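(* Let $n\ge1$ be an integer, $\mathcal{M}$ a subset of $\mathbb{R}^m$, $\Omega\subset\mathbb{R}^N$ an open set and $D\subset\Omega$ an $\mathcal{H}^{N-1}$ $\sigma$-finite Borel set. Let $q_1,q_2,q_3\ge1$, $p\ge1$, and let $F$ be a continuous real-valued function defined on $$\big\{\mathbb{R}^{k\times N^{n+1}}\times\mathbb{R}^{d\times N^{n+1}}\times\mathbb{R}^{m\times N^n}\big\}\times\ldots\times\big\{\mathbb{R}^{k\times N\times N}\times\mathbb{R}^{d\times N\times N}\times\mathbb{R}^{m\times N}\big\}\times\big\{\mathbb{R}^{k\times N}\times\mathbb{R}^{d\times N}\times\mathbb{R}^m\big\}\times\mathbb{R}^N,$$ satisfying $F\ge0$ and the following property: for every $x_0\in\Omega$ and every $\tau>0$ there exists $\alpha>0$ such that $$F(a_1,\ldots,a_n,b,x)-F(a_1,\ldots,a_n,b,x_0)\ge-\tau F(a_1,\ldots,a_n,b,x_0)$$ for all $a_1\in\mathbb{R}^{k\times N^{n+1}}\times\mathbb{R}^{d\times N^{n+1}}\times\mathbb{R}^{m\times N^n}$, $\ldots$, $a_n\in\mathbb{R}^{k\times N\times N}\times\mathbb{R}^{d\times N\times N}\times\mathbb{R}^{m\times N}$, all $b\in\mathbb{R}^{k\times N}\times\mathbb{R}^{d\times N}\times\mathbb{R}^m$ and all $x\in\mathbb{R}^N$ with $|x-x_0|<\alpha$. Let $v\in W^{1,q_1}_{loc}(\Omega,\mathbb{R}^k)$, $\bar m\in L^{q_2}_{loc}(\Omega,\mathbb{R}^{d\times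 N})$ and $\varphi\in L^{q_3}_{loc}(\Omega,\mathbb{R}^m)$ be such that $\mathrm{div}\,\bar m\equiv0$ in $\Omega$ and $$F\big(0,0,\ldots,0,\{\nabla v,\bar m,\varphi\},x\big)=0\quad\text{a.e. in }\Omega.$$ Assume also that there exist Borel mappings $\{\nabla v\}^\pm:D\to\mathbb{R}^{k\times N}$, $\bar m^\pm:D\to\mathbb{R}^{d\times N}$, $\varphi^\pm:D\to\mathbb{R}^m$ and $\vec n:D\to S^{N-1}$ such that for every $x\in D$, and for each choice of the sign $\pm$, $$\lim_{\rho\to0^+}\frac1{\mathcal{L}^N(B_\rho(x))}\int_{B_\rho^\pm(x,\vec n(x))}\Big(\big|\nabla v(y)-\{\nabla v\}^\pm(x)\big|^{q_1}+\big|\bar m(y)-\bar m^\pm(x)\big|^{q_2}+\big|\varphi(y)-\varphi^\pm(x)\big|^{q_3}\Big)dy=0 .$$ Then for every $\{v_\varepsilon\}_{\varepsilon>0}\subset W^{1,q_1}_{loc}(\Omega,\mathbb{R}^k)\cap W^{n+1,p}_{loc}(\Omega,\mathbb{R}^k)$, $\{m_\varepsilon\}_{\varepsilon>0}\subset L^{q_2}_{loc}(\Omega,\mathbb{R}^{d\times N})\cap W^{n,p}_{loc}(\Omega,\mathbb{R}^{d\times N})$ and $\{\psi_\varepsilon\}_{\varepsilon>0}\subset L^{q_3}_{loc}(\Omega,\mathbb{R}^m)\cap W^{n,p}_{loc}(\Omega,\mathbb{R}^m)$ satisfying $\mathrm{div}\,m_\varepsilon\equiv0$ in $\Omega$, $\psi_\varepsilon(x)\in\mathcal{M}$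 for a.e. $x\in\Omega$, $v_\varepsilon\to v$ in $W^{1,q_1}_{loc}(\Omega,\mathbb{R}^k)$, $m_\varepsilon\to\bar m$ in $L^{q_2}_{loc}(\Omega,\mathbb{R}^{d\times N})$ and $\psi_\varepsilon\to\varphi$ in $L^{q_3}_{loc}(\Omega,\mathbb{R}^m)$ as $\varepsilon\to0^+$, we have $$\liminf_{\varepsilon\to0^+}\int_\Omega\frac1\varepsilon F\Big(\big\{\varepsilon^n\nabla^{n+1}v_\varepsilon,\varepsilon^n\nabla^n m_\varepsilon,\varepsilon^n\nabla^n\psi_\varepsilon\big\},\ldots,\big\{\varepsilon\nabla^2v_\varepsilon,\varepsilon\nabla m_\varepsilon,\varepsilon\nabla\psi_\varepsilon\big\},\big\{\nabla v_\varepsilon,m_\varepsilon,\psi_\varepsilon\big\},x\Big)dx$$ $$\ge\ \int_D\bar E^{(n)}_0\Big(\{\nabla v\}^+(x),\bar m^+(x),\varphi^+(x),\{\nabla v\}^-(x),\bar m^-(x),\varphi^-(x),\vec n(x),x\Big)d\mathcal{H}^{N-1}(x),$$ where $\bar E_0^{(n)}$ is the cell functional defined in the context.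
   Context: For a unit vector $\vec\nu\in\mathbb{R}^N$, $I_{\vec\nu}:=\{y\in\mathbb{R}^N:\ |y\cdot\vec\nu_j|<1/2\ \ \forall j=1,\ldots,N\}$, where $\{\vec\nu_1,\ldots,\vec\nu_N\}$ is an orthonormal basis of $\mathbb{R}^N$ with $\vec\nu_1:=\vec\nu$. For constants $V^\pm\in\mathbb{R}^{k\times N}$, $\bar m^\pm\in\mathbb{R}^{d\times N}$, $\varphi^\pm\in\mathbb{R}^m$ (with $V^\pm$ in the role of $\{\nabla v\}^\pm$), let $\sigma(y),\theta(y),\gamma(y)$ equal $V^+,\bar m^+,\varphi^+$ respectively if $y\cdot\vec\nu>0$, and $V^-,\bar m^-,\varphi^-$ respectively if $y\cdot\vec\nu<0$. Then $$\bar E^{(n)}_0\big(V^+,\bar m^+,\varphi^+,V^-,\bar m^-,\varphi^-,\vec\nu,x\big):=\inf\Big\{\liminf_{\varepsilon\to0^+}\int_{I_{\vec\nu}}\frac1\varepsilon F\Big(\big\{\varepsilon^n\nabla^{n+1}\sigma_\varepsilon(y),\varepsilon^n\nabla^n\theta_\varepsilon(y),\varepsilon^n\nabla^n\gamma_\varepsilon(y)\big\},\ldots,\big\{\nabla\sigma_\varepsilon(y),\theta_\varepsilon(y),\gamma_\varepsilon(y)\big\},x\Big)dy\Big\},$$ the infimum being over all families $\sigma_\varepsilon\in W^{1,q_1}(I_{\vec\nu},\mathbb{R}^k)\cap W^{n+1,p}(I_{\vec\nu},\mathbb{R}^k)$, $\theta_\varepsilon\in L^{q_2}(I_{\vec\nu},\mathbb{R}^{d\times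 N})\cap W^{n,p}(I_{\vec\nu},\mathbb{R}^{d\times N})$, $\gamma_\varepsilon\in L^{q_3}(I_{\vec\nu},\mathbb{R}^m)\cap W^{n,p}(I_{\vec\nu},\mathbb{R}^m)$ with values in $\mathcal{M}$, indexed by $\varepsilon>0$, such that $\mathrm{div}\,\theta_\varepsilon\equiv0$ and, as $\varepsilon\to0^+$, $\nabla\sigma_\varepsilon\to\sigma$ in $L^{q_1}(I_{\vec\nu},\mathbb{R}^{k\times N})$, $\theta_\varepsilon\to\theta$ in $L^{q_2}(I_{\vec\nu},\mathbb{R}^{d\times N})$ and $\gamma_\varepsilon\to\gamma$ in $L^{q_3}(I_{\vec\nu},\mathbb{R}^m)$. The divergence of a $d\times N$ matrix field is taken row-wise, in the sense of distributions. $B_\rho(x)$ is the open ball of radius $\rho$ centred at $x$, and $B_\rho^{\pm}(x,\vec n):=\{y\in B_\rho(x):\ \pm(y-x)\cdot\vec n>0\}$. $\mathcal{L}^N$ is Lebesgue measure and $\mathcal{H}^{N-1}$ Hausdorff measure. Here $q_1,q_2,q_3,p$ are scalars. *)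

theory Defs
  imports "HOL-Analysis.Analysis"
begin

section \<open>Hausdorff measure of integer dimension\<close>

text \<open>
  The normalisation makes the \<open>s\<close>-dimensional measure agree with Lebesgue measure on
  \<open>s\<close>-dimensional subspaces. Empty pieces of a cover are singled out because \<open>0 ^ 0 = 1\<close>,
  so that the \<open>0\<close>-dimensional measure is the counting measure. Boundedness of the pieces
  is required because \<^const>\<open>diameter\<close> is only meaningful on bounded sets.
\<close>

definition hausdorff_pre :: "nat \<Rightarrow> real \<Rightarrow> 'a::metric_space set \<Rightarrow> ennreal" where
  "hausdorff_pre s \<delta> A =
     (INF C \<in> {C :: nat \<Rightarrow> 'a set. A \<subseteq> (\<Union>i. C i) \<and> (\<forall>i. bounded (C i) \<and> diameter (C i) \<le> \<delta>)}.
        \<Sum>i. if C i = {} then 0 else ennreal (unit_ball_vol (real s) * (diameter (C i) / 2) ^ s))"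

definition hausdorff_outer :: "nat \<Rightarrow> 'a::metric_space set \<Rightarrow> ennreal" where
  "hausdorff_outer s A = (SUP \<delta> \<in> {0<..}. hausdorff_pre s \<delta> A)"

definition hausdorff_measure :: "nat \<Rightarrow> 'a::metric_space measure" where
  "hausdorff_measure s =
     measure_of UNIV (lambda_system UNIV (Pow UNIV) (hausdorff_outer s)) (hausdorff_outer s)"

lemma hausdorff_pre_mono: "A \<subseteq> B \<Longrightarrow> hausdorff_pre s \<delta> A \<le> hausdorff_pre s \<delta> B"
  unfolding hausdorff_pre_def by (intro INF_superset_mono) auto

lemma hausdorff_pre_empty: "\<delta> > 0 \<Longrightarrow> hausdorff_pre s \<delta> {} = 0"
proof -
  assume "\<delta> > 0"
  then have "hausdorff_pre s \<delta> ({}::'a set) \<le>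
      (\<Sum>i::nat. if {} = ({}::'a set) then 0
          else ennreal (unit_ball_vol (real s) * (diameter ({}::'a set) / 2) ^ s))"
    unfolding hausdorff_pre_def by (intro INF_lower2[where i = "\<lambda>_. {}"]) auto
  then show ?thesis by simp
qed

lemma hausdorff_pre_subadditive:
  fixes A :: "nat \<Rightarrow> 'a::metric_space set"
  shows "hausdorff_pre s \<delta> (\<Union>i. A i) \<le> (\<Sum>i. hausdorff_pre s \<delta> (A i))"
proof (rule ennreal_le_epsilon)
  fix e :: real assume fin: "(\<Sum>i. hausdorff_pre s \<delta> (A i)) < top" and e: "0 < e"
  define w :: "'a set \<Rightarrow> ennreal" where
    "w X = (if X = {} then 0 else ennreal (unit_ball_vol (real s) * (diameter X / 2) ^ s))" for X
  define Cov where
    "Cov B = {C :: nat \<Rightarrow> 'a set. B \<subseteq> (\<Union>i. C i) \<and> (\<forall>i. bounded (C i) \<and> diameter (C i) \<le> \<delta>)}" for B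
  have pre: "hausdorff_pre s \<delta> B = (INF C \<in> Cov B. \<Sum>i. w (C i))" for B
    by (simp add: hausdorff_pre_def w_def Cov_def)
  have "\<exists>C \<in> Cov (A i). (\<Sum>j. w (C j)) \<le> hausdorff_pre s \<delta> (A i) + ennreal (e * (1/2) ^ Suc i)" for i
  proof -
    have "hausdorff_pre s \<delta> (A i) < top"
      by (metis ennreal_suminf_lessD fin)
    moreover have "0 < e * (1/2) ^ Suc i" using e by simp
    ultimately have "hausdorff_pre s \<delta> (A i) < hausdorff_pre s \<delta> (A i) + ennreal (e * (1/2) ^ Suc i)"
      by (metis add.right_neutral ennreal_add_left_cancel_less ennreal_0 ennreal_less_iff order_refl
          infinity_ennreal_def less_top)
    then show ?thesis
      unfolding pre[of "A i"] INF_less_iff by (auto intro: less_imp_le)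
  qed
  then obtain C where C: "\<And>i. C i \<in> Cov (A i)"
    and le: "\<And>i. (\<Sum>j. w (C i j)) \<le> hausdorff_pre s \<delta> (A i) + ennreal (e * (1/2) ^ Suc i)"
    by metis
  define E where "E k = case_prod C (prod_decode k)" for k
  have "E \<in> Cov (\<Union>i. A i)"
  proof -
    have "x \<in> (\<Union>k. E k)" if "x \<in> A i" for x i
    proof -
      from that C[of i] obtain j where "x \<in> C i j" by (auto simp: Cov_def)
      then have "x \<in> E (prod_encode (i, j))" by (simp add: E_def)
      then show ?thesis by blast
    qed
    moreover have "bounded (E k) \<and> diameter (E k) \<le> \<delta>" for k
      using C by (auto simp: Cov_def E_def split: prod.split)
    ultimately show ?thesis by (auto simp: Cov_def)
  qed
  then have "hausdorff_pre s \<delta> (\<Union>i. A i) \<le> (\<Sum>k. w (E k))"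
    unfolding pre by (rule INF_lower)
  also have "\<dots> = (\<Sum>i. \<Sum>j. w (C i j))"
    using suminf_ennreal_2dimen[of "\<lambda>i. \<Sum>j. w (C i j)" "\<lambda>(i, j). w (C i j)"]
    by (simp add: E_def split_beta)
  also have "\<dots> \<le> (\<Sum>i. hausdorff_pre s \<delta> (A i) + ennreal (e * (1/2) ^ Suc i))"
    by (intro suminf_le le) auto
  also have "\<dots> = (\<Sum>i. hausdorff_pre s \<delta> (A i)) + (\<Sum>i. ennreal (e * (1/2) ^ Suc i))"
    by (rule suminf_add[symmetric]) auto
  also have "(\<Sum>i. ennreal (e * (1/2) ^ Suc i)) = ennreal e"
    using sums_mult[OF power_half_series, of e] e
    by (subst suminf_ennreal_eq[where x = e]) auto
  finally show "hausdorff_pre s \<delta> (\<Union>i. A i) \<le> (\<Sum>i. hausdorff_pre s \<delta> (A i)) + ennreal e" .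
qed

lemma outer_measure_space_hausdorff:
  "outer_measure_space (Pow UNIV) (hausdorff_outer s :: 'a::metric_space set \<Rightarrow> ennreal)"
  unfolding outer_measure_space_def
proof (intro conjI)
  show "positive (Pow UNIV) (hausdorff_outer s)"
    unfolding positive_def hausdorff_outer_def
    by (metis (no_types, lifting) SUP_cong SUP_bot bot_ennreal greaterThan_iff hausdorff_pre_empty)
  show "increasing (Pow UNIV) (hausdorff_outer s)"
    unfolding increasing_def hausdorff_outer_def by (auto intro!: SUP_mono' hausdorff_pre_mono)
  show "countably_subadditive (Pow UNIV) (hausdorff_outer s :: 'a set \<Rightarrow> ennreal)"
    unfolding countably_subadditive_def
  proof (intro allI impI)
    fix A :: "nat \<Rightarrow> 'a set"
    show "hausdorff_outer s (\<Union>i. A i) \<le> (\<Sum>i. hausdorff_outer s (A i))"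
      unfolding hausdorff_outer_def[of s "\<Union>i. A i"]
    proof (rule SUP_least)
      fix \<delta> :: real assume "\<delta> \<in> {0<..}"
      then have "hausdorff_pre s \<delta> (A i) \<le> hausdorff_outer s (A i)" for i
        unfolding hausdorff_outer_def by (rule SUP_upper)
      then show "hausdorff_pre s \<delta> (\<Union>i. A i) \<le> (\<Sum>i. hausdorff_outer s (A i))"
        by (intro order_trans[OF hausdorff_pre_subadditive] suminf_le) auto
    qed
  qed
qed

lemma measure_space_hausdorff:
  "measure_space UNIV (lambda_system UNIV (Pow UNIV) (hausdorff_outer s))
     (hausdorff_outer s :: 'a::metric_space set \<Rightarrow> ennreal)"
  by (rule sigma_algebra.caratheodory_lemma[OF sigma_algebra_Pow outer_measure_space_hausdorff])

lemma space_hausdorff_measure: "space (hausdorff_measure s) = UNIV"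
  unfolding hausdorff_measure_def by (simp add: space_measure_of_conv)

lemma sets_hausdorff_measure:
  "sets (hausdorff_measure s :: 'a::metric_space measure) =
     lambda_system UNIV (Pow UNIV) (hausdorff_outer s)"
  unfolding hausdorff_measure_def
  by (intro sigma_algebra.sets_measure_of_eq)
     (use measure_space_hausdorff[of s, where 'a = 'a] in \<open>simp add: measure_space_def\<close>)

lemma emeasure_hausdorff_measure:
  fixes A :: "'a::metric_space set"
  shows "A \<in> sets (hausdorff_measure s) \<Longrightarrow> emeasure (hausdorff_measure s) A = hausdorff_outer s A"
  using measure_space_hausdorff[of s, where 'a = 'a] unfolding sets_hausdorff_measure
  by (subst hausdorff_measure_def)
     (auto simp: measure_space_def intro!: emeasure_measure_of_sigma)

section \<open>Lebesgue and Sobolev spaces, distributional derivatives\<close>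

text \<open>
  The Lebesgue classes are predicates on functions rather than spaces of equivalence
  classes, and values outside the set are irrelevant.
\<close>

definition Lp :: "'a::euclidean_space set \<Rightarrow> real \<Rightarrow> ('a \<Rightarrow> 'b::euclidean_space) \<Rightarrow> bool" where
  "Lp S q f \<longleftrightarrow> set_borel_measurable lebesgue S f \<and>
     set_integrable lebesgue S (\<lambda>x. norm (f x) powr q)"

definition Lp_loc :: "'a::euclidean_space set \<Rightarrow> real \<Rightarrow> ('a \<Rightarrow> 'b::euclidean_space) \<Rightarrow> bool" where
  "Lp_loc U q f \<longleftrightarrow> (\<forall>K. compact K \<and> K \<subseteq> U \<longrightarrow> Lp K q f)"

text \<open>Convergence in \<open>L\<^sup>q\<close> of a family indexed by \<open>\<epsilon> > 0\<close>, as \<open>\<epsilon> \<rightarrow> 0\<^sup>+\<close>.\<close>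

definition Lp_tendsto ::
  "'a::euclidean_space set \<Rightarrow> real \<Rightarrow> (real \<Rightarrow> 'a \<Rightarrow> 'b::euclidean_space) \<Rightarrow> ('a \<Rightarrow> 'b) \<Rightarrow> bool" where
  "Lp_tendsto S q f g \<longleftrightarrow>
     ((\<lambda>\<epsilon>. \<integral>\<^sup>+ x\<in>S. ennreal (norm (f \<epsilon> x - g x) powr q) \<partial>lebesgue) \<longlongrightarrow> 0) (at_right 0)"

definition Lp_loc_tendsto ::
  "'a::euclidean_space set \<Rightarrow> real \<Rightarrow> (real \<Rightarrow> 'a \<Rightarrow> 'b::euclidean_space) \<Rightarrow> ('a \<Rightarrow> 'b) \<Rightarrow> bool" where
  "Lp_loc_tendsto U q f g \<longleftrightarrow> (\<forall>K. compact K \<and> K \<subseteq> U \<longrightarrow> Lp_tendsto K q f g)"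

text \<open>
  A list of coordinate directions of length \<open>j\<close> indexes the components of a \<open>j\<close>-th order
  derivative: \<open>[i\<^sub>1, \<dots>, i\<^sub>j]\<close> stands for \<open>\<partial>\<^sub>i\<^sub>1 \<dots> \<partial>\<^sub>i\<^sub>j\<close>.
\<close>

primrec partials :: "'N::finite list \<Rightarrow> (real^'N \<Rightarrow> real) \<Rightarrow> real^'N \<Rightarrow> real" where
  "partials [] f = f"
| "partials (i # I) f = (\<lambda>x. frechet_derivative (partials I f) (at x) (axis i 1))"

definition test_function :: "(real^'N::finite) set \<Rightarrow> (real^'N \<Rightarrow> real) \<Rightarrow> bool" where
  "test_function U f \<longleftrightarrow> (\<forall>I x. partials I f differentiable (at x)) \<and>
     compact (closure {x. f x \<noteq> 0}) \<and> closure {x. f x \<noteq> 0} \<subseteq> U"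

definition is_weak_deriv :: "(real^'N::finite) set \<Rightarrow> 'N list \<Rightarrow>
    (real^'N \<Rightarrow> 'b::euclidean_space) \<Rightarrow> (real^'N \<Rightarrow> 'b) \<Rightarrow> bool" where
  "is_weak_deriv U I f g \<longleftrightarrow> Lp_loc U 1 f \<and> Lp_loc U 1 g \<and>
     (\<forall>\<eta>. test_function U \<eta> \<longrightarrow>
        (LINT x:U|lebesgue. partials I \<eta> x *\<^sub>R f x) =
        (-1) ^ length I *\<^sub>R (LINT x:U|lebesgue. \<eta> x *\<^sub>R g x))"

text \<open>A representative; it is unique up to null sets of \<open>U\<close> whenever a weak derivative exists.\<close>

definition weak_deriv :: "(real^'N::finite) set \<Rightarrow> 'N list \<Rightarrow>
    (real^'N \<Rightarrow> 'b::euclidean_space) \<Rightarrow> real^'N \<Rightarrow> 'b" where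
  "weak_deriv U I f = (SOME g. is_weak_deriv U I f g)"

definition weak_grad :: "(real^'N::finite) set \<Rightarrow>
    (real^'N \<Rightarrow> real^'k::finite) \<Rightarrow> real^'N \<Rightarrow> real^'N^'k" where
  "weak_grad U u x = (\<chi> i j. weak_deriv U [j] u x $ i)"

definition sobolev :: "nat \<Rightarrow> real \<Rightarrow> (real^'N::finite) set \<Rightarrow>
    (real^'N \<Rightarrow> 'b::euclidean_space) \<Rightarrow> bool" where
  "sobolev l q U f \<longleftrightarrow> (\<forall>I. length I \<le> l \<longrightarrow> (\<exists>g. is_weak_deriv U I f g \<and> Lp U q g))"

definition sobolev_loc :: "nat \<Rightarrow> real \<Rightarrow> (real^'N::finite) set \<Rightarrow>
    (real^'N \<Rightarrow> 'b::euclidean_space) \<Rightarrow> bool" where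
  "sobolev_loc l q U f \<longleftrightarrow> (\<forall>I. length I \<le> l \<longrightarrow> (\<exists>g. is_weak_deriv U I f g \<and> Lp_loc U q g))"

text \<open>Row-wise distributional divergence; row \<open>i\<close> of the integral is
  \<open>\<integral>\<^sub>U \<Sum>\<^sub>j \<theta>\<^sub>i\<^sub>j \<partial>\<^sub>j\<eta>\<close>.\<close>

definition div_free :: "(real^'N::finite) set \<Rightarrow> (real^'N \<Rightarrow> real^'N^'d::finite) \<Rightarrow> bool" where
  "div_free U \<theta> \<longleftrightarrow> Lp_loc U 1 \<theta> \<and>
     (\<forall>\<eta>. test_function U \<eta> \<longrightarrow> (LINT x:U|lebesgue. \<theta> x *v (\<chi> j. partials [j] \<eta> x)) = 0)"

section \<open>The energy density and the cell functional\<close>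

text \<open>
  Since \<open>\<nabla>\<^sup>j\<^sup>+\<^sup>1v = \<nabla>\<^sup>j(\<nabla>v)\<close>, a triple in
  \<open>\<real>\<^bsup>k\<times>N^(j+1)\<^esup> \<times> \<real>\<^bsup>d\<times>N^(j+1)\<^esup> \<times> \<real>\<^bsup>m\<times>N^j\<^esup>\<close> is the same as a family, indexed by the
  lists \<open>I\<close> of length \<open>j\<close> over \<open>N\<close>, of elements of
  \<open>\<real>\<^bsup>k\<times>N\<^esup> \<times> \<real>\<^bsup>d\<times>N\<^esup> \<times> \<real>\<^bsup>m\<^esup>\<close>. The arguments \<open>a\<^sub>1, \<dots>, a\<^sub>n\<close> of the density (orders \<open>n, \<dots>, 1\<close>)
  are collected in one function on lists, which vanishes on lists of any other length;
  the product topology on such functions is the Euclidean one.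
\<close>

type_synonym ('N, 'k, 'd, 'm) state = "(real^'N^'k) \<times> (real^'N^'d) \<times> (real^'m)"

type_synonym ('N, 'k, 'd, 'm) density =
  "('N list \<Rightarrow> ('N, 'k, 'd, 'm) state) \<Rightarrow> ('N, 'k, 'd, 'm) state \<Rightarrow> real^'N \<Rightarrow> real"

definition jets :: "nat \<Rightarrow> ('N::finite list \<Rightarrow> 'b::zero) set" where
  "jets n = {a. \<forall>I. length I \<notin> {1..n} \<longrightarrow> a I = 0}"

text \<open>The component \<open>I\<close>, of order \<open>j\<close>, is that of
  \<open>{\<epsilon>\<^sup>j\<nabla>\<^sup>j\<^sup>+\<^sup>1u, \<epsilon>\<^sup>j\<nabla>\<^sup>j\<theta>, \<epsilon>\<^sup>j\<nabla>\<^sup>j\<gamma>}\<close> at \<open>y\<close>.\<close>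

definition scaled_jet :: "nat \<Rightarrow> real \<Rightarrow> (real^'N::finite) set \<Rightarrow>
    (real^'N \<Rightarrow> real^'k::finite) \<Rightarrow> (real^'N \<Rightarrow> real^'N^'d::finite) \<Rightarrow> (real^'N \<Rightarrow> real^'m::finite) \<Rightarrow>
    real^'N \<Rightarrow> 'N list \<Rightarrow> ('N, 'k, 'd, 'm) state" where
  "scaled_jet n \<epsilon> U u \<theta> \<gamma> y I =
     (if length I \<in> {1..n}
      then \<epsilon> ^ length I *\<^sub>R
        ((\<chi> i j. weak_deriv U (I @ [j]) u y $ i), weak_deriv U I \<theta> y, weak_deriv U I \<gamma> y)
      else 0)"

definition orthonormal_basis :: "'a::euclidean_space set \<Rightarrow> bool" where
  "orthonormal_basis B \<longleftrightarrow> pairwise orthogonal B \<and> (\<forall>b\<in>B. norm b = 1) \<and> span B = UNIV"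

definition unit_cube :: "'a::euclidean_space set \<Rightarrow> 'a set" where
  "unit_cube B = {y. \<forall>b\<in>B. \<bar>y \<bullet> b\<bar> < 1/2}"

text \<open>
  The argument \<open>B\<close> is the orthonormal basis containing \<open>\<nu>\<close> that is used to form the cube, which is
  not determined by \<open>\<nu>\<close> alone in dimension at least three. The constants \<open>Vp, mp, \<phi>p\<close> and
  \<open>Vm, mm, \<phi>m\<close> are the values on the sides \<open>y \<bullet> \<nu> > 0\<close> and \<open>y \<bullet> \<nu> < 0\<close>; the null set
  \<open>y \<bullet> \<nu> = 0\<close> is irrelevant.
\<close>

definition cell_functional :: "nat \<Rightarrow> real \<Rightarrow> real \<Rightarrow> real \<Rightarrow> real \<Rightarrow> (real^'m) set \<Rightarrow>
    ('N::finite, 'k::finite, 'd::finite, 'm::finite) density \<Rightarrow> (real^'N) set \<Rightarrow>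
    real^'N^'k \<Rightarrow> real^'N^'d \<Rightarrow> real^'m \<Rightarrow> real^'N^'k \<Rightarrow> real^'N^'d \<Rightarrow> real^'m \<Rightarrow>
    real^'N \<Rightarrow> real^'N \<Rightarrow> ennreal" where
  "cell_functional n p q\<^sub>1 q\<^sub>2 q\<^sub>3 M F B Vp mp \<phi>p Vm mm \<phi>m \<nu> x =
     (let Q = unit_cube B in
      Inf {Liminf (at_right 0) (\<lambda>\<epsilon>. \<integral>\<^sup>+ y\<in>Q. ennreal (1 / \<epsilon> *
             F (scaled_jet n \<epsilon> Q (\<sigma> \<epsilon>) (\<theta> \<epsilon>) (\<gamma> \<epsilon>) y)
               (weak_grad Q (\<sigma> \<epsilon>) y, \<theta> \<epsilon> y, \<gamma> \<epsilon> y) x) \<partial>lebesgue) | \<sigma> \<theta> \<gamma>.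
        (\<forall>\<epsilon>>0. sobolev 1 q\<^sub>1 Q (\<sigma> \<epsilon>) \<and> sobolev (n + 1) p Q (\<sigma> \<epsilon>) \<and>
               Lp Q q\<^sub>2 (\<theta> \<epsilon>) \<and> sobolev n p Q (\<theta> \<epsilon>) \<and>
               Lp Q q\<^sub>3 (\<gamma> \<epsilon>) \<and> sobolev n p Q (\<gamma> \<epsilon>) \<and>
               (AE y\<in>Q in lebesgue. \<gamma> \<epsilon> y \<in> M) \<and> div_free Q (\<theta> \<epsilon>)) \<and>
        Lp_tendsto Q q\<^sub>1 (\<lambda>\<epsilon>. weak_grad Q (\<sigma> \<epsilon>)) (\<lambda>y. if y \<bullet> \<nu> > 0 then Vp else Vm) \<and>
        Lp_tendsto Q q\<^sub>2 \<theta> (\<lambda>y. if y \<bullet> \<nu> > 0 then mp else mm) \<and>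
        Lp_tendsto Q q\<^sub>3 \<gamma> (\<lambda>y. if y \<bullet> \<nu> > 0 then \<phi>p else \<phi>m)})"

definition half_ball :: "'a::euclidean_space \<Rightarrow> real \<Rightarrow> 'a \<Rightarrow> 'a set" where
  "half_ball x \<rho> \<nu> = {y \<in> ball x \<rho>. (y - x) \<bullet> \<nu> > 0}"

end

theory Submission
  imports Defs "HOL-Real_Asymp.Real_Asymp"
begin

text \<open>
  Let \<open>\<mu>\<^sub>\<epsilon>\<close> be the measure on \<open>\<Omega>\<close> whose density is the integrand on the left-hand side. The set
  function \<open>W \<mapsto> liminf \<mu>\<^sub>\<epsilon> W\<close> is monotone and superadditive on disjoint sets, and this suffices for
  the density comparison with the Hausdorff measure: if it is at least \<open>t\<close> times
  \<open>unit_ball_vol (N - 1) * \<rho> ^ (N - 1)\<close> on all small balls of radius \<open>\<rho>\<close> centred at points of \<open>A\<close>,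
  then it is at least \<open>t\<close> times the Hausdorff measure of \<open>A\<close> on every open set containing \<open>A\<close>. No
  limit measure is needed.

  The lower density at \<open>x \<in> D\<close> is found by blow-up. The disc in which a small ball around \<open>x\<close> meets
  the hyperplane through \<open>x\<close> orthogonal to \<open>nu x\<close> is filled up to a small part by disjoint cubes
  of equal side length, rotated as \<open>basis_of (nu x)\<close>. Rescaled to the unit cube, the given functions
  are competitors for the cell problem at \<open>x\<close>; hence each cube of side \<open>s\<close> carries, asymptotically,
  at least \<open>s ^ (N - 1)\<close> times the cell functional. As \<^const>\<open>weak_deriv\<close> is a choice of
  representative, the rescaling rests on the a.e. uniqueness of weak derivatives.
\<close>

section \<open>Comparison with the Hausdorff measure\<close>

text \<open>The cell problem prescribes convergence on the cube and no boundary values, so the given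
  functions restricted to a small cube compete as they stand, without cut-off or gluing. With
  \<open>(1 / s) *\<^sub>R v (c + s *\<^sub>R y)\<close> in place of \<open>v\<close> the gradient
  keeps its values, jets with parameter \<epsilon> become jets with parameter \<epsilon> / s, and 1
  / \<epsilon> against the Jacobian s ^ N leaves s ^ (N - 1), the weight of an (N - 1)-dimensional
  measure. The dependence of \<open>F\<close> on \<open>x\<close> is frozen at the centre at the
  price of a factor 1 - \<tau>. The obstacle is a mismatch of shapes: the cell problem lives on
  cubes turned by the normal, the covering argument on balls. The cubes are centred on the
  hyperplane, so that all of them see the same jump, and their size relative to the ball is fixed
  before the radius tends to 0, so that averages over half balls control averages over cubes.
  Filling the disc produces the constant \<open>unit_ball_vol (N - 1)\<close> of the Hausdorff
  measure. Neither a bound on the energies nor measurability of the cell functional in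
  \<open>x\<close> is at hand; hence all estimates concern lower limits and lower integrals.\<close>

lemma suminf_tail_small_ennreal:
  fixes f :: "nat \<Rightarrow> ennreal"
  assumes fin: "(\<Sum>i. f i) < top" and e: "0 < e"
  obtains n where "(\<Sum>i. f (i + n)) < e"
proof -
  have off: "(\<Sum>i. f i) = (\<Sum>i. f (i + n)) + (\<Sum>i<n. f i)" for n
    by (rule suminf_offset) auto
  have "(\<lambda>n. \<Sum>i<n. f i) \<longlonglongrightarrow> (\<Sum>i. f i)"
    by (rule summable_LIMSEQ) auto
  have T: "(\<lambda>n. (\<Sum>i. f i) - (\<Sum>i<n. f i)) \<longlonglongrightarrow> (\<Sum>i. f i) - (\<Sum>i. f i)"
    by (intro tendsto_diff_ennreal tendsto_const summable_LIMSEQ) (use fin in auto)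
  have "(\<Sum>i. f i) - (\<Sum>i<n. f i) = (\<Sum>i. f (i + n))" for n
  proof -
    have "(\<Sum>i<n. f i) \<noteq> top"
      using off[of n] fin by (metis add_top ennreal_add_eq_top less_irrefl)
    then show ?thesis
      using off[of n] by (simp add: ennreal_add_diff_cancel_right)
  qed
  moreover have "(\<Sum>i. f i) - (\<Sum>i. f i) = 0"
    using fin by (simp add: ennreal_minus_eq_0)
  ultimately have "(\<lambda>n. \<Sum>i. f (i + n)) \<longlonglongrightarrow> 0"
    using T by simp
  then have "eventually (\<lambda>n. (\<Sum>i. f (i + n)) < e) sequentially"
    using e order_tendstoD(2) by blast
  then show ?thesis
    using that by (auto simp: eventually_sequentially)
qed

text \<open>\<open>Liminf\<close> is a supremum, over eventual predicates, of infima. These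
  predicates are directed under conjunction, so the sum of the two suprema is a supremum over a
  common predicate, and there infima add up in the right direction.\<close>

lemma Liminf_add_Liminf_le_ennreal:
  fixes f g :: "'e \<Rightarrow> ennreal"
  shows "Liminf F f + Liminf F g \<le> Liminf F (\<lambda>e. f e + g e)"
proof -
  have ne: "{P. eventually P F} \<noteq> {}"
    by (auto intro: exI[of _ "\<lambda>_. True"])
  have "Liminf F f + Liminf F g
      = (SUP P\<in>{P. eventually P F}. Inf (f ` Collect P) + Inf (g ` Collect P))"
    unfolding Liminf_def
  proof (rule SUP_add_directed_ennreal[symmetric])
    fix P Q assume "P \<in> {P. eventually P F}" "Q \<in> {P. eventually P F}"
    then show "\<exists>R\<in>{P. eventually P F}.
        Inf (f ` Collect P) + Inf (g ` Collect Q) \<le> Inf (f ` Collect R) + Inf (g ` Collect R)"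
      by (intro bexI[of _ "\<lambda>x. P x \<and> Q x"] add_mono INF_superset_mono)
        (auto intro: eventually_conj)
  qed
  also have "\<dots> \<le> Liminf F (\<lambda>e. f e + g e)"
    unfolding Liminf_def
    by (intro SUP_mono bexI) (auto intro!: INF_greatest add_mono INF_lower)
  finally show ?thesis .
qed

lemma sum_Liminf_le_ennreal:
  fixes f :: "'i \<Rightarrow> 'e \<Rightarrow> ennreal"
  assumes "finite I"
  shows "(\<Sum>i\<in>I. Liminf F (f i)) \<le> Liminf F (\<lambda>e. \<Sum>i\<in>I. f i e)"
  using assms
proof (induction I rule: finite_induct)
  case (insert i I)
  have "(\<Sum>i\<in>insert i I. Liminf F (f i)) \<le> Liminf F (f i) + Liminf F (\<lambda>e. \<Sum>i\<in>I. f i e)"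
    using insert by (simp add: add_left_mono)
  also have "\<dots> \<le> Liminf F (\<lambda>e. f i e + (\<Sum>i\<in>I. f i e))"
    by (rule Liminf_add_Liminf_le_ennreal)
  finally show ?case
    using insert by simp
qed simp

section \<open>The Hausdorff outer measure as a metric outer measure\<close>

lemma hausdorff_pre_antimono: "\<delta> \<le> \<delta>' \<Longrightarrow> hausdorff_pre s \<delta>' A \<le> hausdorff_pre s \<delta> A"
  unfolding hausdorff_pre_def by (intro INF_superset_mono) (auto intro: order_trans)

text \<open>An increasing sequence of approximations replaces the supremum over all scales, so that
  suprema commute with sums. The summand 2 keeps every scale strictly below \<open>d\<close>, as the
  argument for separated sets demands.\<close>

lemma hausdorff_outer_eq_SUP:
  assumes "d > 0"
  shows "hausdorff_outer s A = (SUP n::nat. hausdorff_pre s (d / (real n + 2)) A)"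
proof (rule antisym)
  show "hausdorff_outer s A \<le> (SUP n::nat. hausdorff_pre s (d / (real n + 2)) A)"
    unfolding hausdorff_outer_def
  proof (rule SUP_mono)
    fix \<delta> :: real assume "\<delta> \<in> {0<..}"
    obtain n :: nat where "d / \<delta> < real n" using reals_Archimedean2 by blast
    then have "d / (real n + 2) \<le> \<delta>"
      using \<open>\<delta> \<in> {0<..}\<close> assms by (simp add: field_simps add_increasing2)
    then show "\<exists>n\<in>UNIV. hausdorff_pre s \<delta> A \<le> hausdorff_pre s (d / (real n + 2)) A"
      using hausdorff_pre_antimono by blast
  qed
  show "(SUP n::nat. hausdorff_pre s (d / (real n + 2)) A) \<le> hausdorff_outer s A"
    unfolding hausdorff_outer_def
    by (rule SUP_mono) (use assms in \<open>auto intro!: bexI[of _ "d / (real _ + 2)"]\<close>)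
qed

lemma hausdorff_outer_mono: "A \<subseteq> B \<Longrightarrow> hausdorff_outer s A \<le> hausdorff_outer s B"
  unfolding hausdorff_outer_def by (auto intro!: SUP_mono' hausdorff_pre_mono)

lemma hausdorff_outer_empty: "hausdorff_outer s {} = 0"
  using outer_measure_space_hausdorff[of s]
  by (auto simp: outer_measure_space_def positive_def)

text \<open>\<open>countably_subadditive\<close> speaks of disjoint families only;
  \<open>disjointed\<close> and monotonicity remove this restriction.\<close>

lemma hausdorff_outer_Union_le:
  fixes A :: "nat \<Rightarrow> 'a::metric_space set"
  shows "hausdorff_outer s (\<Union>i. A i) \<le> (\<Sum>i. hausdorff_outer s (A i))"
proof -
  have "hausdorff_outer s (\<Union>i. A i) = hausdorff_outer s (\<Union>i. disjointed A i)"
    by (simp add: UN_disjointed_eq)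
  also have "\<dots> \<le> (\<Sum>i. hausdorff_outer s (disjointed A i))"
    using outer_measure_space_hausdorff[of s, where 'a = 'a] disjoint_family_disjointed[of A]
    by (simp add: outer_measure_space_def countably_subadditive_def)
  also have "\<dots> \<le> (\<Sum>i. hausdorff_outer s (A i))"
    by (intro suminf_le hausdorff_outer_mono disjointed_subset) auto
  finally show ?thesis .
qed

lemma hausdorff_outer_Un_le:
  fixes A B :: "'a::metric_space set"
  shows "hausdorff_outer s (A \<union> B) \<le> hausdorff_outer s A + hausdorff_outer s B"
proof -
  have "hausdorff_outer s (A \<union> B) = hausdorff_outer s (\<Union>i. binaryset A B i)"
    by (simp add: UN_binaryset_eq)
  also have "\<dots> \<le> (\<Sum>i. hausdorff_outer s (binaryset A B i))"
    by (rule hausdorff_outer_Union_le)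
  also have "\<dots> = hausdorff_outer s A + hausdorff_outer s B"
    by (rule suminf_binaryset_eq) (simp add: hausdorff_outer_empty)
  finally show ?thesis .
qed

text \<open>A piece of diameter below \<open>d\<close> cannot meet both sets, so every fine cover of
  the union splits into a cover of \<open>S\<close> and a cover of \<open>T\<close>. This is the
  defining property of a metric outer measure.\<close>

lemma hausdorff_outer_separated:
  fixes S T :: "'a::metric_space set"
  assumes d: "d > 0" and sep: "\<And>x y. x \<in> S \<Longrightarrow> y \<in> T \<Longrightarrow> d \<le> dist x y"
  shows "hausdorff_outer s S + hausdorff_outer s T \<le> hausdorff_outer s (S \<union> T)"
proof -
  have pre: "hausdorff_pre s \<delta> S + hausdorff_pre s \<delta> T \<le> hausdorff_pre s \<delta> (S \<union> T)"
    if "0 < \<delta>" "\<delta> < d" for \<delta>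
    unfolding hausdorff_pre_def[of s \<delta> "S \<union> T"]
  proof (rule INF_greatest)
    fix C :: "nat \<Rightarrow> 'a set"
    assume "C \<in> {C. S \<union> T \<subseteq> (\<Union>i. C i) \<and> (\<forall>i. bounded (C i) \<and> diameter (C i) \<le> \<delta>)}"
    then have cov: "S \<union> T \<subseteq> (\<Union>i. C i)" and C: "\<And>i. bounded (C i)" "\<And>i. diameter (C i) \<le> \<delta>"
      by auto
    define w :: "'a set \<Rightarrow> ennreal" where
      "w X = (if X = {} then 0 else ennreal (unit_ball_vol (real s) * (diameter X / 2) ^ s))" for X
    \<comment> \<open>Pieces that miss \<open>X\<close> become empty; empty pieces have weight 0
      even for \<open>s = 0\<close>, so dropping them this way costs nothing.\<close>
    define P where "P X i = (if C i \<inter> X = {} then {} else C i)" for X i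
    have le: "hausdorff_pre s \<delta> X \<le> (\<Sum>i. w (P X i))" if "X \<subseteq> S \<union> T" for X
      unfolding hausdorff_pre_def w_def
    proof (rule INF_lower, intro CollectI conjI allI)
      show "X \<subseteq> (\<Union>i. P X i)"
      proof
        fix x assume "x \<in> X"
        then obtain i where "x \<in> C i" using cov \<open>X \<subseteq> S \<union> T\<close> by blast
        then have "x \<in> P X i" using \<open>x \<in> X\<close> by (auto simp: P_def)
        then show "x \<in> (\<Union>i. P X i)" by blast
      qed
      show "bounded (P X i)" "diameter (P X i) \<le> \<delta>" for i
        using C \<open>0 < \<delta>\<close> by (auto simp: P_def)
    qed
    have "C i \<inter> S = {} \<or> C i \<inter> T = {}" for i
    proof (rule ccontr)
      assume "\<not> ?thesis"
      then obtain x y where "x \<in> C i" "x \<in> S" "y \<in> C i" "y \<in> T" by blast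
      then have "dist x y \<le> \<delta>" "d \<le> dist x y"
        using diameter_bounded_bound[OF C(1)] C(2) sep order_trans by blast+
      then show False using that by simp
    qed
    then have "w (P S i) + w (P T i) \<le> w (C i)" for i
      by (cases "C i \<inter> S = {}"; cases "C i \<inter> T = {}") (auto simp: P_def w_def)
    then have "(\<Sum>i. w (P S i)) + (\<Sum>i. w (P T i)) \<le> (\<Sum>i. w (C i))"
      by (subst suminf_add) (auto intro!: suminf_le)
    then show "hausdorff_pre s \<delta> S + hausdorff_pre s \<delta> T
        \<le> (\<Sum>i. if C i = {} then 0 else ennreal (unit_ball_vol (real s) * (diameter (C i) / 2) ^ s))"
      unfolding w_def[symmetric] using le[of S] le[of T] by (auto intro: add_mono order_trans)
  qed
  have inc: "incseq (\<lambda>n::nat. hausdorff_pre s (d / (real n + 2)) X)" for X :: "'a set"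
    by (intro incseq_SucI hausdorff_pre_antimono) (use d in \<open>simp add: field_simps\<close>)
  have "hausdorff_outer s S + hausdorff_outer s T =
      (SUP n::nat. hausdorff_pre s (d / (real n + 2)) S + hausdorff_pre s (d / (real n + 2)) T)"
    unfolding hausdorff_outer_eq_SUP[OF d] by (rule ennreal_SUP_add[symmetric, OF inc inc])
  also have "\<dots> \<le> hausdorff_outer s (S \<union> T)"
    unfolding hausdorff_outer_eq_SUP[OF d]
    by (intro SUP_mono' pre) (use d in \<open>auto simp: field_simps add_pos_nonneg\<close>)
  finally show ?thesis .
qed

text \<open>The separating distance may shrink with \<open>k\<close>: each set only has to stay away
  from its finitely many predecessors. Partial sums are handled by induction, with a bound that does
  not depend on their length.\<close>

lemma hausdorff_outer_sum_separated:
  fixes T :: "nat \<Rightarrow> 'a::metric_space set"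
  assumes "\<And>k. \<exists>d>0. \<forall>j<k. \<forall>x\<in>T j. \<forall>y\<in>T k. d \<le> dist x y"
  shows "(\<Sum>k. hausdorff_outer s (T k)) \<le> hausdorff_outer s (\<Union>k. T k)"
proof (rule suminf_le_const)
  show "(\<Sum>k<n. hausdorff_outer s (T k)) \<le> hausdorff_outer s (\<Union>k. T k)" for n
  proof -
    have "(\<Sum>k<n. hausdorff_outer s (T k)) \<le> hausdorff_outer s (\<Union>k<n. T k)"
    proof (induction n)
      case (Suc n)
      obtain d where d: "d > 0" "\<And>j x y. j < n \<Longrightarrow> x \<in> T j \<Longrightarrow> y \<in> T n \<Longrightarrow> d \<le> dist x y"
        using assms[of n] by blast
      have "(\<Sum>k<Suc n. hausdorff_outer s (T k))
          \<le> hausdorff_outer s (\<Union>k<n. T k) + hausdorff_outer s (T n)"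
        using Suc by (simp add: add_right_mono)
      also have "\<dots> \<le> hausdorff_outer s ((\<Union>k<n. T k) \<union> T n)"
        by (rule hausdorff_outer_separated[OF d(1)]) (use d(2) in auto)
      also have "(\<Union>k<n. T k) \<union> T n = (\<Union>k<Suc n. T k)"
        by (auto simp: less_Suc_eq)
      finally show ?case .
    qed simp
    also have "\<dots> \<le> hausdorff_outer s (\<Union>k. T k)"
      by (rule hausdorff_outer_mono) auto
    finally show ?thesis .
  qed
qed auto

text \<open>The complement of \<open>C\<close> is exhausted by shells around \<open>C\<close>; every second shell is separated from
  the previous ones.\<close>

lemma closed_in_sets_hausdorff_measure:
  fixes C :: "'a::metric_space set"
  assumes "closed C"
  shows "C \<in> sets (hausdorff_measure s)"
proof (cases "C = {}")
  case False
  have "hausdorff_outer s (X \<inter> C) + hausdorff_outer s (X - C) = hausdorff_outer s X" for X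
  proof (rule antisym)
    show "hausdorff_outer s X \<le> hausdorff_outer s (X \<inter> C) + hausdorff_outer s (X - C)"
      using hausdorff_outer_Un_le[of s "X \<inter> C" "X - C"] by (simp add: Int_Diff_Un)
    show "hausdorff_outer s (X \<inter> C) + hausdorff_outer s (X - C) \<le> hausdorff_outer s X"
    proof (cases "hausdorff_outer s X = top")
      case False
      define Y where "Y n = {x \<in> X. 1 / (real n + 1) \<le> infdist x C}" for n
      define R where "R n = {x \<in> X. 1 / (real n + 2) \<le> infdist x C \<and> infdist x C < 1 / (real n + 1)}" for n
      have *: "(\<Sum>k. hausdorff_outer s (R (2 * k + b))) < top" for b
      proof -
        have "(\<Sum>k. hausdorff_outer s (R (2 * k + b))) \<le> hausdorff_outer s (\<Union>k. R (2 * k + b))"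
        proof (rule hausdorff_outer_sum_separated)
          fix k
          \<comment> \<open>The gap between two ranges of distances from \<open>C\<close>: for
            \<open>j < k\<close> it is at least \<open>1 / (2 * j + b + 2)\<close>, hence at least
            \<open>1 / (2 * k + b)\<close>, on the earlier shell, and less than
            \<open>1 / (2 * k + b + 1)\<close> on the later one.\<close>
          let ?d = "1 / (real (2 * k + b)) - 1 / (real (2 * k + b) + 1)"
          show "\<exists>d>0. \<forall>j<k. \<forall>x\<in>R (2 * j + b). \<forall>y\<in>R (2 * k + b). d \<le> dist x y"
          proof (cases "k = 0")
            case False
            have "?d > 0" using False by (simp add: divide_simps)
            moreover have "?d \<le> dist x y" if "j < k" "x \<in> R (2 * j + b)" "y \<in> R (2 * k + b)" for j x y
            proof -
              have "1 / (real (2 * k + b)) \<le> 1 / (real (2 * j + b) + 2)"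
                using \<open>j < k\<close> by (intro divide_left_mono) auto
              also have "\<dots> \<le> infdist x C" using that by (auto simp: R_def)
              finally have "1 / (real (2 * k + b)) \<le> infdist x C" .
              moreover have "infdist y C < 1 / (real (2 * k + b) + 1)"
                using that by (auto simp: R_def)
              moreover have "infdist x C \<le> infdist y C + dist x y" by (rule infdist_triangle)
              ultimately show ?thesis by linarith
            qed
            ultimately show ?thesis by blast
          qed (auto intro: exI[of _ 1])
        qed
        also have "\<dots> \<le> hausdorff_outer s X" by (rule hausdorff_outer_mono) (auto simp: R_def)
        finally show ?thesis using False by (simp add: less_top order_le_less_trans)
      qed
      have sumR: "(\<Sum>k. hausdorff_outer s (R k)) < top"
      proof -
        have "(\<Sum>k. hausdorff_outer s (R k)) \<le>
            (\<Sum>k. hausdorff_outer s (R (2 * k))) + (\<Sum>k. hausdorff_outer s (R (2 * k + 1)))"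
        proof (rule suminf_le_const)
          fix n
          have "(\<Sum>k<n. hausdorff_outer s (R k)) \<le> (\<Sum>k<2 * n. hausdorff_outer s (R k))"
            by (rule sum_mono2) auto
          also have "\<dots> = (\<Sum>k<n. hausdorff_outer s (R (2 * k))) + (\<Sum>k<n. hausdorff_outer s (R (2 * k + 1)))"
            by (induction n) (simp_all add: ac_simps)
          also have "\<dots> \<le> (\<Sum>k. hausdorff_outer s (R (2 * k))) + (\<Sum>k. hausdorff_outer s (R (2 * k + 1)))"
            by (intro add_mono sum_le_suminf) auto
          finally show "(\<Sum>k<n. hausdorff_outer s (R k)) \<le>
            (\<Sum>k. hausdorff_outer s (R (2 * k))) + (\<Sum>k. hausdorff_outer s (R (2 * k + 1)))" .
        qed auto
        then show ?thesis using *[of 0] *[of 1] by (auto intro: order_le_less_trans)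
      qed
      show ?thesis
      proof (rule ennreal_le_epsilon)
        fix e :: real assume "0 < e"
        \<comment> \<open>Convergence of the series makes the shells close to \<open>C\<close>
          negligible; the rest of \<open>X - C\<close> is \<open>Y n\<close>, which has positive
          distance from \<open>C\<close>.\<close>
        then obtain n where n: "(\<Sum>i. hausdorff_outer s (R (i + n))) < ennreal e"
          using suminf_tail_small_ennreal[OF sumR] by (metis ennreal_less_zero_iff)
        have "X - C \<subseteq> Y n \<union> (\<Union>i. R (i + n))"
        proof
          fix x assume x: "x \<in> X - C"
          then have pos: "infdist x C > 0"
            using infdist_pos_not_in_closed[OF assms \<open>C \<noteq> {}\<close>] by auto
          show "x \<in> Y n \<union> (\<Union>i. R (i + n))"
          proof (cases "1 / (real n + 1) \<le> infdist x C")
            case False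
            define P where "P k \<longleftrightarrow> 1 / (real k + 1) \<le> infdist x C" for k :: nat
            obtain k0 :: nat where "1 / infdist x C < real k0" using reals_Archimedean2 by blast
            then have "P k0" using pos by (simp add: P_def field_simps)
            \<comment> \<open>The first index whose threshold is reached by the distance of
              \<open>x\<close>; it exceeds \<open>n\<close>, and minimality places \<open>x\<close>
              in the shell with index \<open>k - 1\<close>.\<close>
            define k where "k = (LEAST k. P k)"
            have "P k" unfolding k_def using \<open>P k0\<close> by (rule LeastI)
            have "\<not> P n" using False by (simp add: P_def)
            have nP: "\<not> P j" if "j \<le> n" for j
            proof
              assume "P j"
              then have "1 / (real j + 1) \<le> infdist x C" by (simp add: P_def)
              moreover have "1 / (real n + 1) \<le> 1 / (real j + 1)"
                using that by (intro divide_left_mono) auto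
              ultimately show False using False by simp
            qed
            have "n < k" using nP \<open>P k\<close> not_less by blast
            then obtain i where i: "k = Suc (i + n)"
              by (metis add.commute less_iff_Suc_add)
            have "\<not> P (i + n)" using not_less_Least[of "i + n" P] i by (simp add: k_def)
            then have "x \<in> R (i + n)"
              using \<open>P k\<close> x i by (auto simp: R_def P_def algebra_simps)
            then show ?thesis by blast
          qed (use x in \<open>auto simp: Y_def\<close>)
        qed
        then have "hausdorff_outer s (X - C)
            \<le> hausdorff_outer s (Y n) + hausdorff_outer s (\<Union>i. R (i + n))"
          using hausdorff_outer_mono hausdorff_outer_Un_le order_trans by blast
        also have "hausdorff_outer s (\<Union>i. R (i + n)) \<le> ennreal e"
          using hausdorff_outer_Union_le[of s "\<lambda>i. R (i + n)"] n by simp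
        finally have "hausdorff_outer s (X - C) \<le> hausdorff_outer s (Y n) + ennreal e"
          by (simp add: add_left_mono)
        then have "hausdorff_outer s (X \<inter> C) + hausdorff_outer s (X - C)
            \<le> (hausdorff_outer s (X \<inter> C) + hausdorff_outer s (Y n)) + ennreal e"
          by (simp add: add.assoc add_left_mono)
        also have "hausdorff_outer s (X \<inter> C) + hausdorff_outer s (Y n)
            \<le> hausdorff_outer s (X \<inter> C \<union> Y n)"
        proof (rule hausdorff_outer_separated)
          show "0 < 1 / (real n + 1)" by simp
          fix x y assume "x \<in> X \<inter> C" "y \<in> Y n"
          then show "1 / (real n + 1) \<le> dist x y"
            using infdist_le[of x C y] by (auto simp: Y_def dist_commute)
        qed
        also have "\<dots> \<le> hausdorff_outer s X" by (rule hausdorff_outer_mono) (auto simp: Y_def)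
        finally show "hausdorff_outer s (X \<inter> C) + hausdorff_outer s (X - C)
            \<le> hausdorff_outer s X + ennreal e"
          by (simp add: add_right_mono)
      qed
    qed simp
  qed
  then show ?thesis
    unfolding sets_hausdorff_measure
    by (subst algebra.lambda_system_eq[OF sigma_algebra.axioms(1)[OF sigma_algebra_Pow]]) auto
qed simp

section \<open>Borel sets and inner regularity of the Hausdorff measure\<close>

lemma borel_subset_sets_hausdorff_measure:
  "sets borel \<subseteq> sets (hausdorff_measure s :: 'a::metric_space measure)"
proof -
  have "sigma_sets UNIV (Collect closed) \<subseteq> sets (hausdorff_measure s :: 'a measure)"
    using closed_in_sets_hausdorff_measure
    by (intro sigma_algebra.sigma_sets_subset)
      (auto simp: sets.sigma_algebra_axioms[of "hausdorff_measure s", unfolded space_hausdorff_measure])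
  then show ?thesis
    by (simp add: borel_eq_closed)
qed

text \<open>Near-optimal covers at the scales \<open>h n\<close> are replaced by the closures of
  their pieces, which have the same diameters. Intersecting over \<open>n\<close> the unions of
  these closures gives a Borel set that is still covered at each scale for the same cost.\<close>

lemma borel_hull_hausdorff_outer:
  fixes A :: "'a::metric_space set"
  obtains G where "G \<in> sets borel" "A \<subseteq> G" "hausdorff_outer s G = hausdorff_outer s A"
proof (cases "hausdorff_outer s A = top")
  case True
  have "hausdorff_outer s (UNIV :: 'a set) = top"
    using True hausdorff_outer_mono[of A UNIV s] by (simp add: top_unique)
  with True show ?thesis by (intro that[of UNIV]) auto
next
  case False
  define h where "h n = (1 / (real n + 2))" for n :: nat
  have h: "h n > 0" for n by (simp add: h_def)
  define P where "P n C \<longleftrightarrow> A \<subseteq> (\<Union>i. C i) \<and> (\<forall>i. bounded (C i) \<and> diameter (C i) \<le> h n) \<and>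
     (\<Sum>i. if C i = {} then 0 else ennreal (unit_ball_vol (real s) * (diameter (C i) / 2) ^ s))
       < hausdorff_outer s A + ennreal (h n)" for n and C :: "nat \<Rightarrow> 'a set"
  have "\<exists>C. P n C" for n
  proof -
    have "hausdorff_pre s (h n) A \<le> hausdorff_outer s A"
      unfolding hausdorff_outer_def using h by (auto intro: SUP_upper)
    also have "\<dots> < hausdorff_outer s A + ennreal (h n)"
      using False h[of n] by (metis add.right_neutral ennreal_add_left_cancel_less ennreal_0
          ennreal_less_iff order_refl infinity_ennreal_def)
    finally show ?thesis
      unfolding hausdorff_pre_def INF_less_iff P_def by blast
  qed
  then obtain C where "\<And>n. P n (C n)" by metis
  then have C: "\<And>n. A \<subseteq> (\<Union>i. C n i)" "\<And>n i. bounded (C n i)" "\<And>n i. diameter (C n i) \<le> h n"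
    and le: "\<And>n. (\<Sum>i. if C n i = {} then 0 else ennreal (unit_ball_vol (real s) * (diameter (C n i) / 2) ^ s))
       < hausdorff_outer s A + ennreal (h n)"
    unfolding P_def by blast+
  define G where "G = (\<Inter>n. \<Union>i. closure (C n i))"
  have "G \<in> sets borel" unfolding G_def by auto
  moreover have AG: "A \<subseteq> G" unfolding G_def
  proof (rule INF_greatest)
    show "A \<subseteq> (\<Union>i. closure (C n i))" for n
      by (rule order_trans[OF C(1)[of n]]) (intro UN_mono order_refl closure_subset)
  qed
  moreover have "hausdorff_outer s G \<le> hausdorff_outer s A"
  proof -
    have pre: "hausdorff_pre s (h n) G \<le> hausdorff_outer s A + ennreal (h n)" for n
    proof -
      have "hausdorff_pre s (h n) G \<le> (\<Sum>i. if closure (C n i) = {} then 0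
          else ennreal (unit_ball_vol (real s) * (diameter (closure (C n i)) / 2) ^ s))"
        unfolding hausdorff_pre_def using C(2,3)[of n]
        by (intro INF_lower) (auto simp: G_def diameter_closure)
      also have "\<dots> \<le> hausdorff_outer s A + ennreal (h n)"
        using le[of n] by (simp add: diameter_closure[OF C(2)] closure_eq_empty less_imp_le cong: if_cong)
      finally show ?thesis .
    qed
    have "(\<lambda>n. ennreal (h n)) \<longlonglongrightarrow> ennreal 0"
      unfolding h_def by (intro tendsto_ennrealI) real_asymp
    then have "(\<lambda>n. hausdorff_outer s A + ennreal (h n)) \<longlonglongrightarrow> hausdorff_outer s A + 0"
      by (intro tendsto_add tendsto_const) auto
    moreover have "(\<lambda>n. hausdorff_pre s (h n) G) \<longlonglongrightarrow> hausdorff_outer s G"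
      unfolding hausdorff_outer_eq_SUP[OF zero_less_one] h_def
      by (intro LIMSEQ_SUP incseq_SucI hausdorff_pre_antimono) (simp add: field_simps)
    ultimately show ?thesis
      using pre by (auto intro: LIMSEQ_le)
  qed
  ultimately show ?thesis
    using that hausdorff_outer_mono[OF AG] by (metis antisym)
qed

text \<open>Inner regularity is available for finite Borel measures, so it is applied to the
  restriction of the Hausdorff measure to a Borel set of finite measure. Such a set \<open>B\<close>
  inside \<open>A\<close>, of the same measure, is a Borel hull \<open>G\<close> of \<open>A\<close>
  minus a Borel hull of the null set \<open>G - A\<close>.\<close>

lemma compact_inner_hausdorff_measure:
  fixes A :: "'a::euclidean_space set"
  assumes A: "A \<in> sets (hausdorff_measure s)" and fin: "hausdorff_outer s A < top" and e: "0 < (e::real)"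
  obtains K where "compact K" "K \<subseteq> A" "hausdorff_outer s A \<le> hausdorff_outer s K + ennreal e"
proof -
  let ?H = "hausdorff_measure s :: 'a measure"
  note borel = borel_subset_sets_hausdorff_measure[THEN subsetD, of _ s]
  obtain G where G: "G \<in> sets borel" "A \<subseteq> G" "hausdorff_outer s G = hausdorff_outer s A"
    by (rule borel_hull_hausdorff_outer)
  \<comment> \<open>Here measurability of \<open>A\<close> enters: it turns equality of two outer
    measures into a null difference.\<close>
  have GA: "hausdorff_outer s (G - A) = 0"
  proof -
    have "emeasure ?H (G - A) = emeasure ?H G - emeasure ?H A"
      using G A fin by (intro emeasure_Diff) (auto simp: emeasure_hausdorff_measure borel)
    then show ?thesis
      using A G borel[OF G(1)] fin by (simp add: emeasure_hausdorff_measure sets.Diff less_top)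
  qed
  obtain N where N: "N \<in> sets borel" "G - A \<subseteq> N" "hausdorff_outer s N = hausdorff_outer s (G - A)"
    by (rule borel_hull_hausdorff_outer)
  define B where "B = G - N"
  have B: "B \<in> sets borel" "B \<subseteq> A" using G N by (auto simp: B_def)
  have "hausdorff_outer s A \<le> hausdorff_outer s (B \<union> N)"
    using G by (intro hausdorff_outer_mono) (auto simp: B_def)
  also have "\<dots> \<le> hausdorff_outer s B"
    using hausdorff_outer_Un_le[of s B N] N GA by simp
  finally have AB: "hausdorff_outer s A = hausdorff_outer s B"
    using hausdorff_outer_mono[OF B(2)] by (metis antisym)
  define M where "M = distr (density ?H (indicator B)) borel (\<lambda>x. x)"
  have id: "(\<lambda>x. x) \<in> measurable (density ?H (indicator B)) borel"
    using borel by (auto simp: measurable_def space_hausdorff_measure)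
  have M: "emeasure M X = hausdorff_outer s (B \<inter> X)" if "X \<in> sets borel" for X
    using that id B borel[of B] borel[of X] borel[of "B \<inter> X"]
    by (simp add: M_def emeasure_distr space_hausdorff_measure emeasure_density
        nn_integral_indicator' emeasure_hausdorff_measure flip: indicator_inter_arith)
  have "emeasure M B = (SUP K \<in> {K. K \<subseteq> B \<and> compact K}. emeasure M K)"
    using M[of UNIV] AB fin B by (intro inner_regular) (auto simp: M_def)
  moreover have "emeasure M B = hausdorff_outer s A"
    using M[of B] B AB by simp
  moreover have lt: "hausdorff_outer s A < (SUP K \<in> {K. K \<subseteq> B \<and> compact K}. emeasure M K) + ennreal e"
    using calculation fin e by (metis add.right_neutral ennreal_add_left_cancel_less ennreal_0
          ennreal_less_iff order_refl infinity_ennreal_def less_top)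
  ultimately have "\<exists>K. K \<subseteq> B \<and> compact K \<and> hausdorff_outer s A \<le> emeasure M K + ennreal e"
  proof -
    have "hausdorff_outer s A < (SUP K \<in> {K. K \<subseteq> B \<and> compact K}. emeasure M K + ennreal e)"
      using lt by (subst ennreal_SUP_add_left) auto
    then show ?thesis unfolding less_SUP_iff by (auto intro: less_imp_le)
  qed
  then obtain K where K: "K \<subseteq> B" "compact K" "hausdorff_outer s A \<le> emeasure M K + ennreal e"
    by blast
  then have "emeasure M K = hausdorff_outer s K"
    using M[of K] by (simp add: Int_absorb1 borel_compact)
  with K B show ?thesis by (intro that[of K]) auto
qed

section \<open>From lower densities on balls to the Hausdorff measure\<close>

lemma hausdorff_pre_le_diameter:
  assumes "bounded X" "diameter X \<le> \<delta>" "0 < \<delta>"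
  shows "hausdorff_pre s \<delta> X \<le> ennreal (unit_ball_vol (real s) * (diameter X / 2) ^ s)"
proof -
  have "hausdorff_pre s \<delta> X \<le> (\<Sum>i::nat. if (if i = 0 then X else {}) = {} then 0
      else ennreal (unit_ball_vol (real s) * (diameter (if i = 0 then X else {}) / 2) ^ s))"
    unfolding hausdorff_pre_def
    using assms by (intro INF_lower) (auto split: if_splits)
  also have "\<dots> = (\<Sum>i\<in>{0::nat}. if X = {} then 0
      else ennreal (unit_ball_vol (real s) * (diameter X / 2) ^ s))"
    by (subst suminf_finite[of "{0}"]) auto
  also have "\<dots> \<le> ennreal (unit_ball_vol (real s) * (diameter X / 2) ^ s)"
    by auto
  finally show ?thesis .
qed

text \<open>Vitali's covering lemma gives disjoint balls whose fivefold enlargements cover \<open>A\<close>. All but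
  finitely many of them have small total weight, and the points missed by these finitely many balls
  lie in the enlargements of the others, so the factor \<open>5 ^ s\<close> only affects a small remainder.\<close>

lemma hausdorff_outer_le_Liminf:
  fixes M :: "'e \<Rightarrow> 'a::euclidean_space measure" and t :: real
  assumes M: "\<And>e. sets borel \<subseteq> sets (M e)" and U: "open U" and A: "A \<subseteq> U" and t: "t > 0"
    and dens: "\<And>x. x \<in> A \<Longrightarrow> eventually (\<lambda>r. ennreal (t * (unit_ball_vol (real s) * r ^ s))
           \<le> Liminf F (\<lambda>e. emeasure (M e) (cball x r))) (at_right 0)"
  shows "ennreal t * hausdorff_outer s A \<le> Liminf F (\<lambda>e. emeasure (M e) U)"
proof (cases "Liminf F (\<lambda>e. emeasure (M e) U) = top")
  case False
  define L where "L = Liminf F (\<lambda>e. emeasure (M e) U)"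
  have L: "L < top" using False by (simp add: L_def less_top)
  define w where "w r = unit_ball_vol (real s) * r ^ s" for r
  have w0: "0 \<le> w r" if "0 \<le> r" for r using that by (simp add: w_def unit_ball_vol_nonneg)
  have pre: "ennreal t * hausdorff_pre s \<delta> A \<le> L" if \<delta>: "\<delta> > 0" for \<delta>
  proof (rule ennreal_le_epsilon)
    fix e :: real assume e: "0 < e"
    \<comment> \<open>Radii are at most \<open>\<delta> / 10\<close> so that a fivefold enlarged
      ball still has diameter at most \<open>\<delta>\<close> and may occur in a cover for
      \<open>hausdorff_pre s \<delta>\<close>.\<close>
    define K where "K = {(x, r). x \<in> A \<and> 0 < r \<and> r \<le> \<delta> / 10 \<and> cball x r \<subseteq> U \<and>
        ennreal (t * w r) \<le> Liminf F (\<lambda>e. emeasure (M e) (cball x r))}"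
    have K: "0 < snd i \<and> snd i \<le> \<delta> / 10" if "i \<in> K" for i
      using that by (auto simp: K_def)
    obtain C where C: "countable C" "C \<subseteq> K"
      "pairwise (\<lambda>i j. disjnt (cball (fst i) (snd i)) (cball (fst j) (snd j))) C"
      and V: "\<And>i. i \<in> K \<Longrightarrow> \<exists>j. j \<in> C \<and> \<not> disjnt (cball (fst i) (snd i)) (cball (fst j) (snd j)) \<and>
                        cball (fst i) (snd i) \<subseteq> ball (fst j) (5 * snd j)"
      by (rule Vitali_covering_lemma_cballs_balls[OF K, where a = fst]) (blast intro: that)+
    \<comment> \<open>The chosen balls are indexed by natural numbers. Indices outside
      \<open>I\<close> will carry weight 0, which treats finite and infinite \<open>C\<close>
      alike.\<close>
    define I where "I = to_nat_on C ` C"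
    define c where "c = from_nat_into C"
    have c: "c i \<in> C" if "i \<in> I" for i
      using that C(1) by (auto simp: I_def c_def)
    have cinj: "inj_on c I"
      using C(1) by (auto simp: I_def c_def inj_on_def)
    have csurj: "\<exists>i\<in>I. c i = j" if "j \<in> C" for j
      using that C(1) by (auto simp: I_def c_def)
    define r where "r i = snd (c i)" for i
    define a where "a i = fst (c i)" for i
    have r: "0 < r i" "r i \<le> \<delta> / 10" "a i \<in> A" "cball (a i) (r i) \<subseteq> U"
      "ennreal (t * w (r i)) \<le> Liminf F (\<lambda>e. emeasure (M e) (cball (a i) (r i)))" if "i \<in> I" for i
      using subsetD[OF C(2) c[OF that]] by (auto simp: K_def r_def a_def case_prod_unfold)
    have dj: "disjoint_family_on (\<lambda>i. cball (a i) (r i)) I"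
      using C(3) c cinj unfolding disjoint_family_on_def pairwise_def disjnt_def r_def a_def inj_on_def
      by blast
    define f where "f i = (if i \<in> I then ennreal (w (r i)) else 0)" for i
    have sum: "ennreal t * (\<Sum>i. f i) \<le> L"
    proof -
      have "(\<Sum>i<n. ennreal t * f i) \<le> L" for n
      proof -
        have "(\<Sum>i<n. ennreal t * f i) = (\<Sum>i\<in>{..<n} \<inter> I. ennreal (t * w (r i)))"
          using t w0 r(1) by (auto simp: f_def sum.If_cases if_distrib ennreal_mult' less_imp_le
              cong: sum.cong if_cong)
        also have "\<dots> \<le> (\<Sum>i\<in>{..<n} \<inter> I. Liminf F (\<lambda>e. emeasure (M e) (cball (a i) (r i))))"
          by (intro sum_mono r(5)) auto
        also have "\<dots> \<le> Liminf F (\<lambda>e. \<Sum>i\<in>{..<n} \<inter> I. emeasure (M e) (cball (a i) (r i)))"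
          by (rule sum_Liminf_le_ennreal) auto
        also have "\<dots> \<le> L"
          unfolding L_def
        proof (intro Liminf_mono always_eventually allI)
          fix e
          have "(\<Sum>i\<in>{..<n} \<inter> I. emeasure (M e) (cball (a i) (r i)))
              = emeasure (M e) (\<Union>i\<in>{..<n} \<inter> I. cball (a i) (r i))"
            using M dj by (intro sum_emeasure) (auto simp: subset_eq disjoint_family_on_def)
          also have "\<dots> \<le> emeasure (M e) U"
            using M[of e] U r(4) by (intro emeasure_mono) (auto simp: subset_eq)
          finally show "(\<Sum>i\<in>{..<n} \<inter> I. emeasure (M e) (cball (a i) (r i))) \<le> emeasure (M e) U" .
        qed
        finally show ?thesis .
      qed
      then show ?thesis
        unfolding ennreal_suminf_cmult[symmetric] by (intro suminf_le_const) auto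
    qed
    \<comment> \<open>Finiteness of the lower limit makes the weights of the disjoint balls
      summable; without it there would be no small tail.\<close>
    have fin: "(\<Sum>i. f i) < top"
      using sum L t by (cases "(\<Sum>i. f i) = top") (auto simp: ennreal_mult_top less_top)
    \<comment> \<open>Chosen so that the tail, multiplied by \<open>5 ^ s\<close> for the
      enlargement and by \<open>t\<close>, costs at most \<open>e\<close>.\<close>
    have "0 < e / (t * 5 ^ s)" using e t by simp
    then obtain n where n: "(\<Sum>i. f (i + n)) < ennreal (e / (t * 5 ^ s))"
      using suminf_tail_small_ennreal[OF fin] by (metis ennreal_less_zero_iff)
    define E where "E i = (if i \<notin> I then {} else if i < n then cball (a i) (r i) else ball (a i) (5 * r i))" for i
    have "A \<subseteq> (\<Union>i. E i)"
    proof
      fix x assume x: "x \<in> A"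
      show "x \<in> (\<Union>i. E i)"
      proof (rule ccontr)
        assume nx: "x \<notin> (\<Union>i. E i)"
        define Z where "Z = (\<Union>i\<in>{..<n} \<inter> I. cball (a i) (r i))"
        have "closed Z" unfolding Z_def by (intro closed_UN) auto
        have "x \<notin> Z" using nx by (auto simp: Z_def E_def split: if_splits)
        \<comment> \<open>A small ball around \<open>x\<close> avoids the first \<open>n\<close>
          balls, so the ball that Vitali's lemma assigns to it has index at least \<open>n\<close>,
          and its enlargement contains \<open>x\<close>.\<close>
        then have "open (U - Z)" "x \<in> U - Z" using \<open>closed Z\<close> U x A by auto
        then obtain d where d: "d > 0" "cball x d \<subseteq> U - Z"
          using open_contains_cball by blast
        have "eventually (\<lambda>\<rho>. \<rho> < min d (\<delta> / 10) \<and> \<rho> > 0) (at_right 0)"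
          using d \<delta> by (auto simp: eventually_at_right_field intro!: exI[of _ "min d (\<delta> / 10)"])
        with dens[OF x] have "eventually (\<lambda>\<rho>. (\<rho> < min d (\<delta> / 10) \<and> \<rho> > 0) \<and>
            ennreal (t * w \<rho>) \<le> Liminf F (\<lambda>e. emeasure (M e) (cball x \<rho>))) (at_right 0)"
          unfolding w_def by (rule eventually_conj[rotated])
        then obtain \<rho> where \<rho>: "\<rho> < min d (\<delta> / 10)" "\<rho> > 0"
            "ennreal (t * w \<rho>) \<le> Liminf F (\<lambda>e. emeasure (M e) (cball x \<rho>))"
          using eventually_happens[of _ "at_right (0::real)"] by (auto simp: trivial_limit_at_right_real)
        then have sub: "cball x \<rho> \<subseteq> U - Z" using d by (auto simp: subset_eq)
        then have "(x, \<rho>) \<in> K" using \<rho> x by (auto simp: K_def)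
        from V[OF this] obtain j where j: "j \<in> C" "\<not> disjnt (cball x \<rho>) (cball (fst j) (snd j))"
          "cball x \<rho> \<subseteq> ball (fst j) (5 * snd j)" by auto
        obtain i where i: "i \<in> I" "c i = j" using csurj[OF j(1)] by blast
        have "\<not> i < n"
          using j(2) sub i by (fastforce simp: Z_def disjnt_def a_def r_def)
        moreover have "x \<in> ball (a i) (5 * r i)" using subsetD[OF j(3), of x] i \<rho> by (simp add: a_def r_def)
        ultimately show False using nx i by (auto simp: E_def split: if_splits)
      qed
    qed
    then have "hausdorff_pre s \<delta> A \<le> (\<Sum>i. hausdorff_pre s \<delta> (E i))"
      by (rule order_trans[OF hausdorff_pre_mono hausdorff_pre_subadditive])
    also have "\<dots> = (\<Sum>i. hausdorff_pre s \<delta> (E (i + n))) + (\<Sum>i<n. hausdorff_pre s \<delta> (E i))"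
      by (rule suminf_offset) auto
    also have "\<dots> \<le> (\<Sum>i. 5 ^ s * f (i + n)) + (\<Sum>i<n. f i)"
    proof (intro add_mono suminf_le sum_mono)
      fix i
      show "hausdorff_pre s \<delta> (E (i + n)) \<le> 5 ^ s * f (i + n)"
      proof (cases "i + n \<in> I")
        case True
        have "hausdorff_pre s \<delta> (ball (a (i + n)) (5 * r (i + n)))
            \<le> ennreal (unit_ball_vol (real s) * (diameter (ball (a (i + n)) (5 * r (i + n))) / 2) ^ s)"
          using r(1,2)[OF True] \<delta> by (intro hausdorff_pre_le_diameter) auto
        also have "\<dots> = ennreal (5 ^ s * w (r (i + n)))"
          using r(1)[OF True] by (simp add: w_def power_mult_distrib mult_ac)
        also have "\<dots> = 5 ^ s * f (i + n)"
          using True w0 r(1)[OF True] by (simp add: f_def ennreal_mult' less_imp_le flip: ennreal_power)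
        finally show ?thesis using True by (simp add: E_def)
      qed (use \<delta> in \<open>simp add: E_def hausdorff_pre_empty\<close>)
    next
      fix i assume "i \<in> {..<n}"
      show "hausdorff_pre s \<delta> (E i) \<le> f i"
      proof (cases "i \<in> I")
        case True
        have "hausdorff_pre s \<delta> (cball (a i) (r i))
            \<le> ennreal (unit_ball_vol (real s) * (diameter (cball (a i) (r i)) / 2) ^ s)"
          using r(1,2)[OF True] \<delta> by (intro hausdorff_pre_le_diameter) auto
        also have "\<dots> = f i"
          using r(1)[OF True] True by (simp add: w_def f_def)
        finally show ?thesis using True \<open>i \<in> {..<n}\<close> by (simp add: E_def)
      qed (use \<delta> in \<open>simp add: E_def hausdorff_pre_empty\<close>)
    qed auto
    also have "\<dots> \<le> ennreal (e / t) + (\<Sum>i. f i)"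
    proof (intro add_mono)
      have "(\<Sum>i. 5 ^ s * f (i + n)) = 5 ^ s * (\<Sum>i. f (i + n))" by simp
      also have "\<dots> \<le> ennreal (5 ^ s) * ennreal (e / (t * 5 ^ s))"
        using n by (auto intro!: mult_mono simp flip: ennreal_power)
      also have "\<dots> = ennreal (e / t)" using e t by (simp flip: ennreal_mult)
      finally show "(\<Sum>i. 5 ^ s * f (i + n)) \<le> ennreal (e / t)" .
      show "(\<Sum>i<n. f i) \<le> (\<Sum>i. f i)" by (rule sum_le_suminf) auto
    qed
    finally have "ennreal t * hausdorff_pre s \<delta> A \<le> ennreal t * (ennreal (e / t) + (\<Sum>i. f i))"
      by (rule mult_left_mono) simp
    also have "\<dots> = ennreal e + ennreal t * (\<Sum>i. f i)"
      using t e by (simp add: distrib_left flip: ennreal_mult)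
    also have "\<dots> \<le> L + ennreal e" using sum by (simp add: add.commute add_left_mono)
    finally show "ennreal t * hausdorff_pre s \<delta> A \<le> L + ennreal e" .
  qed
  have "ennreal t * hausdorff_outer s A = (SUP \<delta>\<in>{0<..}. ennreal t * hausdorff_pre s \<delta> A)"
    unfolding hausdorff_outer_def by (rule SUP_mult_left_ennreal)
  also have "\<dots> \<le> L" using pre by (intro SUP_least) auto
  finally show ?thesis by (simp add: L_def)
qed simp

text \<open>For a function \<open>g\<close> that need not be measurable, \<^const>\<open>nn_integral\<close> is the lower integral, so only
  measurable simple functions below \<open>g\<close> matter; their level sets are separated by disjoint open
  sets after passing to compact subsets.\<close>

lemma nn_integral_hausdorff_le_Liminf:
  fixes M :: "'e \<Rightarrow> 'a::euclidean_space measure" and g :: "'a \<Rightarrow> ennreal"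
  assumes M: "\<And>e. sets borel \<subseteq> sets (M e)" and U: "open U" and D: "D \<subseteq> U"
    and dens: "\<And>x t. x \<in> D \<Longrightarrow> 0 < t \<Longrightarrow> ennreal t < g x \<Longrightarrow>
         eventually (\<lambda>r. ennreal (t * (unit_ball_vol (real s) * r ^ s))
           \<le> Liminf F (\<lambda>e. emeasure (M e) (cball x r))) (at_right 0)"
  shows "(\<integral>\<^sup>+x\<in>D. g x \<partial>hausdorff_measure s) \<le> Liminf F (\<lambda>e. emeasure (M e) U)"
  unfolding nn_integral_def_finite
proof (rule SUP_least)
  let ?H = "hausdorff_measure s :: 'a measure"
  fix f assume "f \<in> {f. simple_function ?H f \<and> f \<le> (\<lambda>x. g x * indicator D x) \<and> (\<forall>x. f x < top)}"
  then have f: "simple_function ?H f" "\<And>x. f x \<le> g x * indicator D x" "\<And>x. f x < top"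
    by (auto simp: le_fun_def)
  define L where "L V = Liminf F (\<lambda>e. emeasure (M e) V)" for V
  show "integral\<^sup>S ?H f \<le> Liminf F (\<lambda>e. emeasure (M e) U)"
  proof (cases "L U = top")
    case False
    define A where "A c = f -` {c} \<inter> space ?H" for c
    have Ameas: "A c \<in> sets ?H" for c using f(1) by (simp add: A_def simple_functionD)
    \<comment> \<open>The density hypothesis requires a number strictly below \<open>g x\<close>. On
      the level set of a positive \<open>c\<close> one has \<open>x \<in> D\<close> and
      \<open>c \<le> g x\<close>, so any \<open>t\<close> with \<open>ennreal t < c\<close>
      qualifies.\<close>
    have level: "ennreal t * hausdorff_outer s X \<le> L V"
      if "open V" "X \<subseteq> V" "X \<subseteq> A c" "0 < t" "ennreal t < c" for V X c t
      unfolding L_def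
    proof (rule hausdorff_outer_le_Liminf[OF M that(1,2,4)])
      fix x assume "x \<in> X"
      then have "f x = c" using that by (auto simp: A_def)
      then have "x \<in> D" "c \<le> g x"
        using f(2)[of x] that by (auto split: split_indicator_asm)
      then show "\<forall>\<^sub>F r in at_right 0. ennreal (t * (unit_ball_vol (real s) * r ^ s))
          \<le> Liminf F (\<lambda>e. emeasure (M e) (cball x r))"
        using that dens[of x t] by (auto intro: less_le_trans)
    qed
    define R where "R = f ` space ?H - {0}"
    have finR: "finite R" using f(1) by (simp add: R_def simple_functionD)
    have AU: "A c \<subseteq> U" if "c \<in> R" for c
    proof
      fix x assume "x \<in> A c"
      then have "f x \<noteq> 0" using that by (auto simp: A_def R_def)
      then show "x \<in> U" using f(2)[of x] D by (auto split: split_indicator_asm)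
    qed
    \<comment> \<open>A single positive \<open>t\<close> below \<open>c\<close> already bounds the
      measure of the level set by \<open>L U / t\<close>; the compact approximation below relies on
      this finiteness.\<close>
    have fin: "hausdorff_outer s (A c) < top" if c: "c \<in> R" for c
    proof -
      have "0 < c" using c by (auto simp: R_def zero_less_iff_neq_zero)
      then obtain q where q: "0 < q" "q < c" using dense by blast
      then obtain t where t: "q = ennreal t" "0 < t"
        by (cases q rule: ennreal_cases) (auto simp: ennreal_less_zero_iff top_unique)
      have "ennreal t * hausdorff_outer s (A c) \<le> L U"
        using level[OF U AU[OF c], of c t] q t by simp
      then show ?thesis using False t
        by (cases "hausdorff_outer s (A c) = top") (auto simp: ennreal_mult_top less_top top_unique)
    qed
    \<comment> \<open>\<open>V\<close> is left arbitrary for the induction: the compact set split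
      off lies in \<open>V1\<close>, the remaining ones in \<open>V2\<close>, and superadditivity on
      disjoint open sets adds up the two bounds.\<close>
    have packing: "(\<Sum>c\<in>C. ennreal (t c) * hausdorff_outer s (K c)) \<le> L V"
      if "finite C" "open V" "\<And>c. c \<in> C \<Longrightarrow> compact (K c) \<and> K c \<subseteq> V \<and> K c \<subseteq> A c \<and> 0 < t c \<and> ennreal (t c) < c"
      for C V K t
      using that
    proof (induction C arbitrary: V rule: finite_induct)
      case (insert c C)
      have 1: "compact (K c)" using insert.prems by blast
      have 2: "closed (\<Union>c\<in>C. K c)"
        using insert.prems(2) by (intro closed_UN insert.hyps(1) ballI compact_imp_closed) blast
      have sub: "K c' \<subseteq> f -` {c'}" if "c' \<in> insert c C" for c'
        using insert.prems(2)[OF that] by (auto simp: A_def)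
      have 3: "K c \<inter> (\<Union>c\<in>C. K c) = {}"
      proof -
        have "K c \<inter> K c' = {}" if "c' \<in> C" for c'
          using sub[of c] sub[of c'] that insert.hyps(2) by auto
        then show ?thesis by blast
      qed
      obtain V1 V2 where V: "open V1" "compact (closure V1)" "open V2" "K c \<subseteq> V1" "(\<Union>c\<in>C. K c) \<subseteq> V2" "V1 \<inter> V2 = {}"
        using separation_normal_compact[OF 1 2 3] .
      have "ennreal (t c) * hausdorff_outer s (K c) \<le> L (V \<inter> V1)"
        using insert.prems V by (intro level[where c = c]) auto
      moreover have "(\<Sum>c\<in>C. ennreal (t c) * hausdorff_outer s (K c)) \<le> L (V \<inter> V2)"
        using insert.prems V by (intro insert.IH) auto
      moreover have "L (V \<inter> V1) + L (V \<inter> V2) \<le> L V"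
      proof -
        have "L (V \<inter> V1) + L (V \<inter> V2)
            \<le> Liminf F (\<lambda>e. emeasure (M e) (V \<inter> V1) + emeasure (M e) (V \<inter> V2))"
          unfolding L_def by (rule Liminf_add_Liminf_le_ennreal)
        also have "\<dots> \<le> L V"
          unfolding L_def
        proof (intro Liminf_mono always_eventually allI)
          fix e
          have S: "V \<inter> V1 \<in> sets (M e)" "V \<inter> V2 \<in> sets (M e)" "V \<in> sets (M e)"
            using M[of e] V insert.prems(1) by auto
          have "emeasure (M e) (V \<inter> V1) + emeasure (M e) (V \<inter> V2) = emeasure (M e) ((V \<inter> V1) \<union> (V \<inter> V2))"
            using S V by (intro plus_emeasure) auto
          also have "\<dots> \<le> emeasure (M e) V" using S by (intro emeasure_mono) auto
          finally show "emeasure (M e) (V \<inter> V1) + emeasure (M e) (V \<inter> V2) \<le> emeasure (M e) V" .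
        qed
        finally show ?thesis .
      qed
      ultimately show ?case
        using insert.hyps by (simp, meson add_mono order_trans)
    qed simp
    let ?S = "\<Sum>c\<in>R. c * hausdorff_outer s (A c)"
    \<comment> \<open>There are two losses: the factor \<open>1 - \<eta>\<close> makes the numbers
      used on the levels strictly smaller than the values of \<open>f\<close>, and the summand
      \<open>\<eta>\<close> collects the errors of the compact approximation.\<close>
    have main: "ennreal (1 - \<eta>) * ?S \<le> L U + ennreal \<eta>"
      if \<eta>: "0 < \<eta>" "\<eta> < 1" for \<eta> :: real
    proof -
      \<comment> \<open>Scaled so that the \<open>card R\<close> errors, each weighted by at most
        \<open>c\<close>, add up to at most \<open>\<eta>\<close>; the summand 1 keeps the
        denominator positive.\<close>
      define e where "e c = \<eta> / (real (card R) * enn2real c + 1)" for c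
      have e: "e c > 0" for c using \<eta> by (simp add: e_def add_nonneg_pos)
      have "\<exists>K. compact K \<and> K \<subseteq> A c \<and> hausdorff_outer s (A c) \<le> hausdorff_outer s K + ennreal (e c)"
        if "c \<in> R" for c
        by (rule compact_inner_hausdorff_measure[OF Ameas fin[OF that] e]) blast
      then obtain K where K: "\<And>c. c \<in> R \<Longrightarrow> compact (K c) \<and> K c \<subseteq> A c \<and>
          hausdorff_outer s (A c) \<le> hausdorff_outer s (K c) + ennreal (e c)"
        by metis
      define t where "t c = (1 - \<eta>) * enn2real c" for c
      have c: "c = ennreal (enn2real c)" "0 < enn2real c" if "c \<in> R" for c
      proof -
        from that f(3) have "c < top" "c \<noteq> 0" by (auto simp: R_def)
        then show "c = ennreal (enn2real c)" "0 < enn2real c"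
          by (auto simp: enn2real_positive_iff less_top zero_less_iff_neq_zero)
      qed
      have t: "0 < t c" "ennreal (t c) < c" if "c \<in> R" for c
      proof -
        show "0 < t c" using \<eta> c[OF that] by (simp add: t_def)
        have "ennreal (t c) < ennreal (enn2real c)"
          using \<eta> c(2)[OF that] by (simp add: t_def ennreal_less_iff)
        then show "ennreal (t c) < c" using c(1)[OF that] by simp
      qed
      have "ennreal (1 - \<eta>) * ?S
          = (\<Sum>c\<in>R. ennreal (t c) * hausdorff_outer s (A c))"
        using \<eta> c(1) by (auto simp: sum_distrib_left t_def ennreal_mult' mult.assoc intro!: sum.cong)
      also have "\<dots> \<le> (\<Sum>c\<in>R. ennreal (t c) * hausdorff_outer s (K c) + ennreal (\<eta> / card R))"
      proof (rule sum_mono)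
        fix c assume cR: "c \<in> R"
        have "ennreal (t c) * hausdorff_outer s (A c)
            \<le> ennreal (t c) * (hausdorff_outer s (K c) + ennreal (e c))"
          using K[OF cR] by (intro mult_left_mono) auto
        also have "\<dots> = ennreal (t c) * hausdorff_outer s (K c) + ennreal (t c * e c)"
          using t(1)[OF cR] e[of c] by (simp add: distrib_left ennreal_mult less_imp_le)
        also have "t c * e c \<le> \<eta> / card R"
        proof -
          have "t c * e c \<le> enn2real c * e c"
            using \<eta> e[of c] c(2)[OF cR] by (intro mult_right_mono) (auto simp: t_def less_imp_le mult_left_le_one_le)
          also have "\<dots> \<le> \<eta> / card R"
          proof -
            have n: "real (card R) > 0" using cR finR by (auto simp: card_gt_0_iff)
            have "enn2real c * \<eta> * real (card R) \<le> \<eta> * (real (card R) * enn2real c + 1)"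
              using \<eta> by (simp add: algebra_simps)
            then show ?thesis
              using n c(2)[OF cR] by (simp add: e_def divide_simps add_pos_pos mult_ac split: if_splits)
          qed
          finally show ?thesis .
        qed
        finally show "ennreal (t c) * hausdorff_outer s (A c)
            \<le> ennreal (t c) * hausdorff_outer s (K c) + ennreal (\<eta> / card R)"
          by (simp add: add_left_mono ennreal_leI)
      qed
      also have "\<dots> = (\<Sum>c\<in>R. ennreal (t c) * hausdorff_outer s (K c)) + ennreal (card R * (\<eta> / card R))"
        using \<eta> by (simp add: sum.distrib ennreal_mult'' ennreal_of_nat_eq_real_of_nat flip: ennreal_mult)
      also have "\<dots> \<le> L U + ennreal \<eta>"
      proof (intro add_mono packing finR U conjI)
        show "ennreal (card R * (\<eta> / card R)) \<le> ennreal \<eta>" using \<eta> by (auto intro!: ennreal_leI)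
      qed (use K t AU in blast)+
      finally show ?thesis .
    qed
    have "integral\<^sup>S ?H f = (\<Sum>c\<in>f ` space ?H. c * hausdorff_outer s (A c))"
      unfolding simple_integral_def A_def[symmetric] using Ameas by (simp add: emeasure_hausdorff_measure)
    also have "\<dots> = ?S"
      unfolding R_def using f(1) by (intro sum.mono_neutral_right) (auto simp: simple_functionD)
    also have "\<dots> \<le> L U"
    \<comment> \<open>\<open>main\<close> is used with \<open>\<eta> = 1 / (n + 2)\<close>, which
      lies strictly between 0 and 1 for every \<open>n\<close>.\<close>
    proof (rule LIMSEQ_le)
      have "(\<lambda>n. ennreal (1 - 1 / (real n + 2))) \<longlonglongrightarrow> ennreal 1"
        by (intro tendsto_ennrealI) real_asymp
      then show "(\<lambda>n. ennreal (1 - 1 / (real n + 2)) * ?S) \<longlonglongrightarrow> ?S"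
        using tendsto_mult_ennreal[of "\<lambda>n. ennreal (1 - 1 / (real n + 2))" 1 sequentially "\<lambda>_. ?S" ?S]
        by auto
      have "(\<lambda>n. ennreal (1 / (real n + 2))) \<longlonglongrightarrow> ennreal 0"
        by (intro tendsto_ennrealI) real_asymp
      then show "(\<lambda>n. L U + ennreal (1 / (real n + 2))) \<longlonglongrightarrow> L U"
        using tendsto_add[OF tendsto_const, of "\<lambda>n. ennreal (1 / (real n + 2))" 0 sequentially "L U"] by simp
      show "\<exists>N. \<forall>n\<ge>N. ennreal (1 - 1 / (real n + 2)) * ?S \<le> L U + ennreal (1 / (real n + 2))"
        by (intro exI allI impI main) auto
    qed
    finally show ?thesis by (simp add: L_def)
  qed (simp add: L_def)
qed

section \<open>Packing a disc by cubes\<close>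

lemma orthonormal_basisD:
  fixes B :: "'a::euclidean_space set"
  assumes "orthonormal_basis B"
  shows "finite B" "card B = DIM('a)"
    and "\<And>b c. b \<in> B \<Longrightarrow> c \<in> B \<Longrightarrow> b \<bullet> c = (if b = c then 1 else 0)"
    and "\<And>x. (\<Sum>b\<in>B. (x \<bullet> b) *\<^sub>R b) = x"
proof -
  from assms have o: "pairwise orthogonal B" and n: "\<And>b. b \<in> B \<Longrightarrow> norm b = 1" and sp: "span B = UNIV"
    by (auto simp: orthonormal_basis_def)
  have "independent B"
    using o n by (intro pairwise_orthogonal_independent) force+
  then show fin: "finite B" and "card B = DIM('a)"
    using sp by (auto simp: independent_imp_finite) (metis basis_card_eq_dim dim_UNIV subset_UNIV order_refl)
  show ip: "b \<bullet> c = (if b = c then 1 else 0)" if "b \<in> B" "c \<in> B" for b c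
    using that o n by (auto simp: pairwise_def orthogonal_def norm_eq_1)
  show "(\<Sum>b\<in>B. (x \<bullet> b) *\<^sub>R b) = x" for x
  proof -
    have "x \<in> span B" using sp by simp
    then show ?thesis
      using orthonormal_basis_expand[of B x] o n fin by simp
  qed
qed

lemma norm_le_sum_orthonormal:
  assumes "orthonormal_basis B"
  shows "norm x \<le> (\<Sum>b\<in>B. \<bar>x \<bullet> b\<bar>)"
proof -
  have "norm x = norm (\<Sum>b\<in>B. (x \<bullet> b) *\<^sub>R b)"
    using orthonormal_basisD(4)[OF assms] by simp
  also have "\<dots> \<le> (\<Sum>b\<in>B. \<bar>x \<bullet> b\<bar>)"
    using assms by (intro sum_norm_le) (auto simp: orthonormal_basis_def)
  finally show ?thesis .
qed

lemma inner_sum_orthonormal: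
  assumes "orthonormal_basis B" "I \<subseteq> B" "b \<in> B"
  shows "(\<Sum>c\<in>I. f c *\<^sub>R c) \<bullet> b = (if b \<in> I then f b else 0)"
proof -
  have "finite I" using orthonormal_basisD(1)[OF assms(1)] assms(2) finite_subset by blast
  have "(\<Sum>c\<in>I. f c *\<^sub>R c) \<bullet> b = (\<Sum>c\<in>I. if c = b then f b else 0)"
    unfolding inner_sum_left
    using orthonormal_basisD(3)[OF assms(1)] assms by (intro sum.cong) auto
  also have "\<dots> = (if b \<in> I then f b else 0)"
    using \<open>finite I\<close> by simp
  finally show ?thesis .
qed

text \<open>The grid cells of side \<open>\<delta>\<close> that meet a slightly smaller disc cover
  it, so their number times \<open>\<delta> ^ (N - 1)\<close> is at least its volume; being close to
  that disc, the cubes over them stay in the unit ball. The volume is computed in the coordinates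
  along \<open>B - {\<nu>}\<close>, in a product of real lines instead of on the hyperplane
  itself.\<close>

lemma disc_packing_by_cubes:
  fixes B :: "'a::euclidean_space set"
  assumes B: "orthonormal_basis B" and nu: "\<nu> \<in> B" and T: "T < unit_ball_vol (real (DIM('a) - 1))"
  obtains \<delta> Z where "\<delta> > 0" "finite Z" "\<And>c. c \<in> Z \<Longrightarrow> c \<bullet> \<nu> = 0"
    "\<And>c. c \<in> Z \<Longrightarrow> (\<lambda>y. c + \<delta> *\<^sub>R y) ` unit_cube B \<subseteq> ball 0 1"
    "disjoint_family_on (\<lambda>c. (\<lambda>y. c + \<delta> *\<^sub>R y) ` unit_cube B) Z"
    "T < real (card Z) * \<delta> ^ (DIM('a) - 1)"
proof -
  note ob = orthonormal_basisD[OF B]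
  define s where "s = DIM('a) - 1"
  define I where "I = B - {\<nu>}"
  have I: "finite I" "card I = s" "I \<subseteq> B" "\<nu> \<notin> I"
    using ob nu by (auto simp: I_def s_def)
  let ?N = "real DIM('a)"
  have "((\<lambda>\<delta>. unit_ball_vol (real s) * (1 - 2 * ?N * \<delta>) ^ s) \<longlongrightarrow> unit_ball_vol (real s) * (1 - 2 * ?N * 0) ^ s) (at_right 0)"
    by (intro tendsto_intros)
  then have "eventually (\<lambda>\<delta>. T < unit_ball_vol (real s) * (1 - 2 * ?N * \<delta>) ^ s) (at_right 0)"
    using T by (intro order_tendstoD(1)) (auto simp: s_def)
  moreover have "eventually (\<lambda>\<delta>::real. 0 < \<delta> \<and> \<delta> < 1 / (2 * ?N)) (at_right 0)"
    using eventually_at_right_less[of "0::real"]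
    by (intro eventually_conj) (auto simp: eventually_at_right_field intro!: exI[of _ "1 / (2 * ?N)"])
  ultimately have "eventually (\<lambda>\<delta>. T < unit_ball_vol (real s) * (1 - 2 * ?N * \<delta>) ^ s \<and> 0 < \<delta> \<and> \<delta> < 1 / (2 * ?N)) (at_right 0)"
    by eventually_elim auto
  then obtain \<delta> where \<delta>: "T < unit_ball_vol (real s) * (1 - 2 * ?N * \<delta>) ^ s" "0 < \<delta>" "\<delta> < 1 / (2 * ?N)"
    using eventually_happens[of _ "at_right (0::real)"] by (auto simp: trivial_limit_at_right_real)
  \<comment> \<open>A point of a cube has distance at most \<open>N * \<delta>\<close> from a point
    of the disc of radius \<open>r\<close>, one \<open>\<delta>\<close> for each direction; the
    doubled margin makes the inclusion in the open unit ball strict.\<close>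
  define r where "r = 1 - 2 * ?N * \<delta>"
  have r: "0 < r" "r < 1" using \<delta> by (auto simp: r_def field_simps)
  interpret product_sigma_finite "\<lambda>_::'a. lborel :: real measure" by standard
  let ?P = "Pi\<^sub>M I (\<lambda>_. lborel :: real measure)"
  define disc where "disc = {f. sqrt (\<Sum>i\<in>I. (f i)\<^sup>2) \<le> r} \<inter> space ?P"
  \<comment> \<open>A bound for the grid indices, which makes \<open>Z0\<close> finite; the added 1
    allows for rounding down on the negative side.\<close>
  define m where "m = \<lceil>1 / \<delta>\<rceil> + 1"
  define box where "box z = PiE I (\<lambda>i. {\<delta> * of_int (z i) ..< \<delta> * (of_int (z i) + 1)})" for z :: "'a \<Rightarrow> int"
  define Z0 where "Z0 = {z \<in> PiE I (\<lambda>_. {-m..m}). box z \<inter> disc \<noteq> {}}"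
  have "finite (PiE I (\<lambda>_. {-m..m}))" using I by (intro finite_PiE) auto
  then have finZ0: "finite Z0" by (simp add: Z0_def)
  have box: "box z \<in> sets ?P" "emeasure ?P (box z) = ennreal (\<delta> ^ s)" for z
  proof -
    show "box z \<in> sets ?P" unfolding box_def using I by (intro sets_PiM_I_finite) auto
    have "emeasure ?P (box z) = (\<Prod>i\<in>I. emeasure lborel {\<delta> * of_int (z i) ..< \<delta> * (of_int (z i) + 1)})"
      unfolding box_def using I by (intro emeasure_PiM) auto
    also have "\<dots> = (\<Prod>i\<in>I. ennreal \<delta>)"
      using \<delta> by (intro prod.cong) (auto simp: algebra_simps)
    finally show "emeasure ?P (box z) = ennreal (\<delta> ^ s)"
      using \<delta> I by (simp add: ennreal_power)
  qed
  have "disc \<subseteq> (\<Union>z\<in>Z0. box z)"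
  proof
    fix f assume f: "f \<in> disc"
    then have fI: "f \<in> extensional I" by (auto simp: disc_def space_PiM PiE_def)
    define z where "z = restrict (\<lambda>i. \<lfloor>f i / \<delta>\<rfloor>) I"
    have "\<delta> * of_int (z i) \<le> f i \<and> f i < \<delta> * (of_int (z i) + 1)" if "i \<in> I" for i
    proof -
      have "of_int (z i) \<le> f i / \<delta>" "f i / \<delta> < of_int (z i) + 1"
        using that floor_correct[of "f i / \<delta>"] unfolding z_def by (simp_all add: field_simps)
      then show ?thesis using \<delta>(2) by (simp add: field_simps)
    qed
    then have fz: "f \<in> box z"
      using fI unfolding box_def by (auto simp: PiE_def)
    have "\<bar>f i\<bar> \<le> 1" if "i \<in> I" for i
    proof -
      have "(f i)\<^sup>2 \<le> (\<Sum>i\<in>I. (f i)\<^sup>2)" using that I by (intro member_le_sum) auto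
      then have "\<bar>f i\<bar> \<le> sqrt (\<Sum>i\<in>I. (f i)\<^sup>2)" by (metis real_sqrt_abs real_sqrt_le_iff)
      also have "\<dots> \<le> r" using f by (auto simp: disc_def)
      finally show ?thesis using r by simp
    qed
    then have "\<lfloor>f i / \<delta>\<rfloor> \<in> {-m..m}" if "i \<in> I" for i
    proof -
      have "\<bar>f i / \<delta>\<bar> \<le> 1 / \<delta>" using \<open>\<And>i. i \<in> I \<Longrightarrow> \<bar>f i\<bar> \<le> 1\<close>[OF that] \<delta>(2) by (simp add: abs_divide divide_right_mono)
      then show ?thesis unfolding m_def by (simp, linarith)
    qed
    then have "z \<in> PiE I (\<lambda>_. {-m..m})" by (auto simp: z_def)
    with fz f show "f \<in> (\<Union>z\<in>Z0. box z)" by (auto simp: Z0_def)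
  qed
  then have "emeasure ?P disc \<le> emeasure ?P (\<Union>z\<in>Z0. box z)"
    using box finZ0 by (intro emeasure_mono) auto
  also have "\<dots> \<le> (\<Sum>z\<in>Z0. emeasure ?P (box z))"
    using box finZ0 by (intro emeasure_subadditive_finite) auto
  also have "\<dots> = ennreal (real (card Z0) * \<delta> ^ s)"
    using \<delta> by (simp add: box ennreal_mult ennreal_of_nat_eq_real_of_nat)
  also have "emeasure ?P disc = ennreal (unit_ball_vol (real s) * r ^ s)"
    unfolding disc_def using emeasure_cball_aux[OF I(1) r(1)] I by simp
  finally have "unit_ball_vol (real s) * r ^ s \<le> real (card Z0) * \<delta> ^ s"
    using \<delta> by (simp add: ennreal_le_iff)
  then have vol: "T < real (card Z0) * \<delta> ^ s" using \<delta> by (simp add: r_def)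

  \<comment> \<open>The summand \<open>1 / 2\<close> selects the midpoint of the grid cell. The
    component along \<open>\<nu>\<close> is 0, so the full-dimensional cube straddles the
    hyperplane.\<close>
  define c where "c z = (\<Sum>b\<in>I. (\<delta> * (of_int (z b) + 1 / 2)) *\<^sub>R b)" for z :: "'a \<Rightarrow> int"
  have cb: "c z \<bullet> b = (if b \<in> I then \<delta> * (of_int (z b) + 1 / 2) else 0)" if "b \<in> B" for z b
    unfolding c_def by (rule inner_sum_orthonormal[OF B I(3) that])
  have Q: "\<bar>(y - c z) \<bullet> b\<bar> < \<delta> / 2" if "y \<in> (\<lambda>y. c z + \<delta> *\<^sub>R y) ` unit_cube B" "b \<in> B" for y z b
    using that \<delta>(2) by (auto simp: unit_cube_def abs_mult)
  have disj: "(\<lambda>y. c z + \<delta> *\<^sub>R y) ` unit_cube B \<inter> (\<lambda>y. c z' + \<delta> *\<^sub>R y) ` unit_cube B = {}"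
    if "z \<in> Z0" "z' \<in> Z0" "z \<noteq> z'" for z z'
  proof -
    have zz: "z \<in> PiE I (\<lambda>_. {-m..m})" "z' \<in> PiE I (\<lambda>_. {-m..m})"
      using that by (simp_all add: Z0_def)
    obtain b where b: "b \<in> I" "z b \<noteq> z' b"
      using PiE_ext[OF zz] \<open>z \<noteq> z'\<close> by metis
    have "\<delta> \<le> \<bar>c z \<bullet> b - c z' \<bullet> b\<bar>"
    proof -
      have "1 \<le> \<bar>z b - z' b\<bar>" using b by simp
      then have "1 \<le> \<bar>real_of_int (z b) - of_int (z' b)\<bar>" by linarith
      then have "\<delta> * 1 \<le> \<delta> * \<bar>real_of_int (z b) - of_int (z' b)\<bar>" using \<delta>(2) by (intro mult_left_mono) auto
      also have "\<dots> = \<bar>\<delta> * (real_of_int (z b) - of_int (z' b))\<bar>" using \<delta>(2) by (simp add: abs_mult)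
      also have "\<dots> = \<bar>c z \<bullet> b - c z' \<bullet> b\<bar>" using b I cb by (auto simp: algebra_simps)
      finally show ?thesis by simp
    qed
    show ?thesis
    proof (rule ccontr)
      assume "\<not> ?thesis"
      then obtain y where y: "y \<in> (\<lambda>y. c z + \<delta> *\<^sub>R y) ` unit_cube B"
        "y \<in> (\<lambda>y. c z' + \<delta> *\<^sub>R y) ` unit_cube B" by blast
      have "b \<in> B" using b(1) I(3) by blast
      then have "\<bar>y \<bullet> b - c z \<bullet> b\<bar> < \<delta> / 2" "\<bar>y \<bullet> b - c z' \<bullet> b\<bar> < \<delta> / 2"
        using Q[OF y(1)] Q[OF y(2)] by (simp_all add: inner_diff_left)
      with \<open>\<delta> \<le> \<bar>c z \<bullet> b - c z' \<bullet> b\<bar>\<close> show False by linarith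
    qed
  qed
  have ball: "(\<lambda>y. c z + \<delta> *\<^sub>R y) ` unit_cube B \<subseteq> ball 0 1" if "z \<in> Z0" for z
  proof
    fix y assume y: "y \<in> (\<lambda>y. c z + \<delta> *\<^sub>R y) ` unit_cube B"
    obtain f where f: "f \<in> box z" "f \<in> disc" using \<open>z \<in> Z0\<close> by (auto simp: Z0_def)
    define w where "w = (\<Sum>b\<in>I. f b *\<^sub>R b)"
    have wb: "w \<bullet> b = (if b \<in> I then f b else 0)" if "b \<in> B" for b
      unfolding w_def by (rule inner_sum_orthonormal[OF B I(3) that])
    have "w \<bullet> w = (\<Sum>b\<in>I. (f b)\<^sup>2)"
    proof -
      have "w \<bullet> w = (\<Sum>b\<in>I. f b * (w \<bullet> b))"
        by (subst (2) w_def) (simp add: inner_sum_right)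
      also have "\<dots> = (\<Sum>b\<in>I. (f b)\<^sup>2)"
        using I(3) by (intro sum.cong refl) (auto simp: wb power2_eq_square)
      finally show ?thesis .
    qed
    then have "norm w \<le> r" using f(2) by (simp add: disc_def norm_eq_sqrt_inner)
    moreover have "norm (y - w) \<le> (\<Sum>b\<in>B. \<bar>(y - w) \<bullet> b\<bar>)" by (rule norm_le_sum_orthonormal[OF B])
    moreover have "\<dots> \<le> (\<Sum>b\<in>B. \<delta>)"
    proof (rule sum_mono)
      fix b assume b: "b \<in> B"
      \<comment> \<open>In a direction of \<open>I\<close> the component of \<open>w\<close> lies in
        the grid interval whose midpoint is the component of \<open>c z\<close>; along
        \<open>\<nu>\<close> both components vanish.\<close>
      have "\<bar>(c z - w) \<bullet> b\<bar> \<le> \<delta> / 2"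
      proof (cases "b \<in> I")
        case True
        then have "\<delta> * of_int (z b) \<le> f b" "f b < \<delta> * (of_int (z b) + 1)"
          using f(1) by (auto simp: box_def PiE_def Pi_def)
        moreover have "(c z - w) \<bullet> b = \<delta> * of_int (z b) + \<delta> / 2 - f b"
          using True cb[OF b] wb[OF b] by (simp add: inner_diff_left algebra_simps)
        moreover have "\<delta> * (of_int (z b) + 1) = \<delta> * of_int (z b) + \<delta>" by (simp add: algebra_simps)
        ultimately show ?thesis by linarith
      qed (use cb[OF b] wb[OF b] \<delta>(2) in \<open>simp add: inner_diff_left\<close>)
      moreover have "(y - w) \<bullet> b = (y - c z) \<bullet> b + (c z - w) \<bullet> b" by (simp add: inner_diff_left)
      ultimately show "\<bar>(y - w) \<bullet> b\<bar> \<le> \<delta>" using Q[OF y b] by linarith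
    qed
    moreover have "norm y \<le> norm w + norm (y - w)" by (metis add.commute diff_add_cancel norm_triangle_ineq)
    moreover have "0 < ?N * \<delta>" using \<delta>(2) by simp
    ultimately have "norm y < 1" using ob(2) by (simp add: r_def)
    then show "y \<in> ball 0 1" by simp
  qed
  have ne: "unit_cube B \<noteq> {}" by (auto simp: unit_cube_def intro!: exI[of _ 0])
  \<comment> \<open>Distinct cells have disjoint nonempty cubes, hence distinct centres; passing
    from cells to centres therefore keeps the count.\<close>
  have inj: "inj_on c Z0"
  proof (rule inj_onI, rule ccontr)
    fix z z' assume "z \<in> Z0" "z' \<in> Z0" "c z = c z'" "z \<noteq> z'"
    then show False using disj[of z z'] ne by simp
  qed
  show thesis
  proof (rule that[of \<delta> "c ` Z0"])
    show "x \<bullet> \<nu> = 0" if "x \<in> c ` Z0" for x using that cb[OF nu] I by auto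
    show "T < real (card (c ` Z0)) * \<delta> ^ (DIM('a) - 1)" using vol inj by (simp add: card_image s_def)
    show "disjoint_family_on (\<lambda>c. (\<lambda>y. c + \<delta> *\<^sub>R y) ` unit_cube B) (c ` Z0)"
      unfolding disjoint_family_on_def using disj by (metis imageE)
  qed (use \<delta> finZ0 ball in auto)
qed

section \<open>Uniqueness of weak derivatives\<close>

lemma Lp_loc_set_integrable:
  assumes "Lp_loc U 1 f" "compact K" "K \<subseteq> U"
  shows "set_integrable lebesgue K f"
proof -
  have "Lp K 1 f" using assms by (simp add: Lp_loc_def)
  then have m: "set_borel_measurable lebesgue K f" and i: "set_integrable lebesgue K (\<lambda>x. norm (f x))"
    by (simp_all add: Lp_def)
  show ?thesis
    unfolding set_integrable_def
    using m i unfolding set_borel_measurable_def set_integrable_def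
    by (intro integrable_norm_cancel[OF _ m[unfolded set_borel_measurable_def]]) (simp add: abs_mult)
qed

text \<open>Differentiating \<open>exp (- 1 / t) / t ^ m\<close> only raises the exponent
  \<open>m\<close>. With \<open>m\<close> as a parameter the family is closed under differentiation
  up to linear combinations, so smoothness becomes a closure property.\<close>

definition flat :: "nat \<Rightarrow> real \<Rightarrow> real" where
  "flat m t = (if t > 0 then exp (- 1 / t) / t ^ m else 0)"

lemma flat_tendsto_0: "(flat m \<longlongrightarrow> 0) (at_right 0)"
proof -
  have "((\<lambda>t. inverse t ^ m / exp (inverse t)) \<longlongrightarrow> 0) (at_right (0::real))"
    by (rule filterlim_compose[OF tendsto_power_div_exp_0 filterlim_inverse_at_top_right])
  then show ?thesis
  proof (rule Lim_transform_eventually)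
    show "\<forall>\<^sub>F t in at_right 0. inverse t ^ m / exp (inverse t) = flat m t"
      using eventually_at_right_less[of "0::real"]
      by eventually_elim (simp add: flat_def exp_minus field_simps)
  qed
qed

lemma flat_has_real_derivative:
  "(flat m has_real_derivative flat (m + 2) t - real m * flat (m + 1) t) (at t)"
proof (cases t "0::real" rule: linorder_cases)
  case less
  have "((\<lambda>_. 0) has_real_derivative 0) (at t)" by simp
  then have "(flat m has_real_derivative 0) (at t)"
    by (rule has_field_derivative_transform_within_open[of _ _ _ "{..<0}"]) (use less in \<open>auto simp: flat_def\<close>)
  then show ?thesis using less by (simp add: flat_def)
next
  case greater
  have "((\<lambda>t. exp (- 1 / t) / t ^ m) has_real_derivative flat (m + 2) t - real m * flat (m + 1) t) (at t)"
    using greater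
    by (auto intro!: derivative_eq_intros simp: flat_def field_simps power2_eq_square)
      (cases m; simp add: field_simps)
  then show ?thesis
    by (rule has_field_derivative_transform_within_open[of _ _ _ "{0<..}"]) (use greater in \<open>auto simp: flat_def\<close>)
next
  case equal
  have "((\<lambda>h. (flat m (0 + h) - flat m 0) / h) \<longlongrightarrow> 0) (at 0)"
    unfolding filterlim_at_split
  proof
    show "((\<lambda>h. (flat m (0 + h) - flat m 0) / h) \<longlongrightarrow> 0) (at_left 0)"
      by (rule Lim_transform_eventually[OF tendsto_const])
        (auto simp: eventually_at_left_field flat_def intro!: exI[of _ "-1"])
    show "((\<lambda>h. (flat m (0 + h) - flat m 0) / h) \<longlongrightarrow> 0) (at_right 0)"
    \<comment> \<open>At 0 the right difference quotient of \<open>flat m\<close> is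
      \<open>flat (Suc m)\<close>.\<close>
    proof (rule Lim_transform_eventually[OF flat_tendsto_0[of "Suc m"]])
      show "\<forall>\<^sub>F h in at_right 0. flat (Suc m) h = (flat m (0 + h) - flat m 0) / h"
        using eventually_at_right_less[of "0::real"]
        by eventually_elim (simp add: flat_def field_simps)
    qed
  qed
  then show ?thesis using equal by (simp add: DERIV_def flat_def)
qed

text \<open>An algebra of differentiable functions that turns out to be closed under partial
  derivatives. Every \<open>partials I\<close> of a member is then a member, hence differentiable,
  which is the smoothness that \<open>test_function\<close> demands.\<close>

inductive_set flat_algebra :: "(real^'N::finite \<Rightarrow> real) set" where
  flat: "(\<lambda>x. flat m (c * x $ i + d)) \<in> flat_algebra"
| const: "(\<lambda>x. c) \<in> flat_algebra"
| add: "f \<in> flat_algebra \<Longrightarrow> g \<in> flat_algebra \<Longrightarrow> (\<lambda>x. f x + g x) \<in> flat_algebra"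
| mult: "f \<in> flat_algebra \<Longrightarrow> g \<in> flat_algebra \<Longrightarrow> (\<lambda>x. f x * g x) \<in> flat_algebra"

lemma flat_algebra_derivative:
  assumes "f \<in> flat_algebra"
  shows "(\<forall>x. f differentiable (at x)) \<and> (\<forall>i. (\<lambda>x. frechet_derivative f (at x) (axis i 1)) \<in> flat_algebra)"
  using assms
proof induction
  case (flat m c i d)
  have d: "((\<lambda>x. flat m (c * x $ i + d)) has_derivative
      (\<lambda>h. (c * h $ i) * (flat (m + 2) (c * x $ i + d) - real m * flat (m + 1) (c * x $ i + d)))) (at x)" for x :: "real^'a"
    by (rule DERIV_compose_FDERIV[OF flat_has_real_derivative])
      (auto intro!: derivative_eq_intros bounded_linear_imp_has_derivative[OF bounded_linear_vec_nth])
  have "(\<lambda>x. frechet_derivative (\<lambda>x. flat m (c * x $ i + d)) (at x) (axis j 1))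
    = (\<lambda>x::real^'a. (flat (m + 2) (c * x $ i + d) + (- real m) * flat (m + 1) (c * x $ i + d)) * (c * (axis j 1 :: real^'a) $ i))" for j
    by (rule ext) (simp add: frechet_derivative_at[OF d, symmetric] mult.commute)
  moreover have "(\<lambda>x::real^'a. (flat (m + 2) (c * x $ i + d) + (- real m) * flat (m + 1) (c * x $ i + d)) * (c * (axis j 1 :: real^'a) $ i)) \<in> flat_algebra" for j
    by (intro flat_algebra.intros)
  ultimately show ?case using d by (auto simp: differentiable_def)
next
  case (const c)
  then show ?case by (auto intro: flat_algebra.const)
next
  case (add f g)
  have d: "((\<lambda>x. f x + g x) has_derivative (\<lambda>h. frechet_derivative f (at x) h + frechet_derivative g (at x) h)) (at x)" for x
    using add.IH by (intro has_derivative_add) (auto simp: frechet_derivative_works)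
  have "(\<lambda>x. frechet_derivative (\<lambda>x. f x + g x) (at x) (axis j 1))
     = (\<lambda>x. frechet_derivative f (at x) (axis j 1) + frechet_derivative g (at x) (axis j 1))" for j
    by (rule ext) (simp add: frechet_derivative_at[OF d, symmetric])
  then show ?case using d add.IH by (auto simp: differentiable_def intro: flat_algebra.add)
next
  case (mult f g)
  have d: "((\<lambda>x. f x * g x) has_derivative (\<lambda>h. f x * frechet_derivative g (at x) h + frechet_derivative f (at x) h * g x)) (at x)" for x
    using mult.IH by (intro has_derivative_mult) (auto simp: frechet_derivative_works)
  have "(\<lambda>x. frechet_derivative (\<lambda>x. f x * g x) (at x) (axis j 1))
     = (\<lambda>x. f x * frechet_derivative g (at x) (axis j 1) + frechet_derivative f (at x) (axis j 1) * g x)" for j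
    by (rule ext) (simp add: frechet_derivative_at[OF d, symmetric])
  then show ?case using d mult by (auto simp: differentiable_def intro!: flat_algebra.add flat_algebra.mult)
qed

lemma flat_algebra_partials: "f \<in> flat_algebra \<Longrightarrow> partials I f \<in> flat_algebra"
  by (induction I) (auto simp: flat_algebra_derivative)

lemma flat_algebra_prod:
  "finite A \<Longrightarrow> (\<And>i. i \<in> A \<Longrightarrow> f i \<in> flat_algebra) \<Longrightarrow> (\<lambda>x. \<Prod>i\<in>A. f i x) \<in> flat_algebra"
  by (induction A rule: finite_induct) (auto intro: flat_algebra.const flat_algebra.mult)

text \<open>For \<open>k > 0\<close> each coordinate contributes
  \<open>exp (- 1 / (k * (x $ i - a $ i)))\<close> and its mirror image at \<open>b\<close> inside
  the open box, and 0 outside; as \<open>k\<close> grows the product tends to the indicator of the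
  box. The arguments are written in the affine form of the generators of
  \<open>flat_algebra\<close>.\<close>

definition bump :: "real^'N::finite \<Rightarrow> real^'N \<Rightarrow> nat \<Rightarrow> real^'N \<Rightarrow> real" where
  "bump a b k x = (\<Prod>i\<in>UNIV. flat 0 (real k * x $ i + - real k * a $ i) * flat 0 (- real k * x $ i + real k * b $ i))"

lemma bump_eq_0: "x \<notin> box a b \<Longrightarrow> bump a b k x = 0"
proof -
  assume "x \<notin> box a b"
  then obtain i where "x $ i \<le> a $ i \<or> b $ i \<le> x $ i"
    by (auto simp: mem_box_cart not_less)
  then have "flat 0 (real k * x $ i + - real k * a $ i) * flat 0 (- real k * x $ i + real k * b $ i) = 0"
    by (auto simp: flat_def not_less intro: mult_left_mono) (metis mult_left_mono of_nat_0_le_iff leD)+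
  then show ?thesis unfolding bump_def by (intro prod_zero bexI[of _ i]) auto
qed

lemma test_function_bump:
  assumes "cbox a b \<subseteq> U"
  shows "test_function U (bump a b k)"
proof -
  have "bump a b k \<in> flat_algebra"
    unfolding bump_def[abs_def] by (intro flat_algebra_prod flat_algebra.intros) auto
  then have "partials I (bump a b k) differentiable (at x)" for I x
    using flat_algebra_derivative flat_algebra_partials by blast
  moreover have "closure {x. bump a b k x \<noteq> 0} \<subseteq> cbox a b"
    using bump_eq_0 box_subset_cbox by (intro closure_minimal) blast+
  moreover have "compact (closure {x. bump a b k x \<noteq> 0})"
    using calculation(2) compact_cbox[of a b]
    by (meson bounded_subset closed_closure compact_eq_bounded_closed)
  ultimately show ?thesis
    using assms by (auto simp: test_function_def)
qed

lemma bump_bounds: "0 \<le> bump a b k x" "bump a b k x \<le> 1"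
proof -
  have "0 \<le> flat 0 t" "flat 0 t \<le> 1" for t by (auto simp: flat_def)
  then show "0 \<le> bump a b k x" "bump a b k x \<le> 1"
    unfolding bump_def by (auto intro!: prod_nonneg prod_le_1 mult_le_one)
qed

lemma bump_tendsto_indicator: "(\<lambda>k. bump a b k x) \<longlonglongrightarrow> indicator (box a b) x"
proof (cases "x \<in> box a b")
  case True
  have *: "(\<lambda>k. flat 0 (real k * t)) \<longlonglongrightarrow> 1" if "t > 0" for t
  proof -
    have "(\<lambda>k. exp (- (inverse (real k) * inverse t))) \<longlonglongrightarrow> exp (- (0 * inverse t))"
      by (intro tendsto_intros lim_inverse_n)
    then have "(\<lambda>k. exp (- (inverse (real k) * inverse t))) \<longlonglongrightarrow> 1" by simp
    then show ?thesis
    proof (rule Lim_transform_eventually)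
      show "\<forall>\<^sub>F k in sequentially. exp (- (inverse (real k) * inverse t)) = flat 0 (real k * t)"
        using eventually_gt_at_top[of 0]
        by eventually_elim (use that in \<open>simp add: flat_def field_simps\<close>)
    qed
  qed
  have "(\<lambda>k. bump a b k x) = (\<lambda>k. \<Prod>i\<in>UNIV. flat 0 (real k * (x $ i - a $ i)) * flat 0 (real k * (b $ i - x $ i)))"
    by (simp add: bump_def algebra_simps)
  moreover have "(\<lambda>k. \<Prod>i\<in>UNIV. flat 0 (real k * (x $ i - a $ i)) * flat 0 (real k * (b $ i - x $ i)))
      \<longlonglongrightarrow> (\<Prod>i\<in>(UNIV :: 'a set). 1)"
  proof (rule tendsto_prod)
    fix i
    show "(\<lambda>k. flat 0 (real k * (x $ i - a $ i)) * flat 0 (real k * (b $ i - x $ i))) \<longlonglongrightarrow> 1"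
      using tendsto_mult[OF *[of "x $ i - a $ i"] *[of "b $ i - x $ i"]] True by (simp add: mem_box_cart)
  qed
  ultimately show ?thesis using True by simp
qed (simp add: bump_eq_0)

lemma test_function_continuous: "test_function U \<eta> \<Longrightarrow> continuous_on S \<eta>"
  unfolding test_function_def
  by (intro continuous_at_imp_continuous_on ballI differentiable_imp_continuous_within)
    (auto dest: spec[of _ "[]"])

text \<open>Off the closed support the function vanishes on an open set, and so do its derivatives;
  differentiation does not enlarge supports.\<close>

lemma test_function_partials:
  assumes "test_function U \<eta>"
  shows "test_function U (partials I \<eta>)"
proof -
  have app: "partials J (partials I \<eta>) = partials (J @ I) \<eta>" for J
    by (induction J) auto
  have supp: "x \<in> closure {x. \<eta> x \<noteq> 0}" if "partials I \<eta> x \<noteq> 0" for x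
    using that
  proof (induction I arbitrary: x)
    case Nil
    then show ?case using closure_subset by fastforce
  next
    case (Cons i I)
    show ?case
    proof (rule ccontr)
      assume x: "x \<notin> closure {x. \<eta> x \<noteq> 0}"
      have "((\<lambda>_. 0) has_derivative (\<lambda>_. 0)) (at x)" by simp
      then have "(partials I \<eta> has_derivative (\<lambda>_. 0)) (at x)"
        by (rule has_derivative_transform_within_open[of _ _ _ _ "- closure {x. \<eta> x \<noteq> 0}"]) (use x Cons.IH in auto)
      then have "frechet_derivative (partials I \<eta>) (at x) = (\<lambda>_. 0)"
        using frechet_derivative_at by metis
      then show False using Cons.prems by simp
    qed
  qed
  then have "closure {x. partials I \<eta> x \<noteq> 0} \<subseteq> closure {x. \<eta> x \<noteq> 0}"
    by (intro closure_minimal) auto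
  then show ?thesis
    using assms unfolding test_function_def app
    by (meson bounded_subset closed_closure compact_eq_bounded_closed order_trans)
qed

text \<open>\<open>f\<close> is known to be integrable only on compact subsets of \<open>U\<close>,
  but the support of \<open>\<eta>\<close> is one of them and \<open>\<eta>\<close> is bounded on
  it.\<close>

lemma test_function_set_integrable:
  fixes f :: "real^'N::finite \<Rightarrow> 'b::euclidean_space"
  assumes \<eta>: "test_function U \<eta>" and f: "Lp_loc U 1 f"
  shows "set_integrable lebesgue U (\<lambda>x. \<eta> x *\<^sub>R f x)"
proof -
  define K where "K = closure {x. \<eta> x \<noteq> 0}"
  have K: "compact K" "K \<subseteq> U" using \<eta> by (auto simp: K_def test_function_def)
  have i: "integrable lebesgue (\<lambda>x. indicator K x *\<^sub>R f x)"
    using Lp_loc_set_integrable[OF f K] by (simp add: set_integrable_def)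
  have cont: "continuous_on UNIV \<eta>" by (rule test_function_continuous[OF \<eta>])
  have "compact (\<eta> ` K)"
    using K cont by (intro compact_continuous_image) (auto intro: continuous_on_subset)
  then have "bounded (\<eta> ` K)" by (rule compact_imp_bounded)
  then obtain C where C: "\<And>x. x \<in> K \<Longrightarrow> \<bar>\<eta> x\<bar> \<le> C"
    by (auto simp: bounded_iff)
  have \<eta>0: "\<eta> x = 0" if "x \<notin> K" for x
    using that closure_subset[of "{x. \<eta> x \<noteq> 0}"] unfolding K_def by blast
  have eq: "indicator U x *\<^sub>R \<eta> x *\<^sub>R f x = \<eta> x *\<^sub>R (indicator K x *\<^sub>R f x)" for x
    using \<eta>0[of x] K by (auto split: split_indicator)
  have [measurable]: "\<eta> \<in> borel_measurable lebesgue"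
    using borel_measurable_continuous_onI[OF cont] by (intro measurable_completion) simp
  have "integrable lebesgue (\<lambda>x. \<eta> x *\<^sub>R (indicator K x *\<^sub>R f x))"
  proof (rule Bochner_Integration.integrable_bound)
    show "integrable lebesgue (\<lambda>x. C *\<^sub>R (indicator K x *\<^sub>R f x))" by (rule integrable_scaleR_right) (rule i)
    show "(\<lambda>x. \<eta> x *\<^sub>R indicat_real K x *\<^sub>R f x) \<in> borel_measurable lebesgue"
      by (rule borel_measurable_scaleR[OF _ borel_measurable_integrable[OF i]]) simp
    show "AE x in lebesgue. norm (\<eta> x *\<^sub>R indicat_real K x *\<^sub>R f x) \<le> norm (C *\<^sub>R indicat_real K x *\<^sub>R f x)"
      using C by (intro AE_I2) (force split: split_indicator intro: mult_right_mono)
  qed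
  then show ?thesis unfolding set_integrable_def eq .
qed

lemma sigma_finite_measure_lebesgue: "sigma_finite_measure (lebesgue :: 'a::euclidean_space measure)"
proof (unfold_locales, intro exI conjI)
  let ?A = "range (\<lambda>n::nat. ball (0::'a) (real n))"
  show "countable ?A" by simp
  show "?A \<subseteq> sets lebesgue" by auto
  show "\<Union> ?A = space lebesgue" by (auto simp: reals_Archimedean2)
  show "\<forall>a\<in>?A. emeasure lebesgue a \<noteq> \<infinity>" using emeasure_bounded_finite[OF bounded_ball] by (auto simp: less_top)
qed

text \<open>Bump functions approximate indicators of boxes boundedly, so by dominated convergence
  \<open>h\<close> has integral 0 over boxes. These form an intersection-stable generator, which
  carries the vanishing to all Borel sets and, modulo null sets, to all Lebesgue sets; a function
  whose integrals over all measurable sets vanish is 0 almost everywhere.\<close>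

lemma fundamental_lemma_calculus_of_variations:
  fixes h :: "real^'N::finite \<Rightarrow> 'b::euclidean_space"
  assumes U: "open U" and h: "Lp_loc U 1 h"
    and zero: "\<And>\<eta>. test_function U \<eta> \<Longrightarrow> (LINT x:U|lebesgue. \<eta> x *\<^sub>R h x) = 0"
  shows "AE x\<in>U in lebesgue. h x = 0"
proof -
  have box0: "AE x in lebesgue. x \<in> cbox a b \<longrightarrow> h x = 0" if ab: "cbox a b \<subseteq> U" for a b
  proof -
    \<comment> \<open>The truncation is integrable on the whole space, so its integral over an
      arbitrary Borel set makes sense; \<open>h\<close> itself is only locally integrable in
      \<open>U\<close>.\<close>
    define h1 where "h1 x = indicator (box a b) x *\<^sub>R h x" for x
    have i0: "integrable lebesgue (\<lambda>x. indicator (cbox a b) x *\<^sub>R h x)"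
      using Lp_loc_set_integrable[OF h _ ab] by (simp add: set_integrable_def)
    then have "integrable lebesgue (\<lambda>x. indicator (box a b) x *\<^sub>R (indicator (cbox a b) x *\<^sub>R h x))"
      by (rule integrable_mult_indicator[rotated]) auto
    also have "(\<lambda>x. indicator (box a b) x *\<^sub>R (indicator (cbox a b) x *\<^sub>R h x)) = h1"
      using box_subset_cbox[of a b] by (auto simp: h1_def fun_eq_iff split: split_indicator)
    finally have i1: "integrable lebesgue h1" .
    have box: "(LINT x|lebesgue. indicator (box c d) x *\<^sub>R h1 x) = 0" for c d
    proof -
      obtain c' d' where cd: "box c d \<inter> box a b = box c' d'"
        using box_Int_box[of c d a b] by blast
      have sub: "cbox c' d' \<subseteq> U \<or> box c' d' = {}"
      proof (cases "box c' d' = {}")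
        case False
        have "closure (box c' d') \<subseteq> cbox a b"
          using cd box_subset_cbox[of a b] by (intro closure_minimal) auto
        then show ?thesis using False ab by simp
      qed auto
      show ?thesis
      proof (cases "box c' d' = {}")
        case True
        then have "(\<lambda>x. indicator (box c d) x *\<^sub>R h1 x) = (\<lambda>_. 0)"
          using cd by (auto simp: h1_def fun_eq_iff split: split_indicator)
        then show ?thesis by simp
      next
        case False
        then have subU: "cbox c' d' \<subseteq> U" using sub by simp
        have sub': "box c' d' \<subseteq> cbox a b" using cd box_subset_cbox[of a b] by auto
        let ?b = "\<lambda>k x. indicat_real U x *\<^sub>R bump c' d' k x *\<^sub>R h x"
        let ?h = "\<lambda>x. indicat_real (box c d) x *\<^sub>R h1 x"
        let ?z = "\<lambda>x. norm (indicat_real (cbox a b) x *\<^sub>R h x)"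
        have "(\<lambda>k. LINT x|lebesgue. indicator U x *\<^sub>R (bump c' d' k x *\<^sub>R h x)) \<longlonglongrightarrow>
          (LINT x|lebesgue. indicator (box c d) x *\<^sub>R h1 x)"
        proof (rule integral_dominated_convergence[where w = "\<lambda>x. norm (indicator (cbox a b) x *\<^sub>R h x)"])
          show "(\<lambda>x. indicat_real (box c d) x *\<^sub>R h1 x) \<in> borel_measurable lebesgue"
            using i1 by (intro borel_measurable_scaleR borel_measurable_indicator) (auto dest: borel_measurable_integrable)
          show "?b k \<in> borel_measurable lebesgue" for k
            using test_function_set_integrable[OF test_function_bump[OF subU] h]
            unfolding set_integrable_def by (rule borel_measurable_integrable)
          show "integrable lebesgue ?z" by (rule integrable_norm[OF i0])
          show "AE x in lebesgue. (\<lambda>k. ?b k x) \<longlonglongrightarrow> ?h x"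
          proof (rule AE_I2)
            fix x
            have "(\<lambda>k. ?b k x) \<longlonglongrightarrow> indicat_real U x *\<^sub>R indicator (box c' d') x *\<^sub>R h x"
              by (intro tendsto_intros bump_tendsto_indicator)
            also have "indicat_real U x *\<^sub>R indicator (box c' d') x *\<^sub>R h x = indicat_real (box c d) x *\<^sub>R h1 x"
              unfolding cd[symmetric] h1_def using ab box_subset_cbox[of a b] by (auto split: split_indicator)
            finally show "(\<lambda>k. ?b k x) \<longlonglongrightarrow> ?h x" .
          qed
          show "AE x in lebesgue. norm (?b k x) \<le> ?z x" for k
          proof (rule AE_I2)
            fix x
            show "norm (?b k x) \<le> ?z x"
            proof (cases "x \<in> box c' d'")
              case True
              then show ?thesis using sub' bump_bounds[of c' d' k x]
                by (auto split: split_indicator intro: mult_left_le_one_le)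
            qed (simp add: bump_eq_0)
          qed
        qed
        moreover have "(LINT x|lebesgue. indicator U x *\<^sub>R (bump c' d' k x *\<^sub>R h x)) = 0" for k
          using zero[OF test_function_bump[OF subU]] by (simp add: set_lebesgue_integral_def)
        ultimately show ?thesis by (simp add: LIMSEQ_const_iff)
      qed
    qed
    have borel0: "(LINT x|lebesgue. indicator A x *\<^sub>R h1 x) = 0" if "A \<in> sets borel" for A
    proof -
      have iA: "integrable lebesgue (\<lambda>x. indicator A x *\<^sub>R h1 x)" if "A \<in> sets borel" for A
        using that i1 by (intro integrable_mult_indicator) auto
      have sb: "sets borel = sigma_sets UNIV (range (\<lambda>(a, b). box a b :: (real^'N) set))"
        by (subst borel_eq_box) (simp add: sets_measure_of)
      have "Int_stable (range (\<lambda>(a, b). box a b :: (real^'N) set))"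
        by (auto simp: Int_stable_def box_Int_box)
      moreover have "(range (\<lambda>(a, b). box a b :: (real^'N) set)) \<subseteq> Pow UNIV" by auto
      moreover have "A \<in> sigma_sets UNIV (range (\<lambda>(a, b). box a b :: (real^'N) set))"
        using that sb by simp
      ultimately show ?thesis
      proof (induction rule: sigma_sets_induct_disjoint)
        case (basic A) then show ?case using box by auto
      next
        case empty show ?case by simp
      next
        case (compl A)
        have "(LINT x|lebesgue. indicator (UNIV - A) x *\<^sub>R h1 x) = (LINT x|lebesgue. h1 x - indicator A x *\<^sub>R h1 x)"
          by (intro Bochner_Integration.integral_cong) (auto split: split_indicator)
        also have "\<dots> = (LINT x|lebesgue. h1 x) - (LINT x|lebesgue. indicator A x *\<^sub>R h1 x)"
          using compl i1 iA by (intro Bochner_Integration.integral_diff) (auto simp: sb)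
        \<comment> \<open>\<open>h1\<close> vanishes off \<open>box a b\<close>, so its full
          integral is again an integral over a box.\<close>
        also have "(LINT x|lebesgue. h1 x) = (LINT x|lebesgue. indicator (box a b) x *\<^sub>R h1 x)"
          by (intro Bochner_Integration.integral_cong) (auto simp: h1_def split: split_indicator)
        finally show ?case using compl box by simp
      next
        case (union A)
        have Am: "A i \<in> sets lebesgue" for i using union(2) by (auto simp: sb[symmetric])
        have "(LINT x:(\<Union>i. A i)|lebesgue. h1 x) = (\<Sum>i. LINT x:A i|lebesgue. h1 x)"
        proof (rule lebesgue_integral_countable_add)
          show "A i \<inter> A j = {}" if "i \<noteq> j" for i j using union(1) that by (auto simp: disjoint_family_on_def)
          show "set_integrable lebesgue (\<Union>i. A i) h1"
            unfolding set_integrable_def using Am i1 by (intro integrable_mult_indicator) auto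
        qed (rule Am)
        then show ?case using union(3) by (simp add: set_lebesgue_integral_def)
      qed
    qed
    have "AE x in lebesgue. h1 x = 0"
    proof (rule sigma_finite_measure.density_zero[OF sigma_finite_measure_lebesgue i1])
      fix A :: "(real^'N) set" assume "A \<in> sets lebesgue"
      \<comment> \<open>A Lebesgue set is a Borel set up to a part of a null set, which reduces the
        claim to the Borel case.\<close>
      then obtain S N N' where S: "A = S \<union> N" "N \<subseteq> N'" "N' \<in> null_sets lborel" "S \<in> sets lborel"
        by (rule sets_completionE)
      have "N \<in> null_sets lebesgue"
        by (rule null_sets_completion_subset[OF S(2) null_sets_completionI[OF S(3)]])
      then have "AE x in lebesgue. x \<notin> N" by (rule AE_not_in)
      then have "(LINT x|lebesgue. indicator A x *\<^sub>R h1 x) = (LINT x|lebesgue. indicator S x *\<^sub>R h1 x)"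
        using S \<open>A \<in> sets lebesgue\<close> i1
        by (intro integral_cong_AE borel_measurable_scaleR borel_measurable_indicator)
          (auto split: split_indicator dest: borel_measurable_integrable elim!: eventually_mono)
      then show "(LINT x:A|lebesgue. h1 x) = 0"
        using borel0[of S] S by (simp add: set_lebesgue_integral_def)
    qed
    moreover have "AE x in lebesgue. x \<notin> cbox a b - box a b"
      using negligible_frontier_interval[of a b] by (intro AE_not_in) (simp add: negligible_iff_null_sets)
    ultimately show ?thesis
      by eventually_elim (auto simp: h1_def split: split_indicator_asm)
  qed
  obtain \<D> where \<D>: "countable \<D>" "\<D> \<subseteq> Pow U" "\<And>X. X \<in> \<D> \<Longrightarrow> \<exists>a b. X = cbox a b" "\<Union>\<D> = U"
    using open_countable_Union_open_cbox[OF U] by metis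
  have "AE x in lebesgue. \<forall>X\<in>\<D>. x \<in> X \<longrightarrow> h x = 0"
    unfolding AE_ball_countable[OF \<D>(1)] using \<D>(2,3) box0 by blast
  then show ?thesis
    by (rule eventually_mono) (auto simp flip: \<D>(4))
qed

lemma Lp_loc_1_diff:
  assumes "Lp_loc U 1 f" "Lp_loc U 1 g"
  shows "Lp_loc U 1 (\<lambda>x. f x - g x)"
  unfolding Lp_loc_def
proof (intro allI impI)
  fix K assume K: "compact K \<and> K \<subseteq> U"
  then have i: "set_integrable lebesgue K (\<lambda>x. f x - g x)"
    using assms by (intro set_integral_diff Lp_loc_set_integrable[of U]) auto
  then have "set_integrable lebesgue K (\<lambda>x. norm (f x - g x))"
    by (rule set_integrable_norm)
  with i show "Lp K 1 (\<lambda>x. f x - g x)"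
    by (auto simp: Lp_def set_integrable_def set_borel_measurable_def)
qed

lemma is_weak_deriv_unique:
  assumes U: "open U" and g: "is_weak_deriv U I f g" and g': "is_weak_deriv U I f g'"
  shows "AE x\<in>U in lebesgue. g x = g' x"
proof -
  have L: "Lp_loc U 1 g" "Lp_loc U 1 g'" using g g' by (auto simp: is_weak_deriv_def)
  have "AE x\<in>U in lebesgue. g x - g' x = 0"
  proof (rule fundamental_lemma_calculus_of_variations[OF U Lp_loc_1_diff[OF L]])
    fix \<eta> assume \<eta>: "test_function U \<eta>"
    have "(LINT x:U|lebesgue. \<eta> x *\<^sub>R (g x - g' x))
        = (LINT x:U|lebesgue. \<eta> x *\<^sub>R g x) - (LINT x:U|lebesgue. \<eta> x *\<^sub>R g' x)"
      unfolding scaleR_diff_right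
      by (intro set_integral_diff test_function_set_integrable \<eta> L)
    moreover have "(-1::real) ^ length I *\<^sub>R (LINT x:U|lebesgue. \<eta> x *\<^sub>R g x) = (-1) ^ length I *\<^sub>R (LINT x:U|lebesgue. \<eta> x *\<^sub>R g' x)"
      using g g' \<eta> by (simp add: is_weak_deriv_def)
    then have "(LINT x:U|lebesgue. \<eta> x *\<^sub>R g x) = (LINT x:U|lebesgue. \<eta> x *\<^sub>R g' x)"
      by simp
    ultimately show "(LINT x:U|lebesgue. \<eta> x *\<^sub>R (g x - g' x)) = 0" by simp
  qed
  then show ?thesis by eventually_elim auto
qed

section \<open>Affine rescaling\<close>

lemma affine_lebesgue:
  fixes c :: "'a::euclidean_space"
  assumes "s \<noteq> 0"
  shows "(\<lambda>y. c + s *\<^sub>R y) \<in> lebesgue \<rightarrow>\<^sub>M lebesgue"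
    and "lebesgue = density (distr lebesgue lebesgue (\<lambda>y. c + s *\<^sub>R y)) (\<lambda>_. ennreal (\<bar>s\<bar> ^ DIM('a)))"
proof -
  have *: "(\<lambda>x. c + (\<Sum>j\<in>Basis. (s * (x \<bullet> j)) *\<^sub>R j)) = (\<lambda>y. c + s *\<^sub>R y)"
    by (simp add: scaleR_scaleR[symmetric] scaleR_sum_right[symmetric] euclidean_representation del: scaleR_scaleR)
  show "(\<lambda>y. c + s *\<^sub>R y) \<in> lebesgue \<rightarrow>\<^sub>M lebesgue"
    using lebesgue_affine_measurable[of "\<lambda>_. s" c] assms by (simp add: *)
  show "lebesgue = density (distr lebesgue lebesgue (\<lambda>y. c + s *\<^sub>R y)) (\<lambda>_. ennreal (\<bar>s\<bar> ^ DIM('a)))"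
    using lebesgue_affine_euclidean[of "\<lambda>_. s" c] assms by (simp add: *)
qed

lemma nn_integral_affine_lebesgue:
  fixes c :: "'a::euclidean_space"
  assumes s: "s \<noteq> 0" and f: "f \<in> borel_measurable lebesgue"
  shows "(\<integral>\<^sup>+x. f x \<partial>lebesgue) = ennreal (\<bar>s\<bar> ^ DIM('a)) * (\<integral>\<^sup>+y. f (c + s *\<^sub>R y) \<partial>lebesgue)"
proof -
  note T = affine_lebesgue[OF s, of c]
  have "(\<integral>\<^sup>+x. f x \<partial>lebesgue) = (\<integral>\<^sup>+x. ennreal (\<bar>s\<bar> ^ DIM('a)) * f x \<partial>distr lebesgue lebesgue (\<lambda>y. c + s *\<^sub>R y))"
    by (subst T(2)) (use f in \<open>auto intro: nn_integral_density\<close>)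
  also have "\<dots> = (\<integral>\<^sup>+y. ennreal (\<bar>s\<bar> ^ DIM('a)) * f (c + s *\<^sub>R y) \<partial>lebesgue)"
    using f T(1) by (intro nn_integral_distr) auto
  also have "\<dots> = ennreal (\<bar>s\<bar> ^ DIM('a)) * (\<integral>\<^sup>+y. f (c + s *\<^sub>R y) \<partial>lebesgue)"
    using measurable_compose[OF T(1) f] by (intro nn_integral_cmult)
  finally show ?thesis .
qed

lemma AE_affine_lebesgue:
  fixes c :: "'a::euclidean_space"
  assumes s: "s \<noteq> 0" and P: "AE x in lebesgue. P x"
  shows "AE y in lebesgue. P (c + s *\<^sub>R y)"
proof -
  obtain N where "{x \<in> space lebesgue. \<not> P x} \<subseteq> N" "emeasure lebesgue N = 0" "N \<in> sets lebesgue"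
    using AE_E[OF P] .
  then have N: "N \<in> null_sets lebesgue" "{x. \<not> P x} \<subseteq> N"
    by (blast intro: null_setsI, simp)
  have TN: "(\<lambda>y. c + s *\<^sub>R y) -` N \<inter> space lebesgue \<in> sets lebesgue"
    using N by (intro measurable_sets[OF affine_lebesgue(1)[OF s]]) auto
  have "emeasure lebesgue ((\<lambda>y. c + s *\<^sub>R y) -` N \<inter> space lebesgue) = 0"
  proof -
    have "0 = (\<integral>\<^sup>+x. indicator N x \<partial>lebesgue)" using N by (subst nn_integral_indicator) auto
    also have "\<dots> = ennreal (\<bar>s\<bar> ^ DIM('a)) * (\<integral>\<^sup>+y. indicator N (c + s *\<^sub>R y) \<partial>lebesgue)"
      using N by (intro nn_integral_affine_lebesgue[OF s]) auto
    also have "(\<integral>\<^sup>+y. indicator N (c + s *\<^sub>R y) \<partial>lebesgue) = (\<integral>\<^sup>+y. indicator ((\<lambda>y. c + s *\<^sub>R y) -` N \<inter> space lebesgue) y \<partial>lebesgue)"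
      by (intro nn_integral_cong) (auto split: split_indicator)
    also have "\<dots> = emeasure lebesgue ((\<lambda>y. c + s *\<^sub>R y) -` N \<inter> space lebesgue)"
      using TN by (rule nn_integral_indicator)
    finally show ?thesis using s by simp
  qed
  with TN have "(\<lambda>y. c + s *\<^sub>R y) -` N \<inter> space lebesgue \<in> null_sets lebesgue" by (rule null_setsI[rotated])
  then show ?thesis
    by (rule AE_I') (use N in auto)
qed

text \<open>The formula holds for every \<open>f\<close>: integrability is preserved in both
  directions, and the integral of a non-integrable function is 0 by convention on both sides. Later
  substitutions can thus be made without integrability checks.\<close>

lemma integral_affine_lebesgue:
  fixes c :: "'a::euclidean_space" and f :: "'a \<Rightarrow> 'b::euclidean_space"
  assumes s: "s \<noteq> 0"
  shows "(LINT x|lebesgue. f x) = (\<bar>s\<bar> ^ DIM('a)) *\<^sub>R (LINT y|lebesgue. f (c + s *\<^sub>R y))"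
    and "integrable lebesgue f \<longleftrightarrow> integrable lebesgue (\<lambda>y. f (c + s *\<^sub>R y))"
proof -
  have int: "integrable lebesgue (\<lambda>y. f (c + s *\<^sub>R y))"
    if s: "s \<noteq> 0" and f: "integrable lebesgue f" for f :: "'a \<Rightarrow> 'b" and c s
  proof -
    note T = affine_lebesgue[OF s, of c]
    have m: "f \<in> borel_measurable lebesgue" using f by (rule borel_measurable_integrable)
    have "integrable (density (distr lebesgue lebesgue (\<lambda>y. c + s *\<^sub>R y)) (\<lambda>_. ennreal (\<bar>s\<bar> ^ DIM('a)))) f"
      using f T(2) by simp
    then have "integrable (distr lebesgue lebesgue (\<lambda>y. c + s *\<^sub>R y)) (\<lambda>x. (\<bar>s\<bar> ^ DIM('a)) *\<^sub>R f x)"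
      using m by (subst (asm) integrable_density) auto
    from integrable_scaleR_right[OF this, of "1 / \<bar>s\<bar> ^ DIM('a)"]
    have "integrable (distr lebesgue lebesgue (\<lambda>y. c + s *\<^sub>R y)) f"
      using s by simp
    then show ?thesis using m T(1) by (subst (asm) integrable_distr_eq) auto
  qed
  show iff: "integrable lebesgue f \<longleftrightarrow> integrable lebesgue (\<lambda>y. f (c + s *\<^sub>R y))"
  proof
    assume "integrable lebesgue (\<lambda>y. f (c + s *\<^sub>R y))"
    \<comment> \<open>The inverse map has the same form, with scale \<open>1 / s\<close> and
      translation \<open>- (1 / s) *\<^sub>R c\<close>.\<close>
    from int[OF _ this, of "1 / s" "- (1 / s) *\<^sub>R c"] show "integrable lebesgue f"
      using s by (simp add: scaleR_diff_right)
  qed (rule int[OF s])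
  show "(LINT x|lebesgue. f x) = (\<bar>s\<bar> ^ DIM('a)) *\<^sub>R (LINT y|lebesgue. f (c + s *\<^sub>R y))"
  proof (cases "integrable lebesgue f")
    case True
    note T = affine_lebesgue[OF s, of c]
    have m: "f \<in> borel_measurable lebesgue" using True by (rule borel_measurable_integrable)
    have "(LINT x|lebesgue. f x) = (LINT x|distr lebesgue lebesgue (\<lambda>y. c + s *\<^sub>R y). (\<bar>s\<bar> ^ DIM('a)) *\<^sub>R f x)"
      by (subst T(2), subst integral_density) (use m in auto)
    also have "\<dots> = (LINT y|lebesgue. (\<bar>s\<bar> ^ DIM('a)) *\<^sub>R f (c + s *\<^sub>R y))"
      using m T(1) by (intro integral_distr) auto
    finally show ?thesis by simp
  qed (use iff in \<open>simp add: not_integrable_integral_eq\<close>)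
qed

section \<open>Function classes and weak derivatives under a dilation followed by a
  translation\<close>

context
  fixes c :: "real^'N::finite" and s :: real and T :: "real^'N \<Rightarrow> real^'N"
  assumes s: "s > 0"
  defines "T \<equiv> \<lambda>y. c + s *\<^sub>R y"
begin

lemma affine_inverse: "T ((1 / s) *\<^sub>R (x - c)) = x" "(1 / s) *\<^sub>R (T y - c) = y"
  using s by (auto simp: T_def)

lemma partials_affine:
  assumes "\<forall>I x. partials I \<eta> differentiable (at x)"
  shows "partials I (\<lambda>x. \<eta> ((1 / s) *\<^sub>R (x - c))) = (\<lambda>x. (1 / s) ^ length I * partials I \<eta> ((1 / s) *\<^sub>R (x - c)))"
proof (induction I)
  case (Cons i I)
  let ?T = "\<lambda>x. (1 / s) *\<^sub>R (x - c)"
  have d: "((\<lambda>x. (1 / s) ^ length I * partials I \<eta> (?T x)) has_derivative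
      (\<lambda>h. (1 / s) ^ length I * frechet_derivative (partials I \<eta>) (at (?T x)) ((1 / s) *\<^sub>R h))) (at x)" for x
  proof (rule has_derivative_mult_right)
    have "(?T has_derivative (\<lambda>h. (1 / s) *\<^sub>R h)) (at x)"
      by (auto intro!: derivative_eq_intros)
    moreover have "(partials I \<eta> has_derivative frechet_derivative (partials I \<eta>) (at (?T x))) (at (?T x))"
      using assms by (simp add: frechet_derivative_works)
    ultimately show "((\<lambda>x. partials I \<eta> (?T x)) has_derivative
        (\<lambda>h. frechet_derivative (partials I \<eta>) (at (?T x)) ((1 / s) *\<^sub>R h))) (at x)"
      by (rule has_derivative_compose)
  qed
  have lin: "linear (frechet_derivative (partials I \<eta>) (at x))" for x
    using assms by (simp add: linear_frechet_derivative)
  show ?case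
    unfolding partials.simps Cons frechet_derivative_at[OF d, symmetric]
    by (simp add: linear_scale[OF lin] mult.commute)
qed simp

lemma test_function_affine:
  assumes \<eta>: "test_function Q \<eta>" and TQ: "T ` Q \<subseteq> U"
  shows "test_function U (\<lambda>x. \<eta> ((1 / s) *\<^sub>R (x - c)))"
proof -
  let ?K = "closure {x. \<eta> x \<noteq> 0}"
  have d: "\<forall>I x. partials I \<eta> differentiable (at x)" and K: "compact ?K" "?K \<subseteq> Q"
    using \<eta> by (auto simp: test_function_def)
  have diff: "partials I (\<lambda>x. \<eta> ((1 / s) *\<^sub>R (x - c))) differentiable (at x)" for I x
  proof -
    have "(\<lambda>x. partials I \<eta> ((1 / s) *\<^sub>R (x - c))) differentiable (at x)"
      by (rule differentiable_compose[of "partials I \<eta>"]) (use d in auto)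
    then show ?thesis unfolding partials_affine[OF d] by simp
  qed
  have TK: "compact (T ` ?K)"
    unfolding T_def by (intro compact_continuous_image K continuous_intros)
  have "{x. \<eta> ((1 / s) *\<^sub>R (x - c)) \<noteq> 0} \<subseteq> T ` ?K"
  proof
    fix x assume "x \<in> {x. \<eta> ((1 / s) *\<^sub>R (x - c)) \<noteq> 0}"
    then have "(1 / s) *\<^sub>R (x - c) \<in> ?K" using closure_subset[of "{x. \<eta> x \<noteq> 0}"] by auto
    then show "x \<in> T ` ?K" using affine_inverse(1)[of x] by (metis imageI)
  qed
  then have sub: "closure {x. \<eta> ((1 / s) *\<^sub>R (x - c)) \<noteq> 0} \<subseteq> T ` ?K"
    using TK by (intro closure_minimal) (auto intro: compact_imp_closed)
  moreover have "T ` ?K \<subseteq> U" using K TQ by auto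
  ultimately show ?thesis
    using diff TK unfolding test_function_def
    by (meson bounded_subset closed_closure compact_eq_bounded_closed order_trans)
qed

lemma Lp_affine:
  fixes f :: "real^'N \<Rightarrow> 'b::euclidean_space"
  assumes f: "Lp S q f" and TQ: "T ` Q \<subseteq> S" and Q: "Q \<in> sets lebesgue"
  shows "Lp Q q (\<lambda>y. a *\<^sub>R f (T y))"
proof -
  have s0: "s \<noteq> 0" using s by simp
  have "(\<lambda>x. indicat_real S x *\<^sub>R f x) \<in> borel_measurable lebesgue"
    using f by (simp add: Lp_def set_borel_measurable_def)
  then have comp: "(\<lambda>y. indicator S (T y) *\<^sub>R f (T y)) \<in> borel_measurable lebesgue"
    unfolding T_def by (rule measurable_compose[OF affine_lebesgue(1)[OF s0]])
  have "(\<lambda>y. indicator Q y *\<^sub>R a *\<^sub>R (indicator S (T y) *\<^sub>R f (T y))) \<in> borel_measurable lebesgue"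
    by (rule borel_measurable_scaleR[OF borel_measurable_indicator[OF Q]
          borel_measurable_scaleR[OF borel_measurable_const comp]])
  moreover have "indicator Q y *\<^sub>R a *\<^sub>R (indicator S (T y) *\<^sub>R f (T y)) = indicator Q y *\<^sub>R a *\<^sub>R f (T y)" for y
    using TQ by (auto split: split_indicator)
  ultimately have 1: "set_borel_measurable lebesgue Q (\<lambda>y. a *\<^sub>R f (T y))"
    unfolding set_borel_measurable_def by (simp only:)
  have "integrable lebesgue (\<lambda>x. indicat_real S x *\<^sub>R norm (f x) powr q)"
    using f by (simp add: Lp_def set_integrable_def)
  then have "integrable lebesgue (\<lambda>y. indicat_real S (T y) *\<^sub>R norm (f (T y)) powr q)"
    unfolding T_def by (subst (asm) integral_affine_lebesgue(2)[OF s0])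
  then have "integrable lebesgue (\<lambda>y. indicator Q y *\<^sub>R (\<bar>a\<bar> powr q * (indicat_real S (T y) *\<^sub>R norm (f (T y)) powr q)))"
    using Q by (intro integrable_mult_indicator integrable_mult_right)
  moreover have "indicator Q y *\<^sub>R (\<bar>a\<bar> powr q * (indicat_real S (T y) *\<^sub>R norm (f (T y)) powr q))
      = indicator Q y *\<^sub>R norm (a *\<^sub>R f (T y)) powr q" for y
    using TQ by (auto split: split_indicator simp: powr_mult)
  ultimately have "set_integrable lebesgue Q (\<lambda>y. norm (a *\<^sub>R f (T y)) powr q)"
    unfolding set_integrable_def by (simp only:)
  with 1 show ?thesis by (simp add: Lp_def)
qed

lemma Lp_loc_affine:
  fixes f :: "real^'N \<Rightarrow> 'b::euclidean_space"
  assumes f: "Lp_loc U q f" and TQ: "T ` Q \<subseteq> U"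
  shows "Lp_loc Q q (\<lambda>y. a *\<^sub>R f (T y))"
  unfolding Lp_loc_def
proof (intro allI impI)
  fix K assume K: "compact K \<and> K \<subseteq> Q"
  then have "compact (T ` K)"
    unfolding T_def by (intro compact_continuous_image continuous_intros) auto
  moreover have "T ` K \<subseteq> U" using K TQ by auto
  ultimately have "Lp (T ` K) q f" using f by (simp add: Lp_loc_def)
  then show "Lp K q (\<lambda>y. a *\<^sub>R f (T y))"
    by (rule Lp_affine) (use K in \<open>auto intro: lmeasurable_compact fmeasurableD\<close>)
qed

text \<open>The closure of \<open>Q\<close> is mapped onto a compact subset of \<open>U\<close>;
  local integrability on \<open>U\<close> thereby becomes integrability on all of
  \<open>Q\<close>.\<close>

lemma Lp_loc_Lp_affine:
  fixes f :: "real^'N \<Rightarrow> 'b::euclidean_space"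
  assumes f: "Lp_loc U q f" and Q: "open Q" "bounded Q" and TQ: "T ` closure Q \<subseteq> U"
  shows "Lp Q q (\<lambda>y. a *\<^sub>R f (T y))"
proof -
  have "compact (T ` closure Q)"
    unfolding T_def by (intro compact_continuous_image continuous_intros) (use Q in auto)
  then have "Lp (T ` closure Q) q f" using f TQ by (simp add: Lp_loc_def)
  then show ?thesis
    by (rule Lp_affine) (use Q closure_subset in auto)
qed

text \<open>A test function on \<open>Q\<close> is transported to \<open>U\<close> by the inverse
  map. Substitution produces the same Jacobian on both sides of the defining identity, and the
  derivatives of the transported function supply \<open>(1 / s) ^ length I\<close>, whence the
  chain-rule factor \<open>s ^ length I\<close>.\<close>

lemma is_weak_deriv_affine:
  fixes f g :: "real^'N \<Rightarrow> 'b::euclidean_space"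
  assumes fg: "is_weak_deriv U I f g" and TQ: "T ` Q \<subseteq> U"
  shows "is_weak_deriv Q I (\<lambda>y. a *\<^sub>R f (T y)) (\<lambda>y. (a * s ^ length I) *\<^sub>R g (T y))"
  unfolding is_weak_deriv_def
proof (intro conjI allI impI)
  have L: "Lp_loc U 1 f" "Lp_loc U 1 g" using fg by (auto simp: is_weak_deriv_def)
  show "Lp_loc Q 1 (\<lambda>y. a *\<^sub>R f (T y))" "Lp_loc Q 1 (\<lambda>y. (a * s ^ length I) *\<^sub>R g (T y))"
    by (intro Lp_loc_affine[OF _ TQ] L)+
  fix \<eta> assume \<eta>: "test_function Q \<eta>"
  have s0: "s \<noteq> 0" using s by simp
  have d: "\<forall>I x. partials I \<eta> differentiable (at x)" using \<eta> by (simp add: test_function_def)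
  define \<xi> where "\<xi> = (\<lambda>x. \<eta> ((1 / s) *\<^sub>R (x - c)))"
  have \<xi>: "test_function U \<xi>" unfolding \<xi>_def by (rule test_function_affine[OF \<eta> TQ])
  \<comment> \<open>After substitution the domain is the preimage of \<open>U\<close>, which may be
    larger than \<open>Q\<close>; vanishing outside \<open>Q\<close> allows the two to be
    exchanged.\<close>
  have zero: "partials J \<eta> y = 0" if "y \<notin> Q" for J y
    using test_function_partials[OF \<eta>, of J] that closure_subset[of "{x. partials J \<eta> x \<noteq> 0}"]
    unfolding test_function_def by blast
  have ch: "(LINT x:U|lebesgue. partials J \<xi> x *\<^sub>R h x) =
      (s ^ CARD('N) * (1 / s) ^ length J) *\<^sub>R (LINT y:Q|lebesgue. partials J \<eta> y *\<^sub>R h (T y))"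
    for J and h :: "real^'N \<Rightarrow> 'b"
  proof -
    have "(LINT x:U|lebesgue. partials J \<xi> x *\<^sub>R h x) =
      (s ^ CARD('N)) *\<^sub>R (LINT y|lebesgue. indicator U (T y) *\<^sub>R partials J \<xi> (T y) *\<^sub>R h (T y))"
      unfolding set_lebesgue_integral_def T_def
      by (subst integral_affine_lebesgue(1)[OF s0, of _ c]) (use s in simp)
    also have "(\<lambda>y. indicator U (T y) *\<^sub>R partials J \<xi> (T y) *\<^sub>R h (T y)) =
      (\<lambda>y. (1 / s) ^ length J *\<^sub>R (indicator Q y *\<^sub>R partials J \<eta> y *\<^sub>R h (T y)))"
    proof
      fix y
      show "indicator U (T y) *\<^sub>R partials J \<xi> (T y) *\<^sub>R h (T y) = (1 / s) ^ length J *\<^sub>R (indicator Q y *\<^sub>R partials J \<eta> y *\<^sub>R h (T y))"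
        unfolding \<xi>_def partials_affine[OF d] affine_inverse
        using zero[of y J] TQ by (cases "y \<in> Q") auto
    qed
    finally show ?thesis
      unfolding set_lebesgue_integral_def Bochner_Integration.integral_scaleR_right by (simp only: scaleR_scaleR)
  qed
  let ?X = "LINT y:Q|lebesgue. partials I \<eta> y *\<^sub>R f (T y)" and ?Y = "LINT y:Q|lebesgue. \<eta> y *\<^sub>R g (T y)"
  have eq: "(s ^ CARD('N) * (1 / s) ^ length I) *\<^sub>R ?X = (-1) ^ length I *\<^sub>R (s ^ CARD('N)) *\<^sub>R ?Y"
    using fg \<xi> ch[of I f] ch[of "[]" g] by (simp add: is_weak_deriv_def)
  have "?X = (s ^ length I / s ^ CARD('N)) *\<^sub>R (s ^ CARD('N) * (1 / s) ^ length I) *\<^sub>R ?X"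
    using s by (simp add: power_divide)
  then have "?X = (s ^ length I) *\<^sub>R (-1) ^ length I *\<^sub>R ?Y"
    unfolding eq using s by simp
  moreover have "(LINT x:Q|lebesgue. partials I \<eta> x *\<^sub>R a *\<^sub>R f (T x)) = a *\<^sub>R ?X"
    by (simp add: mult.commute flip: set_integral_scaleR_right)
  moreover have "(LINT x:Q|lebesgue. \<eta> x *\<^sub>R (a * s ^ length I) *\<^sub>R g (T x))
      = (a * s ^ length I) *\<^sub>R ?Y"
    by (simp add: mult.commute mult.left_commute flip: set_integral_scaleR_right)
  ultimately show "(LINT x:Q|lebesgue. partials I \<eta> x *\<^sub>R a *\<^sub>R f (T x)) =
      (- 1) ^ length I *\<^sub>R (LINT x:Q|lebesgue. \<eta> x *\<^sub>R (a * s ^ length I) *\<^sub>R g (T x))"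
    by (simp add: mult_ac)
qed

text \<open>Both sides are weak derivatives of the same function on \<open>Q\<close>, so they agree
  almost everywhere. Existence of a weak derivative on \<open>U\<close> ensures that both choices
  really satisfy \<open>is_weak_deriv\<close>.\<close>

lemma weak_deriv_affine:
  fixes f :: "real^'N \<Rightarrow> 'b::euclidean_space"
  assumes ex: "\<exists>g. is_weak_deriv U I f g" and Q: "open Q" and TQ: "T ` Q \<subseteq> U"
  shows "AE y\<in>Q in lebesgue. weak_deriv Q I (\<lambda>y. a *\<^sub>R f (T y)) y = (a * s ^ length I) *\<^sub>R weak_deriv U I f (T y)"
proof -
  have "is_weak_deriv U I f (weak_deriv U I f)"
    unfolding weak_deriv_def using ex by (rule someI_ex)
  note * = is_weak_deriv_affine[OF this TQ, of a]
  moreover have "is_weak_deriv Q I (\<lambda>y. a *\<^sub>R f (T y)) (weak_deriv Q I (\<lambda>y. a *\<^sub>R f (T y)))"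
    unfolding weak_deriv_def[of Q] by (rule someI[where P = "is_weak_deriv Q I (\<lambda>y. a *\<^sub>R f (T y))", OF *])
  ultimately show ?thesis using is_weak_deriv_unique[OF Q] by blast
qed

lemma sobolev_affine:
  fixes f :: "real^'N \<Rightarrow> 'b::euclidean_space"
  assumes f: "sobolev_loc l q U f" and Q: "open Q" "bounded Q" and TQ: "T ` closure Q \<subseteq> U"
  shows "sobolev l q Q (\<lambda>y. a *\<^sub>R f (T y))"
  unfolding sobolev_def
proof (intro allI impI)
  fix I :: "'N list" assume "length I \<le> l"
  then obtain g where g: "is_weak_deriv U I f g" "Lp_loc U q g" using f by (auto simp: sobolev_loc_def)
  have "T ` Q \<subseteq> U" using TQ closure_subset by blast
  then show "\<exists>g. is_weak_deriv Q I (\<lambda>y. a *\<^sub>R f (T y)) g \<and> Lp Q q g"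
    using is_weak_deriv_affine[OF g(1)] Lp_loc_Lp_affine[OF g(2) Q TQ] by blast
qed

text \<open>The substitution used for weak derivatives; the factor \<open>1 / s\<close> from the
  transported test function does no harm to an equation with right-hand side 0.\<close>

lemma div_free_affine:
  fixes \<theta> :: "real^'N \<Rightarrow> real^'N^'d::finite"
  assumes \<theta>: "div_free U \<theta>" and TQ: "T ` Q \<subseteq> U"
  shows "div_free Q (\<lambda>y. \<theta> (T y))"
  unfolding div_free_def
proof (intro conjI allI impI)
  show "Lp_loc Q 1 (\<lambda>y. \<theta> (T y))"
    using Lp_loc_affine[OF _ TQ, of 1 \<theta> 1] \<theta> by (simp add: div_free_def)
  fix \<eta> assume \<eta>: "test_function Q \<eta>"
  have s0: "s \<noteq> 0" using s by simp
  have d: "\<forall>I x. partials I \<eta> differentiable (at x)" using \<eta> by (simp add: test_function_def)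
  define \<xi> where "\<xi> = (\<lambda>x. \<eta> ((1 / s) *\<^sub>R (x - c)))"
  have \<xi>: "test_function U \<xi>" unfolding \<xi>_def by (rule test_function_affine[OF \<eta> TQ])
  have zero: "partials J \<eta> y = 0" if "y \<notin> Q" for J y
    using test_function_partials[OF \<eta>, of J] that closure_subset[of "{x. partials J \<eta> x \<noteq> 0}"]
    unfolding test_function_def by blast
  have "0 = (LINT x:U|lebesgue. \<theta> x *v (\<chi> j. partials [j] \<xi> x))"
    using \<theta> \<xi> by (simp add: div_free_def)
  also have "\<dots> = (s ^ CARD('N)) *\<^sub>R (LINT y|lebesgue. indicator U (T y) *\<^sub>R (\<theta> (T y) *v (\<chi> j. partials [j] \<xi> (T y))))"
    unfolding set_lebesgue_integral_def T_def
    by (subst integral_affine_lebesgue(1)[OF s0, of _ c]) (use s in simp)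
  also have "(\<lambda>y. indicator U (T y) *\<^sub>R (\<theta> (T y) *v (\<chi> j. partials [j] \<xi> (T y)))) =
      (\<lambda>y. (1 / s) *\<^sub>R (indicator Q y *\<^sub>R (\<theta> (T y) *v (\<chi> j. partials [j] \<eta> y))))"
  proof
    fix y
    have "(\<chi> j. partials [j] \<xi> (T y)) = (1 / s) *\<^sub>R (\<chi> j. partials [j] \<eta> y)"
      unfolding \<xi>_def partials_affine[OF d] affine_inverse by (simp add: vec_eq_iff)
    moreover have "(\<chi> j. partials [j] \<eta> y) = 0" if "y \<notin> Q"
      using zero[OF that] by (simp add: vec_eq_iff del: partials.simps)
    ultimately show "indicator U (T y) *\<^sub>R (\<theta> (T y) *v (\<chi> j. partials [j] \<xi> (T y))) =
       (1 / s) *\<^sub>R (indicator Q y *\<^sub>R (\<theta> (T y) *v (\<chi> j. partials [j] \<eta> y)))"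
      using TQ by (cases "y \<in> Q") (auto simp: matrix_vector_mult_scaleR simp del: partials.simps)
  qed
  finally show "(LINT y:Q|lebesgue. \<theta> (T y) *v (\<chi> j. partials [j] \<eta> y)) = 0"
    unfolding set_lebesgue_integral_def Bochner_Integration.integral_scaleR_right
    using s by (simp del: partials.simps)
qed

end

section \<open>Competitors for the cell problem\<close>

lemma scaled_jet_in_jets: "scaled_jet n \<epsilon> U u \<theta> \<gamma> y \<in> jets n"
  by (simp add: jets_def scaled_jet_def)

lemma AE_ball_in_finite:
  assumes "finite S" "\<And>i. i \<in> S \<Longrightarrow> AE x\<in>Q in M. P i x"
  shows "AE x\<in>Q in M. \<forall>i\<in>S. P i x"
proof -
  have "AE x in M. \<forall>i\<in>S. x \<in> Q \<longrightarrow> P i x"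
    using assms by (intro AE_finite_allI)
  then show ?thesis by (rule eventually_mono) auto
qed

lemma sobolev_loc_weak_deriv:
  "sobolev_loc l q U f \<Longrightarrow> length I \<le> l \<Longrightarrow> \<exists>g. is_weak_deriv U I f g"
  unfolding sobolev_loc_def by blast

text \<open>The factor \<open>1 / s\<close> in front of \<open>v\<close> cancels the
  \<open>s\<close> from the one additional derivative, so all three components of order
  \<open>j\<close> scale by \<open>s ^ j\<close>, which \<open>(\<epsilon> / s) ^ j\<close>
  compensates. Only finitely many lists of length at most \<open>n\<close> exist, so one null set
  serves for all of them; the gradient is the case of the empty list.\<close>

lemma AE_scaled_jet_affine:
  fixes v :: "real^'N::finite \<Rightarrow> real^'k::finite" and m :: "real^'N \<Rightarrow> real^'N^'d::finite"
    and \<psi> :: "real^'N \<Rightarrow> real^'m::finite" and c :: "real^'N"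
  assumes s: "s > 0" and Q: "open Q" and TQ: "(\<lambda>y. c + s *\<^sub>R y) ` Q \<subseteq> U"
    and v: "sobolev_loc 1 q\<^sub>1 U v" "sobolev_loc (n + 1) p U v"
    and m: "sobolev_loc n p U m" and \<psi>: "sobolev_loc n p U \<psi>"
  defines "T \<equiv> \<lambda>y. c + s *\<^sub>R y"
  shows "AE y\<in>Q in lebesgue.
    scaled_jet n (\<epsilon> / s) Q (\<lambda>y. (1 / s) *\<^sub>R v (T y)) (\<lambda>y. m (T y)) (\<lambda>y. \<psi> (T y)) y
      = scaled_jet n \<epsilon> U v m \<psi> (T y) \<and>
    weak_grad Q (\<lambda>y. (1 / s) *\<^sub>R v (T y)) y = weak_grad U v (T y)"
proof -
  let ?S = "{I :: 'N list. length I \<le> n}"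
  let ?u = "\<lambda>y. (1 / s) *\<^sub>R v (T y)"
  have fin: "finite ?S" using finite_lists_length_le[of "UNIV :: 'N set" n] by simp
  note TQ = TQ[folded T_def]
  have 1: "AE y\<in>Q in lebesgue. \<forall>I\<in>?S. \<forall>j\<in>UNIV. weak_deriv Q (I @ [j]) ?u y
      = s ^ length I *\<^sub>R weak_deriv U (I @ [j]) v (T y)"
  proof (intro AE_ball_in_finite fin finite)
    fix I :: "'N list" and j assume "I \<in> ?S"
    then have "\<exists>g. is_weak_deriv U (I @ [j]) v g" by (intro sobolev_loc_weak_deriv[OF v(2)]) auto
    from weak_deriv_affine[OF s this Q TQ[unfolded T_def], of "1 / s"]
    show "AE y\<in>Q in lebesgue. weak_deriv Q (I @ [j]) ?u y = s ^ length I *\<^sub>R weak_deriv U (I @ [j]) v (T y)"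
      using s by (simp add: T_def)
  qed
  have 2: "AE y\<in>Q in lebesgue. \<forall>I\<in>?S. weak_deriv Q I (\<lambda>y. m (T y)) y = s ^ length I *\<^sub>R weak_deriv U I m (T y)"
  proof (intro AE_ball_in_finite fin)
    fix I :: "'N list" assume "I \<in> ?S"
    then have "\<exists>g. is_weak_deriv U I m g" by (intro sobolev_loc_weak_deriv[OF m]) auto
    from weak_deriv_affine[OF s this Q TQ[unfolded T_def], of 1]
    show "AE y\<in>Q in lebesgue. weak_deriv Q I (\<lambda>y. m (T y)) y = s ^ length I *\<^sub>R weak_deriv U I m (T y)"
      by (simp add: T_def)
  qed
  have 3: "AE y\<in>Q in lebesgue. \<forall>I\<in>?S. weak_deriv Q I (\<lambda>y. \<psi> (T y)) y = s ^ length I *\<^sub>R weak_deriv U I \<psi> (T y)"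
  proof (intro AE_ball_in_finite fin)
    fix I :: "'N list" assume "I \<in> ?S"
    then have "\<exists>g. is_weak_deriv U I \<psi> g" by (intro sobolev_loc_weak_deriv[OF \<psi>]) auto
    from weak_deriv_affine[OF s this Q TQ[unfolded T_def], of 1]
    show "AE y\<in>Q in lebesgue. weak_deriv Q I (\<lambda>y. \<psi> (T y)) y = s ^ length I *\<^sub>R weak_deriv U I \<psi> (T y)"
      by (simp add: T_def)
  qed
  show ?thesis
    using 1 2 3
  proof eventually_elim
    case (elim y)
    show ?case
    proof (intro impI conjI ext)
      assume y: "y \<in> Q"
      show "weak_grad Q ?u y = weak_grad U v (T y)"
      proof -
        have "weak_deriv Q [j] ?u y = weak_deriv U [j] v (T y)" for j
          using elim(1)[rule_format, OF y, of "[]" j] by simp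
        then show ?thesis by (simp add: weak_grad_def)
      qed
      fix I :: "'N list"
      show "scaled_jet n (\<epsilon> / s) Q ?u (\<lambda>y. m (T y)) (\<lambda>y. \<psi> (T y)) y I = scaled_jet n \<epsilon> U v m \<psi> (T y) I"
      proof (cases "length I \<in> {1..n}")
        case True
        then have I: "I \<in> ?S" by simp
        have "(\<epsilon> / s) ^ length I * s ^ length I = \<epsilon> ^ length I" using s by (simp add: power_divide)
        then show ?thesis
          using True elim I y by (simp add: scaled_jet_def vec_eq_iff mult.assoc[symmetric])
      qed (auto simp: scaled_jet_def)
    qed
  qed
qed

section \<open>Measurability of the energy density\<close>

lemma Lp_loc_borel_measurable:
  fixes g :: "'a::euclidean_space \<Rightarrow> 'b::euclidean_space"
  assumes U: "open U" and g: "Lp_loc U q g"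
  shows "(\<lambda>x. indicator U x *\<^sub>R g x) \<in> borel_measurable lebesgue"
proof -
  obtain C :: "nat \<Rightarrow> 'a set" where C: "\<And>n. compact (C n)" "\<And>n. C n \<subseteq> U" "\<And>n. C n \<subseteq> interior (C (Suc n))" "\<Union> (range C) = U"
    using open_Union_compact_subsets[OF U] by metis
  have "C n \<subseteq> C (Suc n)" for n
    by (rule order_trans[OF C(3) interior_subset])
  then have inc: "C n \<subseteq> C m" if "n \<le> m" for n m
    using that by (rule lift_Suc_mono_le[of C])
  show ?thesis
  proof (rule borel_measurable_LIMSEQ_metric)
    show "(\<lambda>x. indicator (C n) x *\<^sub>R g x) \<in> borel_measurable lebesgue" for n
      using g C by (auto simp: Lp_loc_def Lp_def set_borel_measurable_def)
    show "(\<lambda>n. indicat_real (C n) x *\<^sub>R g x) \<longlonglongrightarrow> indicator U x *\<^sub>R g x" for x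
    proof (cases "x \<in> U")
      case True
      then obtain k where "x \<in> C k" using C(4) by blast
      then have "x \<in> C n" if "k \<le> n" for n using inc[OF that] by blast
      then have "\<forall>n\<ge>k. indicator U x *\<^sub>R g x = indicat_real (C n) x *\<^sub>R g x" using True by auto
      then show ?thesis
        by (intro Lim_transform_eventually[OF tendsto_const]) (auto simp: eventually_sequentially)
    next
      case False
      then have "x \<notin> C n" for n using C(2) by blast
      then show ?thesis using False by simp
    qed
  qed
qed

lemma weak_deriv_borel_measurable:
  fixes f :: "real^'N::finite \<Rightarrow> 'b::euclidean_space"
  assumes U: "open U" and ex: "\<exists>g. is_weak_deriv U I f g"
  shows "(\<lambda>x. indicator U x *\<^sub>R weak_deriv U I f x) \<in> borel_measurable lebesgue"
proof -
  have "is_weak_deriv U I f (weak_deriv U I f)"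
    unfolding weak_deriv_def using ex by (rule someI_ex)
  then show ?thesis by (intro Lp_loc_borel_measurable[OF U]) (auto simp: is_weak_deriv_def)
qed

lemma borel_measurable_matrix:
  fixes f :: "'a \<Rightarrow> real^'n::finite^'m::finite"
  assumes "\<And>i j. (\<lambda>x. f x $ i $ j) \<in> borel_measurable M"
  shows "f \<in> borel_measurable M"
  using assms by (subst borel_measurable_euclidean_space) (auto simp: Basis_vec_def inner_axis)

lemma weak_grad_borel_measurable:
  assumes U: "open U" and v: "sobolev_loc 1 q U v"
  shows "(\<lambda>x. indicator U x *\<^sub>R weak_grad U v x) \<in> borel_measurable lebesgue"
proof (rule borel_measurable_matrix)
  fix i j
  have "(\<lambda>x. indicator U x *\<^sub>R weak_deriv U [j] v x) \<in> borel_measurable lebesgue"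
    by (intro weak_deriv_borel_measurable[OF U] sobolev_loc_weak_deriv[OF v]) simp
  then have "(\<lambda>x. (indicator U x *\<^sub>R weak_deriv U [j] v x) \<bullet> axis i 1) \<in> borel_measurable lebesgue"
    by (intro borel_measurable_inner) auto
  then show "(\<lambda>x. (indicator U x *\<^sub>R weak_grad U v x) $ i $ j) \<in> borel_measurable lebesgue"
    by (simp add: weak_grad_def inner_axis)
qed

text \<open>\<open>F\<close> is continuous only on jets, and the functions are known to be
  measurable only inside \<open>U\<close>. Multiplying the jet and the lowest-order state by the
  indicator of \<open>U\<close> respects both constraints: the components become measurable on the
  whole space and the function on lists stays a jet. As there are countably many lists,
  componentwise measurability gives Borel measurability for the product topology.\<close>

lemma energy_density_borel_measurable:
  fixes F :: "('N::finite, 'k::finite, 'd::finite, 'm::finite) density"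
    and v :: "real^'N \<Rightarrow> real^'k" and m :: "real^'N \<Rightarrow> real^'N^'d" and \<psi> :: "real^'N \<Rightarrow> real^'m"
  assumes U: "open U" and F: "continuous_on (jets n \<times> UNIV \<times> UNIV) (\<lambda>(a, b, x). F a b x)"
    and v: "sobolev_loc 1 q\<^sub>1 U v" "sobolev_loc (n + 1) p U v"
    and m: "Lp_loc U q\<^sub>2 m" "sobolev_loc n p U m" and \<psi>: "Lp_loc U q\<^sub>3 \<psi>" "sobolev_loc n p U \<psi>"
  shows "(\<lambda>x. indicator U x * ennreal (1 / \<epsilon> * F (scaled_jet n \<epsilon> U v m \<psi> x) (weak_grad U v x, m x, \<psi> x) x))
    \<in> borel_measurable lebesgue"
proof -
  define j where "j x I = indicat_real U x *\<^sub>R scaled_jet n \<epsilon> U v m \<psi> x I" for x I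
  define b where "b x = (indicat_real U x *\<^sub>R weak_grad U v x, indicat_real U x *\<^sub>R m x, indicat_real U x *\<^sub>R \<psi> x)" for x
  have jI: "(\<lambda>x. j x I) \<in> borel_measurable lebesgue" for I
  proof (cases "length I \<in> {1..n}")
    case True
    define A where "A x = indicat_real U x *\<^sub>R (\<chi> i j. weak_deriv U (I @ [j]) v x $ i)" for x
    have "A \<in> borel_measurable lebesgue"
    proof (rule borel_measurable_matrix)
      fix i k
      have "(\<lambda>x. indicator U x *\<^sub>R weak_deriv U (I @ [k]) v x) \<in> borel_measurable lebesgue"
        using True by (intro weak_deriv_borel_measurable[OF U] sobolev_loc_weak_deriv[OF v(2)]) simp
      then have "(\<lambda>x. (indicator U x *\<^sub>R weak_deriv U (I @ [k]) v x) \<bullet> axis i 1) \<in> borel_measurable lebesgue"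
        by (intro borel_measurable_inner) auto
      then show "(\<lambda>x. A x $ i $ k) \<in> borel_measurable lebesgue"
        by (simp add: A_def inner_axis)
    qed
    moreover have "(\<lambda>x. indicator U x *\<^sub>R weak_deriv U I m x) \<in> borel_measurable lebesgue"
      "(\<lambda>x. indicator U x *\<^sub>R weak_deriv U I \<psi> x) \<in> borel_measurable lebesgue"
      using True by (auto intro!: weak_deriv_borel_measurable[OF U] sobolev_loc_weak_deriv[OF m(2)]
          sobolev_loc_weak_deriv[OF \<psi>(2)])
    ultimately have "(\<lambda>x. (A x, indicat_real U x *\<^sub>R weak_deriv U I m x, indicat_real U x *\<^sub>R weak_deriv U I \<psi> x)) \<in> borel_measurable lebesgue"
      by (intro borel_measurable_Pair)
    then have "(\<lambda>x. \<epsilon> ^ length I *\<^sub>R (A x, indicat_real U x *\<^sub>R weak_deriv U I m x, indicat_real U x *\<^sub>R weak_deriv U I \<psi> x)) \<in> borel_measurable lebesgue"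
      by (rule borel_measurable_scaleR[OF borel_measurable_const])
    moreover have "j x I = \<epsilon> ^ length I *\<^sub>R (A x, indicat_real U x *\<^sub>R weak_deriv U I m x, indicat_real U x *\<^sub>R weak_deriv U I \<psi> x)" for x
      using True by (simp add: j_def A_def scaled_jet_def mult.commute)
    ultimately show ?thesis by (simp only:)
  next
    case False
    then have "j x I = 0" for x by (auto simp: j_def scaled_jet_def)
    then show ?thesis by simp
  qed
  have jm: "j \<in> borel_measurable lebesgue"
    by (rule measurable_coordinatewise_then_product) (rule jI)
  have bm: "b \<in> borel_measurable lebesgue"
    unfolding b_def
    by (intro borel_measurable_Pair weak_grad_borel_measurable[OF U v(1)]
        Lp_loc_borel_measurable[OF U m(1)] Lp_loc_borel_measurable[OF U \<psi>(1)])
  have idm: "(\<lambda>x. x) \<in> borel_measurable (lebesgue :: (real^'N) measure)"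
    by (intro measurable_completion) simp
  have "(\<lambda>x. (j x, b x, x)) \<in> borel_measurable lebesgue"
    by (intro borel_measurable_Pair jm bm idm)
  moreover have "j x \<in> jets n" for x
    by (auto simp: j_def jets_def scaled_jet_def)
  ultimately have "(\<lambda>x. (j x, b x, x)) \<in> lebesgue \<rightarrow>\<^sub>M restrict_space borel (jets n \<times> UNIV \<times> UNIV)"
    by (intro measurable_restrict_space2) auto
  then have "(\<lambda>x. (\<lambda>(a, b, x). F a b x) (j x, b x, x)) \<in> borel_measurable lebesgue"
    by (rule measurable_compose) (rule borel_measurable_continuous_on_restrict[OF F])
  then have "(\<lambda>x. F (j x) (b x) x) \<in> borel_measurable lebesgue" by simp
  then have [measurable]: "(\<lambda>x. F (j x) (b x) x) \<in> borel_measurable lebesgue" .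
  have [measurable]: "U \<in> sets lebesgue" using U by simp
  have "(\<lambda>x. indicator U x * ennreal (1 / \<epsilon> * F (j x) (b x) x)) \<in> borel_measurable lebesgue"
    by measurable
  moreover have "indicator U x * ennreal (1 / \<epsilon> * F (j x) (b x) x)
     = indicator U x * ennreal (1 / \<epsilon> * F (scaled_jet n \<epsilon> U v m \<psi> x) (weak_grad U v x, m x, \<psi> x) x)" for x
  proof (cases "x \<in> U")
    case True
    then have "j x = scaled_jet n \<epsilon> U v m \<psi> x" by (simp add: j_def fun_eq_iff)
    then show ?thesis using True by (simp add: b_def)
  qed simp
  ultimately show ?thesis by (simp only:)
qed

text \<open>The constraints that \<open>cell_functional\<close> puts on a family at each single
  \<epsilon>; convergence is kept apart because it concerns the family as a whole.\<close>

definition admissible :: "nat \<Rightarrow> real \<Rightarrow> real \<Rightarrow> real \<Rightarrow> real \<Rightarrow> (real^'m::finite) set \<Rightarrow> (real^'N::finite) set \<Rightarrow>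
    (real^'N \<Rightarrow> real^'k::finite) \<Rightarrow> (real^'N \<Rightarrow> real^'N^'d::finite) \<Rightarrow> (real^'N \<Rightarrow> real^'m) \<Rightarrow> bool" where
  "admissible n p q\<^sub>1 q\<^sub>2 q\<^sub>3 M Q u \<theta> \<gamma> \<longleftrightarrow> sobolev 1 q\<^sub>1 Q u \<and> sobolev (n + 1) p Q u \<and>
     Lp Q q\<^sub>2 \<theta> \<and> sobolev n p Q \<theta> \<and> Lp Q q\<^sub>3 \<gamma> \<and> sobolev n p Q \<gamma> \<and>
     (AE y\<in>Q in lebesgue. \<gamma> y \<in> M) \<and> div_free Q \<theta>"

text \<open>A sequence of competitors along \<open>e\<^sub>j \<down> 0\<close> is extended to all \<open>\<epsilon> > 0\<close> by using at \<open>\<epsilon>\<close>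
  the competitor of the first \<open>e\<^sub>j \<le> \<epsilon>\<close>.\<close>

lemma cell_functional_le:
  fixes F :: "('N::finite, 'k::finite, 'd::finite, 'm::finite) density" and B :: "(real^'N) set"
  defines "Q \<equiv> unit_cube B"
  assumes approx: "\<And>\<eta>. \<eta> > 0 \<Longrightarrow> \<exists>e u \<theta> \<gamma>. 0 < e \<and> e < \<eta> \<and> admissible n p q\<^sub>1 q\<^sub>2 q\<^sub>3 M Q u \<theta> \<gamma> \<and>
      (\<integral>\<^sup>+ y\<in>Q. ennreal (norm (weak_grad Q u y - (if y \<bullet> \<nu> > 0 then Vp else Vm)) powr q\<^sub>1) \<partial>lebesgue) < ennreal \<eta> \<and>
      (\<integral>\<^sup>+ y\<in>Q. ennreal (norm (\<theta> y - (if y \<bullet> \<nu> > 0 then mp else mm)) powr q\<^sub>2) \<partial>lebesgue) < ennreal \<eta> \<and>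
      (\<integral>\<^sup>+ y\<in>Q. ennreal (norm (\<gamma> y - (if y \<bullet> \<nu> > 0 then \<phi>p else \<phi>m)) powr q\<^sub>3) \<partial>lebesgue) < ennreal \<eta> \<and>
      (\<integral>\<^sup>+ y\<in>Q. ennreal (1 / e * F (scaled_jet n e Q u \<theta> \<gamma> y) (weak_grad Q u y, \<theta> y, \<gamma> y) x) \<partial>lebesgue) \<le> C"
  shows "cell_functional n p q\<^sub>1 q\<^sub>2 q\<^sub>3 M F B Vp mp \<phi>p Vm mm \<phi>m \<nu> x \<le> C"
proof -
  define d1 where "d1 u = (\<integral>\<^sup>+ y\<in>Q. ennreal (norm (weak_grad Q u y - (if y \<bullet> \<nu> > 0 then Vp else Vm)) powr q\<^sub>1) \<partial>lebesgue)" for u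
  define d2 where "d2 \<theta> = (\<integral>\<^sup>+ y\<in>Q. ennreal (norm (\<theta> y - (if y \<bullet> \<nu> > 0 then mp else mm)) powr q\<^sub>2) \<partial>lebesgue)" for \<theta>
  define d3 where "d3 \<gamma> = (\<integral>\<^sup>+ y\<in>Q. ennreal (norm (\<gamma> y - (if y \<bullet> \<nu> > 0 then \<phi>p else \<phi>m)) powr q\<^sub>3) \<partial>lebesgue)" for \<gamma>
  define E where "E e u \<theta> \<gamma> = (\<integral>\<^sup>+ y\<in>Q. ennreal (1 / e * F (scaled_jet n e Q u \<theta> \<gamma> y) (weak_grad Q u y, \<theta> y, \<gamma> y) x) \<partial>lebesgue)" for e u \<theta> \<gamma>
  define P where "P \<eta> = (\<lambda>(e, u, \<theta>, \<gamma>). 0 < e \<and> e < \<eta> \<and> admissible n p q\<^sub>1 q\<^sub>2 q\<^sub>3 M Q u \<theta> \<gamma> \<and>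
      d1 u < ennreal \<eta> \<and> d2 \<theta> < ennreal \<eta> \<and> d3 \<gamma> < ennreal \<eta> \<and> E e u \<theta> \<gamma> \<le> C)" for \<eta>
  have ex: "\<exists>w. P \<eta> w" if "\<eta> > 0" for \<eta>
    using approx[OF that] unfolding P_def d1_def d2_def d3_def E_def by auto
  have Pmono: "P \<eta>' w" if "P \<eta> w" "\<eta> \<le> \<eta>'" for \<eta> \<eta>' w
    using that unfolding P_def by (auto split: prod.splits intro: less_le_trans ennreal_leI)
  define h where "h j = 1 / (real j + 1)" for j :: nat
  have h: "h j > 0" for j by (simp add: h_def)
  have "\<exists>w. \<forall>j. P (h j) (w j) \<and> fst (w (Suc j)) < fst (w j)"
  proof (rule dependent_nat_choice)
    show "\<exists>w. P (h 0) w" using ex h by blast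
    fix w j assume w: "P (h j) w"
    then have "fst w > 0" by (auto simp: P_def)
    \<comment> \<open>The minimum with the previous parameter makes the parameters strictly
      decreasing, so that the index chosen at \<open>\<epsilon> = e j\<close> is \<open>j\<close>
      itself.\<close>
    then obtain w' where w': "P (min (h (Suc j)) (fst w)) w'" using ex[of "min (h (Suc j)) (fst w)"] h by auto
    then have "fst w' < fst w" by (auto simp: P_def)
    moreover have "P (h (Suc j)) w'" by (rule Pmono[OF w']) simp
    ultimately show "\<exists>w'. P (h (Suc j)) w' \<and> fst w' < fst w" by blast
  qed
  then obtain w where w: "\<And>j. P (h j) (w j)" "\<And>j. fst (w (Suc j)) < fst (w j)" by blast
  define e where "e j = fst (w j)" for j
  define u where "u j = fst (snd (w j))" for j
  define \<theta> where "\<theta> j = fst (snd (snd (w j)))" for j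
  define \<gamma> where "\<gamma> j = snd (snd (snd (w j)))" for j
  have e: "0 < e j" "e j < h j" and adm: "admissible n p q\<^sub>1 q\<^sub>2 q\<^sub>3 M Q (u j) (\<theta> j) (\<gamma> j)"
    and d: "d1 (u j) < ennreal (h j)" "d2 (\<theta> j) < ennreal (h j)" "d3 (\<gamma> j) < ennreal (h j)"
    and E: "E (e j) (u j) (\<theta> j) (\<gamma> j) \<le> C" for j
    using w(1)[of j] by (auto simp: P_def e_def u_def \<theta>_def \<gamma>_def case_prod_unfold)
  have dec: "e j \<le> e i \<longleftrightarrow> i \<le> j" for i j
  proof -
    have "strict_mono (\<lambda>j. - e j)" using w(2) by (intro strict_monoI_Suc) (simp add: e_def)
    from strict_mono_less_eq[OF this, of i j] show ?thesis by simp
  qed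
  have small: "\<exists>j. e j < b" if "b > 0" for b
  proof -
    obtain j :: nat where "1 / b < real j" using reals_Archimedean2 by blast
    then have "h j < b" using that by (simp add: h_def field_simps)
    then show ?thesis using e(2)[of j] by (intro exI[of _ j]) simp
  qed
  define J where "J \<epsilon> = (LEAST j. e j \<le> \<epsilon>)" for \<epsilon>
  have J: "e (J \<epsilon>) \<le> \<epsilon>" if "\<epsilon> > 0" for \<epsilon>
  proof -
    obtain j where "e j < \<epsilon>" using small[OF \<open>\<epsilon> > 0\<close>] by blast
    then have "e j \<le> \<epsilon>" by simp
    then show ?thesis unfolding J_def by (rule LeastI)
  qed
  have Je: "J (e j) = j" for j
    unfolding J_def dec by (intro Least_equality) auto
  have lim: "((\<lambda>\<epsilon>. g (J \<epsilon>)) \<longlongrightarrow> 0) (at_right 0)" if g: "\<And>j. g j < ennreal (h j)" for g :: "nat \<Rightarrow> ennreal"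
  proof (rule order_tendstoI)
    fix a :: ennreal assume "0 < a"
    then obtain a' where a': "0 < a'" "ennreal a' \<le> a"
    proof (cases a rule: ennreal_cases)
      case (real r)
      with \<open>0 < a\<close> show ?thesis by (intro that[of r]) (auto simp: ennreal_less_zero_iff)
    qed (use that[of 1] in auto)
    obtain K :: nat where "1 / a' < real K" using reals_Archimedean2 by blast
    then have K: "h K < a'" using a' by (simp add: h_def field_simps)
    have "\<forall>\<^sub>F \<epsilon> in at_right 0. 0 < \<epsilon> \<and> \<epsilon> < e K"
      using e(1)[of K] by (auto simp: eventually_at_right_field)
    then show "\<forall>\<^sub>F \<epsilon> in at_right 0. g (J \<epsilon>) < a"
    proof eventually_elim
      case (elim \<epsilon>)
      then have "e (J \<epsilon>) \<le> e K" using J[of \<epsilon>] by simp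
      then have "h (J \<epsilon>) \<le> h K" unfolding dec by (simp add: h_def field_simps)
      have "g (J \<epsilon>) < ennreal (h (J \<epsilon>))" by (rule g)
      also have "\<dots> \<le> ennreal a'" using K \<open>h (J \<epsilon>) \<le> h K\<close> by (intro ennreal_leI) simp
      finally show ?case using a'(2) by simp
    qed
  qed simp
  have "cell_functional n p q\<^sub>1 q\<^sub>2 q\<^sub>3 M F B Vp mp \<phi>p Vm mm \<phi>m \<nu> x
      \<le> Liminf (at_right 0) (\<lambda>\<epsilon>. E \<epsilon> (u (J \<epsilon>)) (\<theta> (J \<epsilon>)) (\<gamma> (J \<epsilon>)))"
    unfolding cell_functional_def Let_def Q_def[symmetric] E_def
  proof (rule Inf_lower, rule CollectI, rule exI[of _ "\<lambda>\<epsilon>. u (J \<epsilon>)"], rule exI[of _ "\<lambda>\<epsilon>. \<theta> (J \<epsilon>)"],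
      rule exI[of _ "\<lambda>\<epsilon>. \<gamma> (J \<epsilon>)"], intro conjI)
    show "Lp_tendsto Q q\<^sub>1 (\<lambda>\<epsilon>. weak_grad Q (u (J \<epsilon>))) (\<lambda>y. if 0 < y \<bullet> \<nu> then Vp else Vm)"
      unfolding Lp_tendsto_def using lim[of "\<lambda>j. d1 (u j)", OF d(1)] by (simp only: d1_def)
    show "Lp_tendsto Q q\<^sub>2 (\<lambda>\<epsilon>. \<theta> (J \<epsilon>)) (\<lambda>y. if 0 < y \<bullet> \<nu> then mp else mm)"
      unfolding Lp_tendsto_def using lim[of "\<lambda>j. d2 (\<theta> j)", OF d(2)] by (simp only: d2_def)
    show "Lp_tendsto Q q\<^sub>3 (\<lambda>\<epsilon>. \<gamma> (J \<epsilon>)) (\<lambda>y. if 0 < y \<bullet> \<nu> then \<phi>p else \<phi>m)"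
      unfolding Lp_tendsto_def using lim[of "\<lambda>j. d3 (\<gamma> j)", OF d(3)] by (simp only: d3_def)
  qed (use adm in \<open>auto simp: admissible_def\<close>)
  also have "\<dots> \<le> C"
  proof (rule ccontr)
    assume "\<not> ?thesis"
    then have "\<forall>\<^sub>F \<epsilon> in at_right 0. C < E \<epsilon> (u (J \<epsilon>)) (\<theta> (J \<epsilon>)) (\<gamma> (J \<epsilon>))"
      unfolding not_le by (rule less_LiminfD)
    then obtain b where b: "b > 0" "\<And>\<epsilon>. 0 < \<epsilon> \<Longrightarrow> \<epsilon> < b \<Longrightarrow> C < E \<epsilon> (u (J \<epsilon>)) (\<theta> (J \<epsilon>)) (\<gamma> (J \<epsilon>))"
      by (auto simp: eventually_at_right_field)
    \<comment> \<open>The energy of the extended family is controlled only where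
      \<open>\<epsilon>\<close> is one of the \<open>e j\<close>; these accumulate at 0, which
      suffices for a lower limit.\<close>
    obtain j where "e j < b" using small[OF b(1)] by blast
    then show False using b(2)[of "e j"] e(1)[of j] E[of j] by (simp add: Je)
  qed
  finally show ?thesis .
qed

section \<open>Blow-up\<close>

lemma add_powr_le:
  fixes a b q :: real
  assumes "0 \<le> a" "0 \<le> b" "0 \<le> q"
  shows "(a + b) powr q \<le> 2 powr q * (a powr q + b powr q)"
proof -
  have "(a + b) powr q \<le> (2 * max a b) powr q"
    using assms by (intro powr_mono2) auto
  also have "\<dots> = 2 powr q * max a b powr q"
    using assms by (intro powr_mult)
  also have "\<dots> \<le> 2 powr q * (a powr q + b powr q)"
    by (intro mult_left_mono) (auto simp: max_def)
  finally show ?thesis .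
qed

lemma open_unit_cube:
  assumes "orthonormal_basis B"
  shows "open (unit_cube B)"
proof -
  have "unit_cube B = (\<Inter>b\<in>B. {y. \<bar>y \<bullet> b\<bar> < 1 / 2})" by (auto simp: unit_cube_def)
  also have "open \<dots>"
    using orthonormal_basisD(1)[OF assms]
    by (intro open_INT ballI open_Collect_less continuous_intros)
  finally show ?thesis .
qed

lemma bounded_unit_cube:
  fixes B :: "'a::euclidean_space set"
  assumes B: "orthonormal_basis B"
  shows "bounded (unit_cube B)"
proof (rule boundedI)
  fix y assume y: "y \<in> unit_cube B"
  have "norm y \<le> (\<Sum>b\<in>B. \<bar>y \<bullet> b\<bar>)" by (rule norm_le_sum_orthonormal[OF B])
  also have "\<dots> \<le> (\<Sum>b\<in>B. 1 / 2)" using y by (intro sum_mono) (auto simp: unit_cube_def less_imp_le)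
  finally show "norm y \<le> (\<Sum>b\<in>B. 1 / 2)" .
qed

lemma half_ball_sets: "half_ball x \<rho> \<nu> \<in> sets lebesgue"
proof -
  have "open (ball x \<rho> \<inter> {y. 0 < (y - x) \<bullet> \<nu>})"
    by (intro open_Int open_ball open_Collect_less continuous_intros)
  also have "ball x \<rho> \<inter> {y. 0 < (y - x) \<bullet> \<nu>} = half_ball x \<rho> \<nu>"
    by (auto simp: half_ball_def)
  finally show ?thesis by simp
qed

text \<open>The error is split into the distance of \<open>f\<close> from \<open>g\<close> and the
  distance of \<open>g\<close> from its one-sided values. Since \<open>c\<close> lies on the
  hyperplane through \<open>x0\<close>, the sign of \<open>y \<bullet> \<nu>\<close> decides in
  which half ball \<open>c + s *\<^sub>R y\<close> lies, off the null set
  \<open>y \<bullet> \<nu> = 0\<close>. The constant combines \<open>2 powr q\<close>, from the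
  inequality for a power of a sum, with the inverse Jacobian.\<close>

lemma Lp_distance_blow_up:
  fixes f g :: "'a::euclidean_space \<Rightarrow> 'b::euclidean_space"
  assumes s: "s > 0" and q: "q \<ge> 0" and \<nu>: "\<nu> \<noteq> 0" and c: "(c - x0) \<bullet> \<nu> = 0"
    and Q: "Q \<in> sets lebesgue" and TQ: "(\<lambda>y. c + s *\<^sub>R y) ` Q \<subseteq> ball x0 \<rho>" and U: "cball x0 \<rho> \<subseteq> U"
    and f: "(\<lambda>x. indicator U x *\<^sub>R f x) \<in> borel_measurable lebesgue"
    and g: "(\<lambda>x. indicator U x *\<^sub>R g x) \<in> borel_measurable lebesgue"
  shows "(\<integral>\<^sup>+ y\<in>Q. ennreal (norm (f (c + s *\<^sub>R y) - (if y \<bullet> \<nu> > 0 then ap else am)) powr q) \<partial>lebesgue)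
    \<le> ennreal (2 powr q / s ^ DIM('a)) *
      ((\<integral>\<^sup>+ x\<in>cball x0 \<rho>. ennreal (norm (f x - g x) powr q) \<partial>lebesgue) +
       (\<integral>\<^sup>+ x\<in>half_ball x0 \<rho> \<nu>. ennreal (norm (g x - ap) powr q) \<partial>lebesgue) +
       (\<integral>\<^sup>+ x\<in>half_ball x0 \<rho> (- \<nu>). ennreal (norm (g x - am) powr q) \<partial>lebesgue))"
proof -
  let ?f = "\<lambda>x. indicator U x *\<^sub>R f x" and ?g = "\<lambda>x. indicator U x *\<^sub>R g x"
  let ?T = "\<lambda>y. c + s *\<^sub>R y"
  note [measurable] = f g half_ball_sets
  have [measurable]: "cball x0 \<rho> \<in> sets lebesgue" by simp
  define h1 where "h1 x = ennreal (norm (?f x - ?g x) powr q) * indicator (cball x0 \<rho>) x" for x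
  define h2 where "h2 x = ennreal (norm (?g x - ap) powr q) * indicator (half_ball x0 \<rho> \<nu>) x" for x
  define h3 where "h3 x = ennreal (norm (?g x - am) powr q) * indicator (half_ball x0 \<rho> (- \<nu>)) x" for x
  have m1 [measurable]: "h1 \<in> borel_measurable lebesgue" unfolding h1_def by measurable
  have m2 [measurable]: "h2 \<in> borel_measurable lebesgue" unfolding h2_def by measurable
  have m3 [measurable]: "h3 \<in> borel_measurable lebesgue" unfolding h3_def by measurable
  have sub: "half_ball x0 \<rho> \<mu> \<subseteq> cball x0 \<rho>" for \<mu> by (auto simp: half_ball_def)
  define G where "G x = ennreal (2 powr q) * (h1 x + h2 x + h3 x)" for x
  have mG: "G \<in> borel_measurable lebesgue" unfolding G_def by measurable
  have "AE y in lebesgue. y \<notin> {y. \<nu> \<bullet> y = 0}"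
    using negligible_hyperplane[of \<nu> 0] \<nu> by (intro AE_not_in) (auto simp: negligible_iff_null_sets)
  then have "AE y in lebesgue. ennreal (norm (f (?T y) - (if y \<bullet> \<nu> > 0 then ap else am)) powr q) * indicator Q y \<le> G (?T y)"
  proof (rule eventually_mono)
    fix y assume "y \<notin> {y. \<nu> \<bullet> y = 0}"
    then have ne: "y \<bullet> \<nu> \<noteq> 0" by (simp add: inner_commute)
    show "ennreal (norm (f (?T y) - (if y \<bullet> \<nu> > 0 then ap else am)) powr q) * indicator Q y \<le> G (?T y)"
    proof (cases "y \<in> Q")
      case True
      then have b: "?T y \<in> ball x0 \<rho>" using TQ by blast
      then have U': "?T y \<in> U" "?T y \<in> cball x0 \<rho>" using U by (auto simp: less_imp_le)
      have dir: "(?T y - x0) \<bullet> \<nu> = s * (y \<bullet> \<nu>)"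
        using c by (simp add: inner_diff_left inner_add_left)
      define a where "a = (if y \<bullet> \<nu> > 0 then ap else am)"
      have "norm (f (?T y) - a) powr q \<le> (norm (f (?T y) - g (?T y)) + norm (g (?T y) - a)) powr q"
        using q norm_triangle_ineq[of "f (?T y) - g (?T y)" "g (?T y) - a"] by (intro powr_mono2) auto
      also have "\<dots> \<le> 2 powr q * (norm (f (?T y) - g (?T y)) powr q + norm (g (?T y) - a) powr q)"
        using q by (intro add_powr_le) auto
      finally have "ennreal (norm (f (?T y) - a) powr q)
        \<le> ennreal (2 powr q) * (ennreal (norm (f (?T y) - g (?T y)) powr q) + ennreal (norm (g (?T y) - a) powr q))"
        by (simp flip: ennreal_plus ennreal_mult add: ennreal_leI)
      also have "\<dots> \<le> G (?T y)"
        unfolding G_def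
      proof (rule mult_left_mono)
        have 1: "ennreal (norm (f (?T y) - g (?T y)) powr q) = h1 (?T y)"
          using U' by (simp add: h1_def)
        have 2: "ennreal (norm (g (?T y) - a) powr q) \<le> h2 (?T y) + h3 (?T y)"
        proof (cases "y \<bullet> \<nu> > 0")
          case True
          then have "?T y \<in> half_ball x0 \<rho> \<nu>" using b dir s by (simp add: half_ball_def)
          then show ?thesis using True U' by (simp add: a_def h2_def)
        next
          case False
          then have "?T y \<in> half_ball x0 \<rho> (- \<nu>)" using b dir s ne by (simp add: half_ball_def mult_pos_neg)
          then show ?thesis using False U' by (simp add: a_def h3_def)
        qed
        show "ennreal (norm (f (?T y) - g (?T y)) powr q) + ennreal (norm (g (?T y) - a) powr q)
            \<le> h1 (?T y) + h2 (?T y) + h3 (?T y)"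
          unfolding 1 add.assoc by (intro add_left_mono 2)
      qed simp
      finally show ?thesis using True by (simp add: a_def)
    qed simp
  qed
  then have "(\<integral>\<^sup>+ y\<in>Q. ennreal (norm (f (?T y) - (if y \<bullet> \<nu> > 0 then ap else am)) powr q) \<partial>lebesgue)
      \<le> (\<integral>\<^sup>+ y. G (?T y) \<partial>lebesgue)"
    by (rule nn_integral_mono_AE)
  also have "\<dots> = ennreal (1 / s ^ DIM('a)) * (\<integral>\<^sup>+ x. G x \<partial>lebesgue)"
    unfolding nn_integral_affine_lebesgue[OF less_imp_neq[OF s, symmetric] mG, of c]
    using s by (simp add: mult.assoc[symmetric] flip: ennreal_mult)
  also have "(\<integral>\<^sup>+ x. G x \<partial>lebesgue) = ennreal (2 powr q) * (integral\<^sup>N lebesgue h1 + integral\<^sup>N lebesgue h2 + integral\<^sup>N lebesgue h3)"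
    unfolding G_def by (simp add: nn_integral_cmult nn_integral_add)
  also have "integral\<^sup>N lebesgue h1 = (\<integral>\<^sup>+ x\<in>cball x0 \<rho>. ennreal (norm (f x - g x) powr q) \<partial>lebesgue)"
    unfolding h1_def using U by (intro nn_integral_cong) (auto split: split_indicator)
  also have "integral\<^sup>N lebesgue h2 = (\<integral>\<^sup>+ x\<in>half_ball x0 \<rho> \<nu>. ennreal (norm (g x - ap) powr q) \<partial>lebesgue)"
    unfolding h2_def using U sub[of \<nu>] by (intro nn_integral_cong) (auto split: split_indicator)
  also have "integral\<^sup>N lebesgue h3 = (\<integral>\<^sup>+ x\<in>half_ball x0 \<rho> (- \<nu>). ennreal (norm (g x - am) powr q) \<partial>lebesgue)"
    unfolding h3_def using U sub[of "- \<nu>"] by (intro nn_integral_cong) (auto split: split_indicator)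
  finally show ?thesis
    using s by (simp add: mult.assoc[symmetric] mult.commute flip: ennreal_mult)
qed

text \<open>As \<open>\<delta>\<close> does not vary with \<open>\<rho>\<close>, a cube of side
  \<open>\<rho> * \<delta>\<close> occupies a fixed fraction of the volume of the ball of radius
  \<open>\<rho>\<close>; smallness relative to the ball is smallness relative to the cube.\<close>

lemma emeasure_ball_ratio_tendsto:
  fixes A :: "real \<Rightarrow> ennreal" and x0 :: "'a::euclidean_space"
  assumes lim: "((\<lambda>\<rho>. A \<rho> / emeasure lebesgue (ball x0 \<rho>)) \<longlongrightarrow> 0) (at_right 0)" and \<delta>: "\<delta> > 0"
  shows "((\<lambda>\<rho>. ennreal (K / (\<rho> * \<delta>) ^ DIM('a)) * A \<rho>) \<longlongrightarrow> 0) (at_right 0)"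
proof -
  define w where "w = unit_ball_vol (real DIM('a))"
  have w: "w > 0" by (simp add: w_def)
  have "((\<lambda>\<rho>. ennreal (K * w / \<delta> ^ DIM('a)) * (A \<rho> / emeasure lebesgue (ball x0 \<rho>))) \<longlongrightarrow> ennreal (K * w / \<delta> ^ DIM('a)) * 0) (at_right 0)"
    using lim by (intro tendsto_mult_ennreal tendsto_const) auto
  then have "((\<lambda>\<rho>. ennreal (K * w / \<delta> ^ DIM('a)) * (A \<rho> / emeasure lebesgue (ball x0 \<rho>))) \<longlongrightarrow> 0) (at_right 0)" by simp
  then show ?thesis
  proof (rule Lim_transform_eventually)
    show "\<forall>\<^sub>F \<rho> in at_right 0. ennreal (K * w / \<delta> ^ DIM('a)) * (A \<rho> / emeasure lebesgue (ball x0 \<rho>)) =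
        ennreal (K / (\<rho> * \<delta>) ^ DIM('a)) * A \<rho>"
      using eventually_at_right_less[of "0::real"]
    proof eventually_elim
      case (elim \<rho>)
      have "emeasure lebesgue (ball x0 \<rho>) = ennreal (w * \<rho> ^ DIM('a))"
        using elim by (simp add: emeasure_ball w_def)
      then have "A \<rho> / emeasure lebesgue (ball x0 \<rho>) = A \<rho> * ennreal (1 / (w * \<rho> ^ DIM('a)))"
        using elim w by (simp add: divide_ennreal_def inverse_ennreal inverse_eq_divide)
      then have "ennreal (K * w / \<delta> ^ DIM('a)) * (A \<rho> / emeasure lebesgue (ball x0 \<rho>)) =
         (ennreal (K * w / \<delta> ^ DIM('a)) * ennreal (1 / (w * \<rho> ^ DIM('a)))) * A \<rho>"
        by (simp add: mult_ac)
      also have "ennreal (K * w / \<delta> ^ DIM('a)) * ennreal (1 / (w * \<rho> ^ DIM('a))) = ennreal (K / (\<rho> * \<delta>) ^ DIM('a))"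
        using elim w \<delta> by (subst ennreal_mult''[symmetric]) (auto simp: field_simps power_mult_distrib)
      finally show ?case .
    qed
  qed
qed

lemma eventually_not_eventuallyE:
  assumes "eventually P F" "\<not> eventually Q F"
  obtains x where "P x" "\<not> Q x"
  using assms eventually_mono by blast

lemma ennreal_dense_real:
  assumes "0 < t" "ennreal t < x"
  obtains t' where "t < t'" "ennreal t' < x"
proof -
  obtain z where z: "ennreal t < z" "z < x"
    using dense[OF assms(2)] by blast
  show ?thesis
  proof (cases z rule: ennreal_cases)
    case (real r)
    then show ?thesis using z assms(1) that[of r] by (auto simp: ennreal_less_iff)
  qed (use z in auto)
qed

lemma Lp_loc_tendstoD:
  assumes "Lp_loc_tendsto U q f g" "compact K" "K \<subseteq> U" "0 < e"
  shows "\<forall>\<^sub>F \<epsilon> in at_right 0. (\<integral>\<^sup>+ x\<in>K. ennreal (norm (f \<epsilon> x - g x) powr q) \<partial>lebesgue) < e"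
proof -
  have "((\<lambda>\<epsilon>. \<integral>\<^sup>+ x\<in>K. ennreal (norm (f \<epsilon> x - g x) powr q) \<partial>lebesgue) \<longlongrightarrow> 0) (at_right 0)"
    using assms(1-3) by (simp add: Lp_loc_tendsto_def Lp_tendsto_def)
  then show ?thesis using assms(4) by (rule order_tendstoD(2))
qed

text \<open>\<open>\<eta>\<close> is shared equally between the two errors: \<open>fg\<close> will
  hold for small \<epsilon> at fixed \<open>\<rho>\<close>, and \<open>A\<close> for small
  \<open>\<rho>\<close>. With \<open>K\<close>, \<open>Ap\<close> and \<open>Am\<close> instead of
  exact values, one bound can serve all three exponents.\<close>

lemma Lp_distance_blow_up_less:
  fixes f g :: "'a::euclidean_space \<Rightarrow> 'b::euclidean_space"
  assumes s: "s > 0" and q: "q \<ge> 0" and \<nu>: "\<nu> \<noteq> 0" and c: "(c - x0) \<bullet> \<nu> = 0"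
    and Q: "Q \<in> sets lebesgue" and TQ: "(\<lambda>y. c + s *\<^sub>R y) ` Q \<subseteq> ball x0 \<rho>" and U: "cball x0 \<rho> \<subseteq> U"
    and f: "(\<lambda>x. indicator U x *\<^sub>R f x) \<in> borel_measurable lebesgue"
    and g: "(\<lambda>x. indicator U x *\<^sub>R g x) \<in> borel_measurable lebesgue"
    and K: "2 powr q \<le> K" and \<eta>: "\<eta> > 0"
    and fg: "(\<integral>\<^sup>+ x\<in>cball x0 \<rho>. ennreal (norm (f x - g x) powr q) \<partial>lebesgue) < ennreal (\<eta> / 2 * s ^ DIM('a) / K)"
    and Ap: "(\<integral>\<^sup>+ x\<in>half_ball x0 \<rho> \<nu>. ennreal (norm (g x - ap) powr q) \<partial>lebesgue) \<le> Ap"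
    and Am: "(\<integral>\<^sup>+ x\<in>half_ball x0 \<rho> (- \<nu>). ennreal (norm (g x - am) powr q) \<partial>lebesgue) \<le> Am"
    and A: "ennreal (K / s ^ DIM('a)) * (Ap + Am) < ennreal (\<eta> / 2)"
  shows "(\<integral>\<^sup>+ y\<in>Q. ennreal (norm (f (c + s *\<^sub>R y) - (if y \<bullet> \<nu> > 0 then ap else am)) powr q) \<partial>lebesgue) < ennreal \<eta>"
proof -
  have K0: "K > 0" using K by (rule less_le_trans[rotated]) simp
  have "(\<integral>\<^sup>+ y\<in>Q. ennreal (norm (f (c + s *\<^sub>R y) - (if y \<bullet> \<nu> > 0 then ap else am)) powr q) \<partial>lebesgue)
    \<le> ennreal (2 powr q / s ^ DIM('a)) *
      ((\<integral>\<^sup>+ x\<in>cball x0 \<rho>. ennreal (norm (f x - g x) powr q) \<partial>lebesgue) +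
       (\<integral>\<^sup>+ x\<in>half_ball x0 \<rho> \<nu>. ennreal (norm (g x - ap) powr q) \<partial>lebesgue) +
       (\<integral>\<^sup>+ x\<in>half_ball x0 \<rho> (- \<nu>). ennreal (norm (g x - am) powr q) \<partial>lebesgue))"
    by (rule Lp_distance_blow_up[OF s q \<nu> c Q TQ U f g])
  also have "\<dots> \<le> ennreal (K / s ^ DIM('a)) * (ennreal (\<eta> / 2 * s ^ DIM('a) / K) + Ap + Am)"
    using K s fg Ap Am by (intro mult_mono add_mono ennreal_leI divide_right_mono) (auto intro: less_imp_le)
  also have "\<dots> = ennreal (\<eta> / 2) + ennreal (K / s ^ DIM('a)) * (Ap + Am)"
  proof -
    have "ennreal (K / s ^ DIM('a)) * ennreal (\<eta> / 2 * s ^ DIM('a) / K) = ennreal (\<eta> / 2)"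
      using K0 s \<eta> by (subst ennreal_mult[symmetric]) auto
    then show ?thesis by (simp add: distrib_left add.assoc)
  qed
  also have "\<dots> < ennreal (\<eta> / 2) + ennreal (\<eta> / 2)"
    using A by (simp add: ennreal_add_left_cancel_less)
  also have "\<dots> = ennreal \<eta>" using \<eta> by (simp flip: ennreal_plus)
  finally show ?thesis .
qed

section \<open>Rescaling of the energy and densities on balls\<close>

lemma open_affine_image:
  fixes Q :: "'a::euclidean_space set"
  assumes "s \<noteq> 0" "open Q"
  shows "open ((\<lambda>y. c + s *\<^sub>R y) ` Q)"
proof -
  have "(\<lambda>y. c + s *\<^sub>R y) ` Q = (\<lambda>x. c + x) ` ((\<lambda>y. s *\<^sub>R y) ` Q)"
    unfolding image_image ..
  then show ?thesis using open_translation[OF open_scaling[OF assms]] by simp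
qed

text \<open>The Jacobian gives \<open>s ^ N\<close>, and \<open>1 / \<epsilon>\<close> is
  \<open>1 / s\<close> times the rescaled prefactor \<open>1 / (\<epsilon> / s)\<close>; together
  they leave \<open>s ^ (N - 1)\<close>. The factor \<open>\<kappa>\<close> is the price for
  evaluating the density at \<open>x0\<close> instead of at the moving point.\<close>

lemma energy_blow_up:
  fixes F :: "('N::finite, 'k::finite, 'd::finite, 'm::finite) density"
    and v :: "real^'N \<Rightarrow> real^'k" and m :: "real^'N \<Rightarrow> real^'N^'d" and \<psi> :: "real^'N \<Rightarrow> real^'m"
  assumes s: "s > 0" and \<epsilon>: "\<epsilon> > 0" and Q: "open Q" and U: "open U" and TQ: "(\<lambda>y. c + s *\<^sub>R y) ` Q \<subseteq> U"
    and F: "continuous_on (jets n \<times> UNIV \<times> UNIV) (\<lambda>(a, b, x). F a b x)"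
    and v: "sobolev_loc 1 q\<^sub>1 U v" "sobolev_loc (n + 1) p U v"
    and m: "Lp_loc U q\<^sub>2 m" "sobolev_loc n p U m" and \<psi>: "Lp_loc U q\<^sub>3 \<psi>" "sobolev_loc n p U \<psi>"
    and \<kappa>: "\<kappa> > 0"
    and near: "\<And>a b y. a \<in> jets n \<Longrightarrow> y \<in> Q \<Longrightarrow> \<kappa> * F a b x0 \<le> F a b (c + s *\<^sub>R y)"
  shows "ennreal (\<kappa> * s ^ (CARD('N) - 1)) *
      (\<integral>\<^sup>+ y\<in>Q. ennreal (1 / (\<epsilon> / s) * F (scaled_jet n (\<epsilon> / s) Q (\<lambda>y. (1 / s) *\<^sub>R v (c + s *\<^sub>R y)) (\<lambda>y. m (c + s *\<^sub>R y)) (\<lambda>y. \<psi> (c + s *\<^sub>R y)) y)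
        (weak_grad Q (\<lambda>y. (1 / s) *\<^sub>R v (c + s *\<^sub>R y)) y, m (c + s *\<^sub>R y), \<psi> (c + s *\<^sub>R y)) x0) \<partial>lebesgue)
    \<le> (\<integral>\<^sup>+ x\<in>(\<lambda>y. c + s *\<^sub>R y) ` Q. ennreal (1 / \<epsilon> * F (scaled_jet n \<epsilon> U v m \<psi> x) (weak_grad U v x, m x, \<psi> x) x) \<partial>lebesgue)"
    (is "_ * ?I \<le> _")
proof -
  let ?T = "\<lambda>y. c + s *\<^sub>R y"
  define G where "G x = 1 / \<epsilon> * F (scaled_jet n \<epsilon> U v m \<psi> x) (weak_grad U v x, m x, \<psi> x) x" for x
  have mG [measurable]: "(\<lambda>x. indicator U x * ennreal (G x)) \<in> borel_measurable lebesgue"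
    unfolding G_def by (rule energy_density_borel_measurable[OF U F v m \<psi>])
  have s0: "s \<noteq> 0" using s by simp
  have inj: "?T y \<in> ?T ` Q \<longleftrightarrow> y \<in> Q" for y using s by auto
  have "open (?T ` Q)" by (rule open_affine_image[OF s0 Q])
  then have [measurable]: "?T ` Q \<in> sets lebesgue" by simp
  have ind: "ennreal (G x) * indicator (?T ` Q) x = (indicator U x * ennreal (G x)) * indicator (?T ` Q) x" for x
    using TQ by (auto split: split_indicator)
  have mGT: "(\<lambda>x. ennreal (G x) * indicator (?T ` Q) x) \<in> borel_measurable lebesgue"
    unfolding ind by measurable
  let ?j = "\<lambda>y. scaled_jet n (\<epsilon> / s) Q (\<lambda>y. (1 / s) *\<^sub>R v (?T y)) (\<lambda>y. m (?T y)) (\<lambda>y. \<psi> (?T y)) y"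
  let ?g = "\<lambda>y. weak_grad Q (\<lambda>y. (1 / s) *\<^sub>R v (?T y)) y"
  let ?L = "\<lambda>y. ennreal (1 / (\<epsilon> / s) * F (?j y) (?g y, m (?T y), \<psi> (?T y)) x0) * indicator Q y"
  let ?R = "\<lambda>y. ennreal (s / \<kappa>) * (ennreal (G (?T y)) * indicator (?T ` Q) (?T y))"
  have "?I \<le> (\<integral>\<^sup>+ y. ?R y \<partial>lebesgue)"
  proof (rule nn_integral_mono_AE)
    show "AE y in lebesgue. ?L y \<le> ?R y"
      using AE_scaled_jet_affine[OF s Q TQ v m(2) \<psi>(2), of \<epsilon>]
    proof (rule eventually_mono)
      fix y
      assume *: "y \<in> Q \<longrightarrow> ?j y = scaled_jet n \<epsilon> U v m \<psi> (?T y) \<and> ?g y = weak_grad U v (?T y)"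
      show "?L y \<le> ?R y"
      proof (cases "y \<in> Q")
        case True
        let ?F = "F (scaled_jet n \<epsilon> U v m \<psi> (?T y)) (weak_grad U v (?T y), m (?T y), \<psi> (?T y))"
        have "\<kappa> * ?F x0 \<le> ?F (?T y)" by (rule near[OF scaled_jet_in_jets True])
        then have "1 / (\<epsilon> / s) * ?F x0 \<le> s / \<kappa> * G (?T y)"
          using s \<epsilon> \<kappa> by (simp add: G_def field_simps)
        then have "ennreal (1 / (\<epsilon> / s) * ?F x0) \<le> ennreal (s / \<kappa>) * ennreal (G (?T y))"
          using s \<kappa> by (simp add: ennreal_mult'[symmetric] ennreal_leI)
        then show ?thesis using True * inj[of y] by simp
      qed simp
    qed
  qed
  also have "\<dots> = ennreal (s / \<kappa>) * (\<integral>\<^sup>+ y. ennreal (G (?T y)) * indicator (?T ` Q) (?T y) \<partial>lebesgue)"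
    by (intro nn_integral_cmult measurable_compose[OF affine_lebesgue(1)[OF s0] mGT])
  finally have "ennreal (\<kappa> * s ^ (CARD('N) - 1)) * ?I \<le> ennreal (\<kappa> * s ^ (CARD('N) - 1)) *
      (ennreal (s / \<kappa>) * (\<integral>\<^sup>+ y. ennreal (G (?T y)) * indicator (?T ` Q) (?T y) \<partial>lebesgue))"
    by (rule mult_left_mono) simp
  also have "\<dots> = ennreal (s ^ CARD('N)) * (\<integral>\<^sup>+ y. ennreal (G (?T y)) * indicator (?T ` Q) (?T y) \<partial>lebesgue)"
  proof -
    have "\<kappa> * s ^ (CARD('N) - 1) * (s / \<kappa>) = s ^ CARD('N)"
      using \<kappa> by (simp add: power_eq_if)
    then show ?thesis using s \<kappa> by (simp add: mult.assoc[symmetric] flip: ennreal_mult)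
  qed
  also have "\<dots> = (\<integral>\<^sup>+ x. ennreal (G x) * indicator (?T ` Q) x \<partial>lebesgue)"
    using nn_integral_affine_lebesgue[OF s0 mGT, of c] s by simp
  finally show ?thesis unfolding G_def .
qed

text \<open>If the inequality failed for arbitrarily small \<open>\<rho>\<close>, rescaling the given functions on the
  offending cubes to \<open>unit_cube B\<close> would give competitors for the cell problem, with parameter
  \<open>\<epsilon> / (\<rho> * \<delta>)\<close>, of energy less than the cell functional.\<close>

lemma cell_functional_blow_up:
  fixes n :: nat and p q\<^sub>1 q\<^sub>2 q\<^sub>3 :: real
    and M :: "(real^'m) set" and U :: "(real^'N) set"
    and F :: "('N::finite, 'k::finite, 'd::finite, 'm::finite) density" and B :: "(real^'N) set"
    and v :: "real^'N \<Rightarrow> real^'k" and mbar :: "real^'N \<Rightarrow> real^'N^'d" and \<phi> :: "real^'N \<Rightarrow> real^'m"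
    and v\<^sub>\<epsilon> :: "real \<Rightarrow> real^'N \<Rightarrow> real^'k" and m\<^sub>\<epsilon> :: "real \<Rightarrow> real^'N \<Rightarrow> real^'N^'d"
    and \<psi>\<^sub>\<epsilon> :: "real \<Rightarrow> real^'N \<Rightarrow> real^'m"
  assumes U: "open U" and x0: "x0 \<in> U" and q: "q\<^sub>1 \<ge> 1" "q\<^sub>2 \<ge> 1" "q\<^sub>3 \<ge> 1"
    and B: "orthonormal_basis B" "\<nu> \<in> B"
    and F: "continuous_on (jets n \<times> UNIV \<times> UNIV) (\<lambda>(a, b, x). F a b x)"
    and F0: "\<And>a b x. a \<in> jets n \<Longrightarrow> F a b x \<ge> 0"
    and lsc: "\<And>\<tau>. \<tau> > 0 \<Longrightarrow> \<exists>\<alpha>>0. \<forall>a\<in>jets n. \<forall>b x. norm (x - x0) < \<alpha> \<longrightarrow>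
             F a b x - F a b x0 \<ge> - \<tau> * F a b x0"
    and lim: "sobolev_loc 1 q\<^sub>1 U v" "Lp_loc U q\<^sub>2 mbar" "Lp_loc U q\<^sub>3 \<phi>"
    and plus: "((\<lambda>\<rho>. (\<integral>\<^sup>+ y\<in>half_ball x0 \<rho> \<nu>.
               ennreal (norm (weak_grad U v y - Vp) powr q\<^sub>1 + norm (mbar y - mp) powr q\<^sub>2
                 + norm (\<phi> y - \<phi>p) powr q\<^sub>3) \<partial>lebesgue)
               / emeasure lebesgue (ball x0 \<rho>)) \<longlongrightarrow> 0) (at_right 0)"
    and minus: "((\<lambda>\<rho>. (\<integral>\<^sup>+ y\<in>half_ball x0 \<rho> (- \<nu>).
               ennreal (norm (weak_grad U v y - Vm) powr q\<^sub>1 + norm (mbar y - mm) powr q\<^sub>2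
                 + norm (\<phi> y - \<phi>m) powr q\<^sub>3) \<partial>lebesgue)
               / emeasure lebesgue (ball x0 \<rho>)) \<longlongrightarrow> 0) (at_right 0)"
    and v: "\<And>\<epsilon>. \<epsilon> > 0 \<Longrightarrow> sobolev_loc 1 q\<^sub>1 U (v\<^sub>\<epsilon> \<epsilon>) \<and> sobolev_loc (n + 1) p U (v\<^sub>\<epsilon> \<epsilon>)"
    and m: "\<And>\<epsilon>. \<epsilon> > 0 \<Longrightarrow> Lp_loc U q\<^sub>2 (m\<^sub>\<epsilon> \<epsilon>) \<and> sobolev_loc n p U (m\<^sub>\<epsilon> \<epsilon>)"
    and \<psi>: "\<And>\<epsilon>. \<epsilon> > 0 \<Longrightarrow> Lp_loc U q\<^sub>3 (\<psi>\<^sub>\<epsilon> \<epsilon>) \<and> sobolev_loc n p U (\<psi>\<^sub>\<epsilon> \<epsilon>)"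
    and div: "\<And>\<epsilon>. \<epsilon> > 0 \<Longrightarrow> div_free U (m\<^sub>\<epsilon> \<epsilon>)"
    and inM: "\<And>\<epsilon>. \<epsilon> > 0 \<Longrightarrow> AE x\<in>U in lebesgue. \<psi>\<^sub>\<epsilon> \<epsilon> x \<in> M"
    and conv: "Lp_loc_tendsto U q\<^sub>1 (\<lambda>\<epsilon>. weak_grad U (v\<^sub>\<epsilon> \<epsilon>)) (weak_grad U v)"
      "Lp_loc_tendsto U q\<^sub>2 m\<^sub>\<epsilon> mbar" "Lp_loc_tendsto U q\<^sub>3 \<psi>\<^sub>\<epsilon> \<phi>"
    and \<delta>: "\<delta> > 0" and c: "c \<bullet> \<nu> = 0" and ball: "(\<lambda>y. c + \<delta> *\<^sub>R y) ` unit_cube B \<subseteq> ball 0 1"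
    and t: "t > 0" "ennreal t < cell_functional n p q\<^sub>1 q\<^sub>2 q\<^sub>3 M F B Vp mp \<phi>p Vm mm \<phi>m \<nu> x0"
  shows "\<forall>\<^sub>F \<rho> in at_right 0. ennreal (t * (\<rho> * \<delta>) ^ (CARD('N) - 1)) \<le>
      Liminf (at_right 0) (\<lambda>\<epsilon>. \<integral>\<^sup>+ x\<in>(\<lambda>y. (x0 + \<rho> *\<^sub>R c) + (\<rho> * \<delta>) *\<^sub>R y) ` unit_cube B. ennreal (1 / \<epsilon> *
             F (scaled_jet n \<epsilon> U (v\<^sub>\<epsilon> \<epsilon>) (m\<^sub>\<epsilon> \<epsilon>) (\<psi>\<^sub>\<epsilon> \<epsilon>) x)
               (weak_grad U (v\<^sub>\<epsilon> \<epsilon>) x, m\<^sub>\<epsilon> \<epsilon> x, \<psi>\<^sub>\<epsilon> \<epsilon> x) x) \<partial>lebesgue)"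
    (is "\<forall>\<^sub>F \<rho> in _. ?lo \<rho> \<le> Liminf _ (?en \<rho>)")
proof (rule ccontr)
  assume neg: "\<not> ?thesis"
  let ?Q = "unit_cube B"
  have Q: "open ?Q" "bounded ?Q" "?Q \<in> sets lebesgue"
    using open_unit_cube[OF B(1)] bounded_unit_cube[OF B(1)] by auto
  \<comment> \<open>A value strictly in between leaves room for the factor \<open>1 - \<tau>\<close>
    lost when \<open>x\<close> is frozen; \<open>\<tau>\<close> is then determined by
    \<open>(1 - \<tau>) * t2 = t\<close>.\<close>
  obtain t2 where t2: "t < t2" "ennreal t2 < cell_functional n p q\<^sub>1 q\<^sub>2 q\<^sub>3 M F B Vp mp \<phi>p Vm mm \<phi>m \<nu> x0"
    using ennreal_dense_real[OF t] .
  define \<tau> where "\<tau> = 1 - t / t2"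
  have \<tau>: "0 < \<tau>" "0 < 1 - \<tau>" "(1 - \<tau>) * t2 = t" using t(1) t2(1) by (auto simp: \<tau>_def)
  obtain \<alpha> where \<alpha>: "\<alpha> > 0" "\<And>a b x. a \<in> jets n \<Longrightarrow> norm (x - x0) < \<alpha> \<Longrightarrow> F a b x - F a b x0 \<ge> - \<tau> * F a b x0"
    using lsc[OF \<tau>(1)] by blast
  obtain r0 where r0: "r0 > 0" "cball x0 r0 \<subseteq> U" using U x0 open_contains_cball by blast
  have \<nu>: "\<nu> \<noteq> 0" using B by (auto simp: orthonormal_basis_def)
  define K where "K = 2 powr q\<^sub>1 + 2 powr q\<^sub>2 + 2 powr q\<^sub>3"
  have K: "2 powr q\<^sub>1 \<le> K" "2 powr q\<^sub>2 \<le> K" "2 powr q\<^sub>3 \<le> K" by (auto simp: K_def)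
  have K0: "K > 0" by (simp add: K_def add_pos_pos)
  define Ap where "Ap \<rho> = (\<integral>\<^sup>+ y\<in>half_ball x0 \<rho> \<nu>.
               ennreal (norm (weak_grad U v y - Vp) powr q\<^sub>1 + norm (mbar y - mp) powr q\<^sub>2
                 + norm (\<phi> y - \<phi>p) powr q\<^sub>3) \<partial>lebesgue)" for \<rho>
  define Am where "Am \<rho> = (\<integral>\<^sup>+ y\<in>half_ball x0 \<rho> (- \<nu>).
               ennreal (norm (weak_grad U v y - Vm) powr q\<^sub>1 + norm (mbar y - mm) powr q\<^sub>2
                 + norm (\<phi> y - \<phi>m) powr q\<^sub>3) \<partial>lebesgue)" for \<rho>
  let ?A = "\<lambda>\<rho>. ennreal (K / (\<rho> * \<delta>) ^ CARD('N)) * (Ap \<rho> + Am \<rho>)"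
  have A: "(?A \<longlongrightarrow> 0) (at_right 0)"
    using tendsto_add[OF emeasure_ball_ratio_tendsto[OF plus[folded Ap_def] \<delta>, of K]
        emeasure_ball_ratio_tendsto[OF minus[folded Am_def] \<delta>, of K]]
    by (simp add: distrib_left)
  have "cell_functional n p q\<^sub>1 q\<^sub>2 q\<^sub>3 M F B Vp mp \<phi>p Vm mm \<phi>m \<nu> x0 \<le> ennreal t2"
  proof (rule cell_functional_le)
    fix \<eta> :: real assume \<eta>: "\<eta> > 0"
    have "\<forall>\<^sub>F \<rho> in at_right 0. ?A \<rho> < ennreal (\<eta> / 2)"
      using order_tendstoD(2)[OF A] \<eta> by simp
    moreover have "\<forall>\<^sub>F \<rho> in at_right 0. 0 < \<rho> \<and> \<rho> < min \<alpha> r0"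
      using \<alpha>(1) r0(1) by (auto simp: eventually_at_right_field intro!: exI[of _ "min \<alpha> r0"])
    ultimately have "\<forall>\<^sub>F \<rho> in at_right 0. (0 < \<rho> \<and> \<rho> < min \<alpha> r0) \<and>
        ?A \<rho> < ennreal (\<eta> / 2)"
      by eventually_elim simp
    \<comment> \<open>The radius is fixed first, at a place where the inequality fails;
      \<open>\<epsilon>\<close> is chosen afterwards, with thresholds that depend on
      \<open>\<rho>\<close>.\<close>
    then obtain \<rho> where "(0 < \<rho> \<and> \<rho> < min \<alpha> r0) \<and>
        ?A \<rho> < ennreal (\<eta> / 2)"
        and lo: "\<not> ?lo \<rho> \<le> Liminf (at_right 0) (?en \<rho>)"
      using neg by (rule eventually_not_eventuallyE)
    then have \<rho>: "0 < \<rho>" "\<rho> < \<alpha>" "\<rho> < r0"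
        and A\<rho>: "?A \<rho> < ennreal (\<eta> / 2)"
      by auto
    define s where "s = \<rho> * \<delta>"
    define cc where "cc = x0 + \<rho> *\<^sub>R c"
    have s: "s > 0" using \<rho> \<delta> by (simp add: s_def)
    define T where "T y = cc + s *\<^sub>R y" for y
    have T: "T y = x0 + \<rho> *\<^sub>R (c + \<delta> *\<^sub>R y)" for y
      by (simp add: T_def cc_def s_def algebra_simps)
    have TQ: "T ` ?Q \<subseteq> ball x0 \<rho>"
    proof
      fix z assume "z \<in> T ` ?Q"
      then obtain y where y: "y \<in> ?Q" "z = T y" by blast
      then have "norm (c + \<delta> *\<^sub>R y) < 1" using ball by auto
      then show "z \<in> ball x0 \<rho>" using y \<rho>(1) by (simp add: T dist_norm)
    qed
    have cb: "cball x0 \<rho> \<subseteq> U" using r0(2) \<rho>(3) by (auto intro: subsetD[OF r0(2)])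
    \<comment> \<open>Membership in the local spaces on \<open>U\<close> yields membership in the
      spaces on the whole cube only if the closed cube is mapped into \<open>U\<close>.\<close>
    have TcQ: "T ` closure ?Q \<subseteq> U"
    proof -
      have "T ` closure ?Q \<subseteq> closure (T ` ?Q)"
        unfolding T_def by (rule continuous_image_closure_subset[where A = UNIV]) (auto intro!: continuous_intros)
      also have "\<dots> \<subseteq> cball x0 \<rho>" using TQ by (intro closure_minimal) (auto intro: less_imp_le)
      finally show ?thesis using cb by blast
    qed
    have TQU: "T ` ?Q \<subseteq> U" using TcQ closure_subset by blast
    let ?I1 = "\<lambda>\<epsilon>. (\<integral>\<^sup>+ x\<in>cball x0 \<rho>. ennreal (norm (weak_grad U (v\<^sub>\<epsilon> \<epsilon>) x - weak_grad U v x) powr q\<^sub>1) \<partial>lebesgue)"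
    let ?I2 = "\<lambda>\<epsilon>. (\<integral>\<^sup>+ x\<in>cball x0 \<rho>. ennreal (norm (m\<^sub>\<epsilon> \<epsilon> x - mbar x) powr q\<^sub>2) \<partial>lebesgue)"
    let ?I3 = "\<lambda>\<epsilon>. (\<integral>\<^sup>+ x\<in>cball x0 \<rho>. ennreal (norm (\<psi>\<^sub>\<epsilon> \<epsilon> x - \<phi> x) powr q\<^sub>3) \<partial>lebesgue)"
    let ?e = "ennreal (\<eta> / 2 * s ^ CARD('N) / K)"
    have "\<forall>\<^sub>F \<epsilon> in at_right 0. ?I1 \<epsilon> < ?e" "\<forall>\<^sub>F \<epsilon> in at_right 0. ?I2 \<epsilon> < ?e" "\<forall>\<^sub>F \<epsilon> in at_right 0. ?I3 \<epsilon> < ?e"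
      using \<eta> s K0 by (auto intro!: Lp_loc_tendstoD[OF conv(1) compact_cball cb]
          Lp_loc_tendstoD[OF conv(2) compact_cball cb] Lp_loc_tendstoD[OF conv(3) compact_cball cb])
    \<comment> \<open>This makes the parameter \<open>\<epsilon> / s\<close> of the rescaled
      competitor smaller than \<open>\<eta>\<close>.\<close>
    moreover have "\<forall>\<^sub>F \<epsilon> in at_right 0. 0 < \<epsilon> \<and> \<epsilon> < \<eta> * s"
      using \<eta> s by (auto simp: eventually_at_right_field intro!: exI[of _ "\<eta> * s"])
    ultimately have ev: "\<forall>\<^sub>F \<epsilon> in at_right 0. ?I1 \<epsilon> < ?e \<and> ?I2 \<epsilon> < ?e \<and> ?I3 \<epsilon> < ?e \<and> 0 < \<epsilon> \<and> \<epsilon> < \<eta> * s"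
      by eventually_elim simp
    have "\<not> (\<forall>\<^sub>F \<epsilon> in at_right 0. ?lo \<rho> \<le> ?en \<rho> \<epsilon>)"
    proof
      assume "\<forall>\<^sub>F \<epsilon> in at_right 0. ?lo \<rho> \<le> ?en \<rho> \<epsilon>"
      then have "?lo \<rho> \<le> Liminf (at_right 0) (?en \<rho>)" by (rule Liminf_bounded)
      with lo show False by contradiction
    qed
    with ev obtain \<epsilon> where \<epsilon>': "?I1 \<epsilon> < ?e \<and> ?I2 \<epsilon> < ?e \<and> ?I3 \<epsilon> < ?e \<and> 0 < \<epsilon> \<and> \<epsilon> < \<eta> * s"
      and "\<not> ?lo \<rho> \<le> ?en \<rho> \<epsilon>"
      by (rule eventually_not_eventuallyE)
    then have en: "?en \<rho> \<epsilon> < ?lo \<rho>" by (simp only: not_le)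
    from \<epsilon>' have \<epsilon>: "?I1 \<epsilon> < ?e" "?I2 \<epsilon> < ?e" "?I3 \<epsilon> < ?e" "0 < \<epsilon>" "\<epsilon> < \<eta> * s"
      by blast+
    define u where "u y = (1 / s) *\<^sub>R v\<^sub>\<epsilon> \<epsilon> (T y)" for y
    note v\<epsilon> = v[OF \<epsilon>(4), THEN conjunct1] v[OF \<epsilon>(4), THEN conjunct2]
    note m\<epsilon> = m[OF \<epsilon>(4), THEN conjunct1] m[OF \<epsilon>(4), THEN conjunct2]
    note \<psi>\<epsilon> = \<psi>[OF \<epsilon>(4), THEN conjunct1] \<psi>[OF \<epsilon>(4), THEN conjunct2]
    have adm: "admissible n p q\<^sub>1 q\<^sub>2 q\<^sub>3 M ?Q u (\<lambda>y. m\<^sub>\<epsilon> \<epsilon> (T y)) (\<lambda>y. \<psi>\<^sub>\<epsilon> \<epsilon> (T y))"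
      unfolding admissible_def
    proof (intro conjI)
      note TcQ' = TcQ[unfolded T_def] and TQU' = TQU[unfolded T_def]
      show "sobolev 1 q\<^sub>1 ?Q u" "sobolev (n + 1) p ?Q u"
        unfolding u_def T_def by (intro sobolev_affine[OF s _ Q(1,2) TcQ'] v\<epsilon>)+
      show "Lp ?Q q\<^sub>2 (\<lambda>y. m\<^sub>\<epsilon> \<epsilon> (T y))"
        using Lp_loc_Lp_affine[OF s m\<epsilon>(1) Q(1,2) TcQ', of 1] by (simp add: T_def)
      show "sobolev n p ?Q (\<lambda>y. m\<^sub>\<epsilon> \<epsilon> (T y))"
        using sobolev_affine[OF s m\<epsilon>(2) Q(1,2) TcQ', of 1] by (simp add: T_def)
      show "Lp ?Q q\<^sub>3 (\<lambda>y. \<psi>\<^sub>\<epsilon> \<epsilon> (T y))"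
        using Lp_loc_Lp_affine[OF s \<psi>\<epsilon>(1) Q(1,2) TcQ', of 1] by (simp add: T_def)
      show "sobolev n p ?Q (\<lambda>y. \<psi>\<^sub>\<epsilon> \<epsilon> (T y))"
        using sobolev_affine[OF s \<psi>\<epsilon>(2) Q(1,2) TcQ', of 1] by (simp add: T_def)
      show "div_free ?Q (\<lambda>y. m\<^sub>\<epsilon> \<epsilon> (T y))"
        unfolding T_def by (rule div_free_affine[OF s div[OF \<epsilon>(4)] TQU'])
      have "AE y in lebesgue. T y \<in> U \<longrightarrow> \<psi>\<^sub>\<epsilon> \<epsilon> (T y) \<in> M"
        unfolding T_def by (rule AE_affine_lebesgue[OF _ inM[OF \<epsilon>(4)]]) (use s in simp)
      then show "AE y\<in>?Q in lebesgue. \<psi>\<^sub>\<epsilon> \<epsilon> (T y) \<in> M"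
        by (rule eventually_mono) (use TQU in blast)
    qed
    have AE_jet: "AE y\<in>?Q in lebesgue. weak_grad ?Q u y = weak_grad U (v\<^sub>\<epsilon> \<epsilon>) (T y)"
      using AE_scaled_jet_affine[OF s Q(1) TQU[unfolded T_def] v\<epsilon> m\<epsilon>(2) \<psi>\<epsilon>(2)]
      unfolding u_def T_def by (rule eventually_mono) blast
    have cc: "(cc - x0) \<bullet> \<nu> = 0" using c by (simp add: cc_def)
    have A\<rho>': "ennreal (K / s ^ DIM(real^'N)) * (Ap \<rho> + Am \<rho>) < ennreal (\<eta> / 2)" using A\<rho> by (simp add: s_def)
    note small = Lp_distance_blow_up_less[OF s _ \<nu> cc Q(3) TQ[unfolded T_def] cb _ _ _ \<eta> _ _ _ A\<rho>']
    have d2: "(\<integral>\<^sup>+ y\<in>?Q. ennreal (norm (m\<^sub>\<epsilon> \<epsilon> (T y) - (if y \<bullet> \<nu> > 0 then mp else mm)) powr q\<^sub>2) \<partial>lebesgue) < ennreal \<eta>"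
      unfolding T_def
    proof (rule small[where g = mbar, OF _ Lp_loc_borel_measurable[OF U m\<epsilon>(1)] Lp_loc_borel_measurable[OF U lim(2)] K(2)])
      show "(\<integral>\<^sup>+ x\<in>half_ball x0 \<rho> \<nu>. ennreal (norm (mbar x - mp) powr q\<^sub>2) \<partial>lebesgue) \<le> Ap \<rho>"
        "(\<integral>\<^sup>+ x\<in>half_ball x0 \<rho> (- \<nu>). ennreal (norm (mbar x - mm) powr q\<^sub>2) \<partial>lebesgue) \<le> Am \<rho>"
        unfolding Ap_def Am_def by (intro nn_integral_mono mult_right_mono ennreal_leI; simp)+
    qed (use q \<epsilon>(2) in auto)
    have d3: "(\<integral>\<^sup>+ y\<in>?Q. ennreal (norm (\<psi>\<^sub>\<epsilon> \<epsilon> (T y) - (if y \<bullet> \<nu> > 0 then \<phi>p else \<phi>m)) powr q\<^sub>3) \<partial>lebesgue) < ennreal \<eta>"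
      unfolding T_def
    proof (rule small[where g = \<phi>, OF _ Lp_loc_borel_measurable[OF U \<psi>\<epsilon>(1)] Lp_loc_borel_measurable[OF U lim(3)] K(3)])
      show "(\<integral>\<^sup>+ x\<in>half_ball x0 \<rho> \<nu>. ennreal (norm (\<phi> x - \<phi>p) powr q\<^sub>3) \<partial>lebesgue) \<le> Ap \<rho>"
        "(\<integral>\<^sup>+ x\<in>half_ball x0 \<rho> (- \<nu>). ennreal (norm (\<phi> x - \<phi>m) powr q\<^sub>3) \<partial>lebesgue) \<le> Am \<rho>"
        unfolding Ap_def Am_def by (intro nn_integral_mono mult_right_mono ennreal_leI; simp)+
    qed (use q \<epsilon>(3) in auto)
    have "(\<integral>\<^sup>+ y\<in>?Q. ennreal (norm (weak_grad U (v\<^sub>\<epsilon> \<epsilon>) (T y) - (if y \<bullet> \<nu> > 0 then Vp else Vm)) powr q\<^sub>1) \<partial>lebesgue) < ennreal \<eta>"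
      unfolding T_def
    proof (rule small[where g = "weak_grad U v", OF _ weak_grad_borel_measurable[OF U v\<epsilon>(1)] weak_grad_borel_measurable[OF U lim(1)] K(1)])
      show "(\<integral>\<^sup>+ x\<in>half_ball x0 \<rho> \<nu>. ennreal (norm (weak_grad U v x - Vp) powr q\<^sub>1) \<partial>lebesgue) \<le> Ap \<rho>"
        "(\<integral>\<^sup>+ x\<in>half_ball x0 \<rho> (- \<nu>). ennreal (norm (weak_grad U v x - Vm) powr q\<^sub>1) \<partial>lebesgue) \<le> Am \<rho>"
        unfolding Ap_def Am_def by (intro nn_integral_mono mult_right_mono ennreal_leI; simp)+
    qed (use q \<epsilon>(1) in auto)
    also have "(\<integral>\<^sup>+ y\<in>?Q. ennreal (norm (weak_grad U (v\<^sub>\<epsilon> \<epsilon>) (T y) - (if y \<bullet> \<nu> > 0 then Vp else Vm)) powr q\<^sub>1) \<partial>lebesgue)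
      = (\<integral>\<^sup>+ y\<in>?Q. ennreal (norm (weak_grad ?Q u y - (if y \<bullet> \<nu> > 0 then Vp else Vm)) powr q\<^sub>1) \<partial>lebesgue)"
      by (rule nn_integral_cong_AE, rule eventually_mono[OF AE_jet]) (auto split: split_indicator)
    finally have d1: "(\<integral>\<^sup>+ y\<in>?Q. ennreal (norm (weak_grad ?Q u y - (if y \<bullet> \<nu> > 0 then Vp else Vm)) powr q\<^sub>1) \<partial>lebesgue) < ennreal \<eta>" .
    let ?E = "\<integral>\<^sup>+ y\<in>?Q. ennreal (1 / (\<epsilon> / s) * F (scaled_jet n (\<epsilon> / s) ?Q u (\<lambda>y. m\<^sub>\<epsilon> \<epsilon> (T y)) (\<lambda>y. \<psi>\<^sub>\<epsilon> \<epsilon> (T y)) y)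
        (weak_grad ?Q u y, m\<^sub>\<epsilon> \<epsilon> (T y), \<psi>\<^sub>\<epsilon> \<epsilon> (T y)) x0) \<partial>lebesgue"
    have "ennreal ((1 - \<tau>) * s ^ (CARD('N) - 1)) * ?E \<le> ?en \<rho> \<epsilon>"
      unfolding u_def T_def cc_def[symmetric] s_def[symmetric]
    proof (rule energy_blow_up[OF s \<epsilon>(4) Q(1) U TQU[unfolded T_def] F v\<epsilon> m\<epsilon> \<psi>\<epsilon> \<tau>(2)])
      fix a :: "'N list \<Rightarrow> ('N, 'k, 'd, 'm) state" and b y
      assume a: "a \<in> jets n" and y: "y \<in> ?Q"
      have "T y \<in> ball x0 \<rho>" using TQ y by blast
      then have "norm (T y - x0) < \<alpha>" using \<rho>(2) by (simp add: dist_norm norm_minus_commute)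
      from \<alpha>(2)[OF a this, of b] show "(1 - \<tau>) * F a b x0 \<le> F a b (cc + s *\<^sub>R y)"
        by (simp add: T_def algebra_simps)
    qed
    also note en
    \<comment> \<open>By the choice of \<open>\<tau>\<close> the bound that fails carries the same
      factor as the rescaled energy, so comparing the two leaves \<open>t2\<close>.\<close>
    also have "?lo \<rho> = ennreal ((1 - \<tau>) * s ^ (CARD('N) - 1)) * ennreal t2"
      using \<tau> s t t2 by (subst ennreal_mult[symmetric]) (auto simp: s_def mult_ac)
    finally have lt: "ennreal ((1 - \<tau>) * s ^ (CARD('N) - 1)) * ?E < ennreal ((1 - \<tau>) * s ^ (CARD('N) - 1)) * ennreal t2" .
    have "?E \<le> ennreal t2"
    proof (rule ccontr)
      assume "\<not> ?thesis"
      then have "ennreal ((1 - \<tau>) * s ^ (CARD('N) - 1)) * ennreal t2 \<le> ennreal ((1 - \<tau>) * s ^ (CARD('N) - 1)) * ?E"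
        by (intro mult_left_mono) auto
      with lt show False by simp
    qed
    then show "\<exists>e u \<theta> \<gamma>. 0 < e \<and> e < \<eta> \<and> admissible n p q\<^sub>1 q\<^sub>2 q\<^sub>3 M ?Q u \<theta> \<gamma> \<and>
      (\<integral>\<^sup>+ y\<in>?Q. ennreal (norm (weak_grad ?Q u y - (if y \<bullet> \<nu> > 0 then Vp else Vm)) powr q\<^sub>1) \<partial>lebesgue) < ennreal \<eta> \<and>
      (\<integral>\<^sup>+ y\<in>?Q. ennreal (norm (\<theta> y - (if y \<bullet> \<nu> > 0 then mp else mm)) powr q\<^sub>2) \<partial>lebesgue) < ennreal \<eta> \<and>
      (\<integral>\<^sup>+ y\<in>?Q. ennreal (norm (\<gamma> y - (if y \<bullet> \<nu> > 0 then \<phi>p else \<phi>m)) powr q\<^sub>3) \<partial>lebesgue) < ennreal \<eta> \<and>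
      (\<integral>\<^sup>+ y\<in>?Q. ennreal (1 / e * F (scaled_jet n e ?Q u \<theta> \<gamma> y) (weak_grad ?Q u y, \<theta> y, \<gamma> y) x0) \<partial>lebesgue) \<le> ennreal t2"
      using adm d1 d2 d3 \<epsilon>(4,5) s
      by (intro exI[of _ "\<epsilon> / s"] exI[of _ u] exI[of _ "\<lambda>y. m\<^sub>\<epsilon> \<epsilon> (T y)"] exI[of _ "\<lambda>y. \<psi>\<^sub>\<epsilon> \<epsilon> (T y)"])
        (simp add: field_simps)
  qed
  then show False using t2(2) by simp
qed

text \<open>A scaled copy of one packing of the unit disc sits in every small ball around
  \<open>x0\<close>, and superadditivity of lower limits adds up the contributions of its disjoint
  cubes. The gap between \<open>t\<close> and \<open>t'\<close> pays for the part of the disc that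
  stays uncovered.\<close>

lemma ball_density_blow_up:
  fixes \<mu> :: "real \<Rightarrow> (real^'N) measure" and B :: "(real^'N::finite) set"
  assumes B: "orthonormal_basis B" "\<nu> \<in> B" and sets: "\<And>\<epsilon>. sets (\<mu> \<epsilon>) = sets lebesgue"
    and t: "0 < t" "t < t'"
    and cubes: "\<And>\<delta> c. \<delta> > 0 \<Longrightarrow> c \<bullet> \<nu> = 0 \<Longrightarrow> (\<lambda>y. c + \<delta> *\<^sub>R y) ` unit_cube B \<subseteq> ball 0 1 \<Longrightarrow>
      \<forall>\<^sub>F \<rho> in at_right 0. ennreal (t' * (\<rho> * \<delta>) ^ (CARD('N) - 1)) \<le>
        Liminf (at_right 0) (\<lambda>\<epsilon>. emeasure (\<mu> \<epsilon>) ((\<lambda>y. (x0 + \<rho> *\<^sub>R c) + (\<rho> * \<delta>) *\<^sub>R y) ` unit_cube B))"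
  shows "\<forall>\<^sub>F \<rho> in at_right 0. ennreal (t * (unit_ball_vol (real (CARD('N) - 1)) * \<rho> ^ (CARD('N) - 1))) \<le>
     Liminf (at_right 0) (\<lambda>\<epsilon>. emeasure (\<mu> \<epsilon>) (cball x0 \<rho>))"
proof -
  let ?w = "unit_ball_vol (real (CARD('N) - 1))" and ?s = "CARD('N) - 1"
  have w: "?w > 0" by simp
  \<comment> \<open>The fraction \<open>t / t'\<close> of the disc is to be filled: cubes of density
    \<open>t'\<close> on it amount to density \<open>t\<close> on the whole disc.\<close>
  have "?w * (t / t') < ?w * 1" using t by (intro mult_strict_left_mono w) simp
  then have "?w * (t / t') < ?w" by simp
  then obtain \<delta> Z where \<delta>: "\<delta> > 0" and Z: "finite Z" "\<And>c. c \<in> Z \<Longrightarrow> c \<bullet> \<nu> = 0"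
    "\<And>c. c \<in> Z \<Longrightarrow> (\<lambda>y. c + \<delta> *\<^sub>R y) ` unit_cube B \<subseteq> ball 0 1"
    "disjoint_family_on (\<lambda>c. (\<lambda>y. c + \<delta> *\<^sub>R y) ` unit_cube B) Z"
    "?w * (t / t') < real (card Z) * \<delta> ^ ?s"
    using disc_packing_by_cubes[OF B, of "?w * (t / t')"] by (auto simp: DIM_cart)
  define C where "C \<rho> c = (\<lambda>y. (x0 + \<rho> *\<^sub>R c) + (\<rho> * \<delta>) *\<^sub>R y) ` unit_cube B" for \<rho> c
  have CT: "C \<rho> c = (\<lambda>z. x0 + \<rho> *\<^sub>R z) ` ((\<lambda>y. c + \<delta> *\<^sub>R y) ` unit_cube B)" for \<rho> c
    by (auto simp: C_def image_image algebra_simps)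
  \<comment> \<open>The packing is finite and independent of \<open>\<rho>\<close>, so one threshold
    for \<open>\<rho>\<close> serves all its cubes.\<close>
  have "\<forall>\<^sub>F \<rho> in at_right 0. \<forall>c\<in>Z. ennreal (t' * (\<rho> * \<delta>) ^ ?s) \<le> Liminf (at_right 0) (\<lambda>\<epsilon>. emeasure (\<mu> \<epsilon>) (C \<rho> c))"
    unfolding C_def using Z(1) cubes[OF \<delta> Z(2,3)] by (intro eventually_ball_finite) auto
  then show ?thesis
    using eventually_at_right_less[of "0::real"]
  proof eventually_elim
    case (elim \<rho>)
    have Csub: "C \<rho> c \<subseteq> cball x0 \<rho>" if "c \<in> Z" for c
    proof
      fix x assume "x \<in> C \<rho> c"
      then obtain z where z: "z \<in> (\<lambda>y. c + \<delta> *\<^sub>R y) ` unit_cube B" "x = x0 + \<rho> *\<^sub>R z"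
        unfolding CT by blast
      then have "norm z < 1" using Z(3)[OF that] by auto
      then show "x \<in> cball x0 \<rho>" using z elim by (simp add: dist_norm mult_left_le)
    qed
    have Copen: "open (C \<rho> c)" for c
      unfolding C_def using elim \<delta> by (intro open_affine_image open_unit_cube[OF B(1)]) auto
    have inj: "inj (\<lambda>z. x0 + \<rho> *\<^sub>R z)" using elim by (auto intro!: injI)
    have Cdisj: "disjoint_family_on (C \<rho>) Z"
      using Z(4) unfolding disjoint_family_on_def CT image_Int[OF inj, symmetric] by simp
    have "t * (?w * \<rho> ^ ?s) \<le> real (card Z) * (t' * (\<rho> * \<delta>) ^ ?s)"
    proof -
      have "t * ?w \<le> real (card Z) * t' * \<delta> ^ ?s"
        using Z(5) t by (simp add: field_simps)
      then have "t * ?w * \<rho> ^ ?s \<le> real (card Z) * t' * \<delta> ^ ?s * \<rho> ^ ?s"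
        using elim by (intro mult_right_mono) auto
      then show ?thesis by (simp add: power_mult_distrib mult_ac)
    qed
    then have "ennreal (t * (?w * \<rho> ^ ?s)) \<le> (\<Sum>c\<in>Z. ennreal (t' * (\<rho> * \<delta>) ^ ?s))"
      using elim \<delta> t by (simp add: ennreal_of_nat_eq_real_of_nat ennreal_leI flip: ennreal_mult)
    also have "\<dots> \<le> (\<Sum>c\<in>Z. Liminf (at_right 0) (\<lambda>\<epsilon>. emeasure (\<mu> \<epsilon>) (C \<rho> c)))"
      using elim by (intro sum_mono) auto
    also have "\<dots> \<le> Liminf (at_right 0) (\<lambda>\<epsilon>. \<Sum>c\<in>Z. emeasure (\<mu> \<epsilon>) (C \<rho> c))"
      by (rule sum_Liminf_le_ennreal[OF Z(1)])
    also have "\<dots> \<le> Liminf (at_right 0) (\<lambda>\<epsilon>. emeasure (\<mu> \<epsilon>) (cball x0 \<rho>))"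
    proof (intro Liminf_mono always_eventually allI)
      fix \<epsilon>
      have "(\<Sum>c\<in>Z. emeasure (\<mu> \<epsilon>) (C \<rho> c)) = emeasure (\<mu> \<epsilon>) (\<Union>c\<in>Z. C \<rho> c)"
        using Copen Cdisj Z(1) by (intro sum_emeasure) (auto simp: sets)
      also have "\<dots> \<le> emeasure (\<mu> \<epsilon>) (cball x0 \<rho>)"
        using Csub by (intro emeasure_mono) (auto simp: sets)
      finally show "(\<Sum>c\<in>Z. emeasure (\<mu> \<epsilon>) (C \<rho> c)) \<le> emeasure (\<mu> \<epsilon>) (cball x0 \<rho>)" .
    qed
    finally show ?case .
  qed
qed

section \<open>The lower bound for the energy in terms of the cell functional\<close>

theorem theorem2p3:
  fixes n :: nat and p q\<^sub>1 q\<^sub>2 q\<^sub>3 :: real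
    and M :: "(real^'m) set" and \<Omega> D :: "(real^'N) set"
    and F :: "('N::finite, 'k::finite, 'd::finite, 'm::finite) density"
    and basis_of :: "real^'N \<Rightarrow> (real^'N) set"
    and v :: "real^'N \<Rightarrow> real^'k" and mbar :: "real^'N \<Rightarrow> real^'N^'d" and \<phi> :: "real^'N \<Rightarrow> real^'m"
    and Vp Vm :: "real^'N \<Rightarrow> real^'N^'k" and mp mm :: "real^'N \<Rightarrow> real^'N^'d"
    and \<phi>p \<phi>m :: "real^'N \<Rightarrow> real^'m" and nu :: "real^'N \<Rightarrow> real^'N"
    and v\<^sub>\<epsilon> :: "real \<Rightarrow> real^'N \<Rightarrow> real^'k" and m\<^sub>\<epsilon> :: "real \<Rightarrow> real^'N \<Rightarrow> real^'N^'d"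
    and \<psi>\<^sub>\<epsilon> :: "real \<Rightarrow> real^'N \<Rightarrow> real^'m"
  assumes "n \<ge> 1" and "open \<Omega>" and "D \<subseteq> \<Omega>" and "D \<in> sets borel"
    and "sigma_finite_measure (restrict_space (hausdorff_measure (CARD('N) - 1)) D)"
    and "q\<^sub>1 \<ge> 1" and "q\<^sub>2 \<ge> 1" and "q\<^sub>3 \<ge> 1" and "p \<ge> 1"
    and "\<And>\<nu>. norm \<nu> = 1 \<Longrightarrow> orthonormal_basis (basis_of \<nu>) \<and> \<nu> \<in> basis_of \<nu>"
    and "continuous_on (jets n \<times> UNIV \<times> UNIV) (\<lambda>(a, b, x). F a b x)"
    and "\<And>a b x. a \<in> jets n \<Longrightarrow> F a b x \<ge> 0"
    and "\<And>x\<^sub>0 \<tau>. x\<^sub>0 \<in> \<Omega> \<Longrightarrow> \<tau> > 0 \<Longrightarrow>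
           \<exists>\<alpha>>0. \<forall>a\<in>jets n. \<forall>b x. norm (x - x\<^sub>0) < \<alpha> \<longrightarrow>
             F a b x - F a b x\<^sub>0 \<ge> - \<tau> * F a b x\<^sub>0"
    and "sobolev_loc 1 q\<^sub>1 \<Omega> v" and "Lp_loc \<Omega> q\<^sub>2 mbar" and "Lp_loc \<Omega> q\<^sub>3 \<phi>"
    and "div_free \<Omega> mbar"
    and "AE x\<in>\<Omega> in lebesgue. F (\<lambda>_. 0) (weak_grad \<Omega> v x, mbar x, \<phi> x) x = 0"
    and "Vp \<in> borel_measurable (restrict_space borel D)"
    and "Vm \<in> borel_measurable (restrict_space borel D)"
    and "mp \<in> borel_measurable (restrict_space borel D)"
    and "mm \<in> borel_measurable (restrict_space borel D)"
    and "\<phi>p \<in> borel_measurable (restrict_space borel D)"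
    and "\<phi>m \<in> borel_measurable (restrict_space borel D)"
    and "nu \<in> borel_measurable (restrict_space borel D)"
    and "\<And>x. x \<in> D \<Longrightarrow> norm (nu x) = 1"
    and "\<And>x. x \<in> D \<Longrightarrow>
           ((\<lambda>\<rho>. (\<integral>\<^sup>+ y\<in>half_ball x \<rho> (nu x).
               ennreal (norm (weak_grad \<Omega> v y - Vp x) powr q\<^sub>1 + norm (mbar y - mp x) powr q\<^sub>2
                 + norm (\<phi> y - \<phi>p x) powr q\<^sub>3) \<partial>lebesgue)
               / emeasure lebesgue (ball x \<rho>)) \<longlongrightarrow> 0) (at_right 0)"
    and "\<And>x. x \<in> D \<Longrightarrow>
           ((\<lambda>\<rho>. (\<integral>\<^sup>+ y\<in>half_ball x \<rho> (- nu x).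
               ennreal (norm (weak_grad \<Omega> v y - Vm x) powr q\<^sub>1 + norm (mbar y - mm x) powr q\<^sub>2
                 + norm (\<phi> y - \<phi>m x) powr q\<^sub>3) \<partial>lebesgue)
               / emeasure lebesgue (ball x \<rho>)) \<longlongrightarrow> 0) (at_right 0)"
    and "\<And>\<epsilon>. \<epsilon> > 0 \<Longrightarrow> sobolev_loc 1 q\<^sub>1 \<Omega> (v\<^sub>\<epsilon> \<epsilon>) \<and> sobolev_loc (n + 1) p \<Omega> (v\<^sub>\<epsilon> \<epsilon>)"
    and "\<And>\<epsilon>. \<epsilon> > 0 \<Longrightarrow> Lp_loc \<Omega> q\<^sub>2 (m\<^sub>\<epsilon> \<epsilon>) \<and> sobolev_loc n p \<Omega> (m\<^sub>\<epsilon> \<epsilon>)"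
    and "\<And>\<epsilon>. \<epsilon> > 0 \<Longrightarrow> Lp_loc \<Omega> q\<^sub>3 (\<psi>\<^sub>\<epsilon> \<epsilon>) \<and> sobolev_loc n p \<Omega> (\<psi>\<^sub>\<epsilon> \<epsilon>)"
    and "\<And>\<epsilon>. \<epsilon> > 0 \<Longrightarrow> div_free \<Omega> (m\<^sub>\<epsilon> \<epsilon>)"
    and "\<And>\<epsilon>. \<epsilon> > 0 \<Longrightarrow> AE x\<in>\<Omega> in lebesgue. \<psi>\<^sub>\<epsilon> \<epsilon> x \<in> M"
    and "Lp_loc_tendsto \<Omega> q\<^sub>1 v\<^sub>\<epsilon> v"
    and "Lp_loc_tendsto \<Omega> q\<^sub>1 (\<lambda>\<epsilon>. weak_grad \<Omega> (v\<^sub>\<epsilon> \<epsilon>)) (weak_grad \<Omega> v)"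
    and "Lp_loc_tendsto \<Omega> q\<^sub>2 m\<^sub>\<epsilon> mbar"
    and "Lp_loc_tendsto \<Omega> q\<^sub>3 \<psi>\<^sub>\<epsilon> \<phi>"
  shows "Liminf (at_right 0) (\<lambda>\<epsilon>. \<integral>\<^sup>+ x\<in>\<Omega>. ennreal (1 / \<epsilon> *
             F (scaled_jet n \<epsilon> \<Omega> (v\<^sub>\<epsilon> \<epsilon>) (m\<^sub>\<epsilon> \<epsilon>) (\<psi>\<^sub>\<epsilon> \<epsilon>) x)
               (weak_grad \<Omega> (v\<^sub>\<epsilon> \<epsilon>) x, m\<^sub>\<epsilon> \<epsilon> x, \<psi>\<^sub>\<epsilon> \<epsilon> x) x) \<partial>lebesgue)
         \<ge> (\<integral>\<^sup>+ x\<in>D. cell_functional n p q\<^sub>1 q\<^sub>2 q\<^sub>3 M F (basis_of (nu x))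
               (Vp x) (mp x) (\<phi>p x) (Vm x) (mm x) (\<phi>m x) (nu x) x
             \<partial>hausdorff_measure (CARD('N) - 1))"
proof -
  note a = assms
  define en where "en \<epsilon> x = ennreal (1 / \<epsilon> *
             F (scaled_jet n \<epsilon> \<Omega> (v\<^sub>\<epsilon> \<epsilon>) (m\<^sub>\<epsilon> \<epsilon>) (\<psi>\<^sub>\<epsilon> \<epsilon>) x)
               (weak_grad \<Omega> (v\<^sub>\<epsilon> \<epsilon>) x, m\<^sub>\<epsilon> \<epsilon> x, \<psi>\<^sub>\<epsilon> \<epsilon> x) x)" for \<epsilon> x
  \<comment> \<open>Measurability of the integrand is known only inside \<open>\<Omega>\<close>,
    hence the indicator. For \<open>\<epsilon> \<le> 0\<close> nothing is known about the integrand,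
    but the limits only see positive \<epsilon>.\<close>
  define \<mu> where "\<mu> \<epsilon> = density lebesgue (\<lambda>x. indicator \<Omega> x * en \<epsilon> x)" for \<epsilon>
  have \<mu>: "emeasure (\<mu> \<epsilon>) W = (\<integral>\<^sup>+ x\<in>W. en \<epsilon> x \<partial>lebesgue)"
    if "\<epsilon> > 0" "W \<in> sets lebesgue" "W \<subseteq> \<Omega>" for \<epsilon> W
  proof -
    have "(\<lambda>x. indicator \<Omega> x * en \<epsilon> x) \<in> borel_measurable lebesgue"
      unfolding en_def using a(29-31)[OF that(1)]
      by (intro energy_density_borel_measurable[OF \<open>open \<Omega>\<close> a(11)]) auto
    then have "emeasure (\<mu> \<epsilon>) W = (\<integral>\<^sup>+ x. (indicator \<Omega> x * en \<epsilon> x) * indicator W x \<partial>lebesgue)"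
      unfolding \<mu>_def using that(2) by (rule emeasure_density)
    also have "\<dots> = (\<integral>\<^sup>+ x\<in>W. en \<epsilon> x \<partial>lebesgue)"
      using that(3) by (intro nn_integral_cong) (auto split: split_indicator)
    finally show ?thesis .
  qed
  have Liminf_\<mu>: "Liminf (at_right 0) (\<lambda>\<epsilon>. emeasure (\<mu> \<epsilon>) W) = Liminf (at_right 0) (\<lambda>\<epsilon>. \<integral>\<^sup>+ x\<in>W. en \<epsilon> x \<partial>lebesgue)"
    if "W \<in> sets lebesgue" "W \<subseteq> \<Omega>" for W
    by (rule Liminf_eq, rule eventually_mono[OF eventually_at_right_less]) (rule \<mu>[OF _ that])
  have sets: "sets (\<mu> \<epsilon>) = sets lebesgue" for \<epsilon> by (simp add: \<mu>_def)
  have "(\<integral>\<^sup>+ x\<in>D. cell_functional n p q\<^sub>1 q\<^sub>2 q\<^sub>3 M F (basis_of (nu x))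
               (Vp x) (mp x) (\<phi>p x) (Vm x) (mm x) (\<phi>m x) (nu x) x
             \<partial>hausdorff_measure (CARD('N) - 1)) \<le> Liminf (at_right 0) (\<lambda>\<epsilon>. emeasure (\<mu> \<epsilon>) \<Omega>)"
  proof (rule nn_integral_hausdorff_le_Liminf)
    show "sets borel \<subseteq> sets (\<mu> \<epsilon>)" for \<epsilon> unfolding sets by auto
    show "open \<Omega>" "D \<subseteq> \<Omega>" by (fact a)+
    fix x t
    let ?E = "cell_functional n p q\<^sub>1 q\<^sub>2 q\<^sub>3 M F (basis_of (nu x))
               (Vp x) (mp x) (\<phi>p x) (Vm x) (mm x) (\<phi>m x) (nu x) x"
    assume x: "x \<in> D" and t: "0 < t" "ennreal t < ?E"
    \<comment> \<open>The reserve between \<open>t\<close> and the cell functional that the packing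
      of the disc consumes.\<close>
    obtain t' where t': "t < t'" "ennreal t' < ?E"
      using ennreal_dense_real[OF t] .
    have B: "orthonormal_basis (basis_of (nu x))" "nu x \<in> basis_of (nu x)"
      using a(10)[OF a(26)[OF x]] by auto
    have x\<Omega>: "x \<in> \<Omega>" using x \<open>D \<subseteq> \<Omega>\<close> by blast
    show "\<forall>\<^sub>F \<rho> in at_right 0. ennreal (t * (unit_ball_vol (real (CARD('N) - 1)) * \<rho> ^ (CARD('N) - 1)))
        \<le> Liminf (at_right 0) (\<lambda>\<epsilon>. emeasure (\<mu> \<epsilon>) (cball x \<rho>))"
    proof (rule ball_density_blow_up[OF B sets t(1) t'(1)])
      fix \<delta> :: real and c
      assume \<delta>: "\<delta> > 0" and c: "c \<bullet> nu x = 0" "(\<lambda>y. c + \<delta> *\<^sub>R y) ` unit_cube (basis_of (nu x)) \<subseteq> ball 0 1"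
      let ?C = "\<lambda>\<rho>. (\<lambda>y. (x + \<rho> *\<^sub>R c) + (\<rho> * \<delta>) *\<^sub>R y) ` unit_cube (basis_of (nu x))"
      \<comment> \<open>For \<open>\<rho> < r0\<close> the cubes lie in \<open>\<Omega>\<close>,
        where \<open>\<mu> \<epsilon>\<close> of a set is the energy on it for positive
        \<epsilon>.\<close>
      obtain r0 where r0: "r0 > 0" "ball x r0 \<subseteq> \<Omega>" using \<open>open \<Omega>\<close> x\<Omega> open_contains_ball by blast
      have "\<forall>\<^sub>F \<rho> in at_right 0. ennreal (t' * (\<rho> * \<delta>) ^ (CARD('N) - 1)) \<le>
        Liminf (at_right 0) (\<lambda>\<epsilon>. \<integral>\<^sup>+ x\<in>?C \<rho>. en \<epsilon> x \<partial>lebesgue)"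
        unfolding en_def
        by (rule cell_functional_blow_up[OF a(2) x\<Omega> a(6-8) B a(11,12) a(13)[OF x\<Omega>] a(14-16)
              a(27)[OF x] a(28)[OF x] a(29-33) a(35-37) \<delta> c _ t'(2)])
          (use t t' in auto)
      moreover have "\<forall>\<^sub>F \<rho> in at_right 0. 0 < \<rho> \<and> \<rho> < r0"
        using r0(1) by (auto simp: eventually_at_right_field)
      ultimately show "\<forall>\<^sub>F \<rho> in at_right 0. ennreal (t' * (\<rho> * \<delta>) ^ (CARD('N) - 1)) \<le>
        Liminf (at_right 0) (\<lambda>\<epsilon>. emeasure (\<mu> \<epsilon>) (?C \<rho>))"
      proof eventually_elim
        case (elim \<rho>)
        have "open (?C \<rho>)"
          using elim \<delta> by (intro open_affine_image open_unit_cube[OF B(1)]) auto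
        moreover have "?C \<rho> \<subseteq> \<Omega>"
        proof
          fix z assume "z \<in> ?C \<rho>"
          then obtain y where y: "y \<in> unit_cube (basis_of (nu x))" "z = (x + \<rho> *\<^sub>R c) + (\<rho> * \<delta>) *\<^sub>R y" by blast
          have "norm (c + \<delta> *\<^sub>R y) < 1" using c(2) y(1) by auto
          moreover have "z - x = \<rho> *\<^sub>R (c + \<delta> *\<^sub>R y)" using y(2) by (simp add: algebra_simps)
          ultimately have "norm (z - x) < \<rho>" using elim by simp
          then show "z \<in> \<Omega>" using elim r0(2) by (auto simp: dist_norm norm_minus_commute subset_eq)
        qed
        ultimately show ?case using elim Liminf_\<mu>[of "?C \<rho>"] by simp
      qed
    qed
  qed
  also have "\<dots> = Liminf (at_right 0) (\<lambda>\<epsilon>. \<integral>\<^sup>+ x\<in>\<Omega>. en \<epsilon> x \<partial>lebesgue)"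
    using \<open>open \<Omega>\<close> by (intro Liminf_\<mu>) auto
  finally show ?thesis unfolding en_def .
qed

end
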